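(* For every positive odd integer $k$, ${\cal G}'_k={\cal H}'_k$, where ${\cal G}'_k$ is the set of all graphs $G$ that contain no cycle of order less than $k$ and satisfy $\nu_k(F)=\tau_k(F)$ for every induced subgraph $F$ of $G$, and ${\cal H}'_k$ is the set of all graphs $G$ such that every non-trivial block $B$ of $G$ satisfies the following condition: $B=Sub_k(H)$ for some multigraph $H$, and every component $K$ of $G-V(H)$ that contains a vertex from $V(B)\setminus V(H)$ is a tree without a $k$-path.
   Context: Graphs are finite, simple, and undirected. Multigraphs are finite and undirected and may contain loops and parallel edges. The order of a graph, path or cycle is its number of vertices. For a positive integer $k$, a $k$-path in a graph $G$ is a (not necessarily induced) path in $G$ of order $k$; cycles in $G$ are likewise not necessarily induced. $\nu_k(G)$ is the maximum cardinality of a set of pairwise vertex-disjoint $k$-paths in $G$, and $\tau_k(G)$ is the minimum cardinality of a set of vertices of $G$ intersecting every $k$-path in $G$. A cutvertex of $G$ is a vertex $x$ of $G$ such that $G-x$ has more components than $G$. A block of $G$ is a maximal connected subgraph $B$ of $G$ such that $B$ itself has no cutvertex. A block is trivial if it is either $K_1$ or $K_2$. For a multigraph $H$, the $k$-subdivision $Sub_k(H)$ arises from $H$ by subdividing every edge exactly $k-1$ times, that is, every edge between distinct vertices $u$ and $v$ is replaced by a path of order $k+1$ between $u$ and $v$ whose internal vertices have degree $2$, and every loop incident with a vertex $u$ is replaced by a cycle of order $k$ containing $u$ and $k-1$ further vertices of degree $2$. In particular $V(H)\subseteq V(Sub_k(H))$, and when $B=Sub_k(H)$ the vertices of $H$ are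 regarded as vertices of $B$. Since blocks of graphs are simple graphs, $B=Sub_k(H)$ entails that $Sub_k(H)$ is a simple graph. *)

theory Defs
  imports Main
begin

section \<open>Simple graphs\<close>

record 'a sgraph =
  verts :: "'a set"
  edges :: "'a set set"

definition wf_sgraph :: "'a sgraph \<Rightarrow> bool" where
  "wf_sgraph G \<longleftrightarrow> finite (verts G) \<and> (\<forall>e \<in> edges G. e \<subseteq> verts G \<and> card e = 2)"

definition order :: "'a sgraph \<Rightarrow> nat" where
  "order G = card (verts G)"

definition subgraph :: "'a sgraph \<Rightarrow> 'a sgraph \<Rightarrow> bool" where
  "subgraph F G \<longleftrightarrow> wf_sgraph F \<and> verts F \<subseteq> verts G \<and> edges F \<subseteq> edges G"

definition induced_subgraph :: "'a sgraph \<Rightarrow> 'a sgraph \<Rightarrow> bool" where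
  "induced_subgraph F G \<longleftrightarrow> subgraph F G \<and> edges F = {e \<in> edges G. e \<subseteq> verts F}"

definition delete_verts :: "'a sgraph \<Rightarrow> 'a set \<Rightarrow> 'a sgraph" where
  "delete_verts G X = \<lparr>verts = verts G - X, edges = {e \<in> edges G. e \<inter> X = {}}\<rparr>"

definition complete :: "'a sgraph \<Rightarrow> bool" where
  "complete G \<longleftrightarrow> edges G = {{x, y} |x y. x \<in> verts G \<and> y \<in> verts G \<and> x \<noteq> y}"

section \<open>Paths, cycles and their packings and covers\<close>

text \<open>Paths and cycles are graphs, not vertex sequences, so that a path and its
  reversal are the same path.\<close>

definition path_edges :: "'a list \<Rightarrow> 'a set set" where
  "path_edges xs = {{xs ! i, xs ! Suc i} |i. Suc i < length xs}"

definition is_path :: "'a sgraph \<Rightarrow> bool" where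
  "is_path P \<longleftrightarrow> (\<exists>xs. xs \<noteq> [] \<and> distinct xs \<and>
     P = \<lparr>verts = set xs, edges = path_edges xs\<rparr>)"

definition is_cycle :: "'a sgraph \<Rightarrow> bool" where
  "is_cycle C \<longleftrightarrow> (\<exists>xs. 3 \<le> length xs \<and> distinct xs \<and>
     C = \<lparr>verts = set xs, edges = insert {last xs, hd xs} (path_edges xs)\<rparr>)"

definition k_paths :: "nat \<Rightarrow> 'a sgraph \<Rightarrow> 'a sgraph set" where
  "k_paths k G = {P. is_path P \<and> order P = k \<and> subgraph P G}"

definition path_packing :: "nat \<Rightarrow> 'a sgraph \<Rightarrow> 'a sgraph set \<Rightarrow> bool" where
  "path_packing k G \<P> \<longleftrightarrow>
     \<P> \<subseteq> k_paths k G \<and> pairwise (\<lambda>P Q. verts P \<inter> verts Q = {}) \<P>"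

definition path_cover :: "nat \<Rightarrow> 'a sgraph \<Rightarrow> 'a set \<Rightarrow> bool" where
  "path_cover k G T \<longleftrightarrow> T \<subseteq> verts G \<and> (\<forall>P \<in> k_paths k G. T \<inter> verts P \<noteq> {})"

text \<open>For finite \<open>G\<close> and \<open>k > 0\<close>, both sets below are finite and non-empty.\<close>

definition nu :: "nat \<Rightarrow> 'a sgraph \<Rightarrow> nat" where
  "nu k G = Max {card \<P> |\<P>. path_packing k G \<P>}"

definition tau :: "nat \<Rightarrow> 'a sgraph \<Rightarrow> nat" where
  "tau k G = Min {card T |T. path_cover k G T}"

section \<open>Components, trees and blocks\<close>

definition adj_rel :: "'a sgraph \<Rightarrow> 'a rel" where
  "adj_rel G = {(x, y). {x, y} \<in> edges G}"

definition connected_graph :: "'a sgraph \<Rightarrow> bool" where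
  "connected_graph G \<longleftrightarrow>
     verts G \<noteq> {} \<and> (\<forall>x \<in> verts G. \<forall>y \<in> verts G. (x, y) \<in> (adj_rel G)\<^sup>*)"

definition maximal_subgraph :: "('a sgraph \<Rightarrow> bool) \<Rightarrow> 'a sgraph \<Rightarrow> 'a sgraph \<Rightarrow> bool" where
  "maximal_subgraph P G K \<longleftrightarrow> subgraph K G \<and> P K \<and>
     (\<forall>K'. subgraph K' G \<and> P K' \<and> subgraph K K' \<longrightarrow> K' = K)"

definition components_of :: "'a sgraph \<Rightarrow> 'a sgraph set" where
  "components_of G = {K. maximal_subgraph connected_graph G K}"

definition is_tree :: "'a sgraph \<Rightarrow> bool" where
  "is_tree T \<longleftrightarrow> connected_graph T \<and> (\<nexists>C. is_cycle C \<and> subgraph C T)"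

definition cutvertex :: "'a sgraph \<Rightarrow> 'a \<Rightarrow> bool" where
  "cutvertex G x \<longleftrightarrow> x \<in> verts G \<and>
     card (components_of (delete_verts G {x})) > card (components_of G)"

definition blocks :: "'a sgraph \<Rightarrow> 'a sgraph set" where
  "blocks G = {B. maximal_subgraph (\<lambda>F. connected_graph F \<and> (\<nexists>x. cutvertex F x)) G B}"

definition trivial_block :: "'a sgraph \<Rightarrow> bool" where
  "trivial_block B \<longleftrightarrow> complete B \<and> (order B = 1 \<or> order B = 2)"

section \<open>Multigraphs and subdivisions\<close>

text \<open>A loop at \<open>u\<close> is an edge \<open>e\<close> with \<open>ends e = {u}\<close>.\<close>

record ('a, 'e) multigraph =
  mverts :: "'a set"
  medges :: "'e set"
  ends :: "'e \<Rightarrow> 'a set"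

definition wf_multigraph :: "('a, 'e) multigraph \<Rightarrow> bool" where
  "wf_multigraph H \<longleftrightarrow> finite (mverts H) \<and> finite (medges H) \<and>
     (\<forall>e \<in> medges H. ends H e \<subseteq> mverts H \<and> (card (ends H e) = 1 \<or> card (ends H e) = 2))"

datatype ('a, 'e) sub_vertex = Orig 'a | Inner 'e nat

text \<open>An arbitrary orientation of the edges, used only to number the subdivision vertices
  along each edge.\<close>

definition orient :: "('a, 'e) multigraph \<Rightarrow> 'e \<Rightarrow> 'a \<times> 'a" where
  "orient H e = (SOME (x, y). ends H e = {x, y})"

definition sub_point :: "nat \<Rightarrow> ('a, 'e) multigraph \<Rightarrow> 'e \<Rightarrow> nat \<Rightarrow> ('a, 'e) sub_vertex" where
  "sub_point k H e i =
     (if i = 0 then Orig (fst (orient H e))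
      else if i = k then Orig (snd (orient H e))
      else Inner e i)"

text \<open>For \<open>k > 0\<close>, the edge \<open>e\<close> is replaced by the \<open>k\<close> edges \<open>(e, 0), \<dots>, (e, k - 1)\<close>, passing
  through \<open>Inner e 1, \<dots>, Inner e (k - 1)\<close>. The result is a multigraph; for instance a loop
  yields a loop for \<open>k = 1\<close> and two parallel edges for \<open>k = 2\<close>.\<close>

definition Sub :: "nat \<Rightarrow> ('a, 'e) multigraph \<Rightarrow> (('a, 'e) sub_vertex, 'e \<times> nat) multigraph" where
  "Sub k H =
     \<lparr>mverts = Orig ` mverts H \<union> {Inner e i |e i. e \<in> medges H \<and> 0 < i \<and> i < k},
      medges = medges H \<times> {..<k},
      ends = (\<lambda>(e, i). {sub_point k H e i, sub_point k H e (Suc i)})\<rparr>"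

text \<open>\<open>B = Sub k H\<close> up to a multigraph isomorphism under which every vertex of \<open>H\<close> is itself
  a vertex of \<open>B\<close>. Bijectivity on edges forces \<open>Sub k H\<close> to be simple.\<close>

definition is_Sub :: "nat \<Rightarrow> ('a, 'e) multigraph \<Rightarrow> 'a sgraph \<Rightarrow> bool" where
  "is_Sub k H B \<longleftrightarrow> (\<exists>\<phi>.
     bij_betw \<phi> (mverts (Sub k H)) (verts B) \<and>
     bij_betw (\<lambda>d. \<phi> ` ends (Sub k H) d) (medges (Sub k H)) (edges B) \<and>
     (\<forall>v \<in> mverts H. \<phi> (Orig v) = v))"

lemma wf_multigraph_Sub:
  assumes "wf_multigraph H" "k > 0"
  shows "wf_multigraph (Sub k H)"
proof -
  have orient: "ends H e = {fst (orient H e), snd (orient H e)}" if e: "e \<in> medges H" for e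
  proof -
    from assms e have "card (ends H e) = 1 \<or> card (ends H e) = 2"
      by (simp add: wf_multigraph_def)
    then obtain x y where "ends H e = {x, y}"
      by (auto simp: card_1_singleton_iff card_2_iff)
    then have "case (x, y) of (x, y) \<Rightarrow> ends H e = {x, y}"
      by simp
    then have "case orient H e of (x, y) \<Rightarrow> ends H e = {x, y}"
      unfolding orient_def by (rule someI)
    then show ?thesis
      by (simp add: case_prod_beta)
  qed
  have "finite ((\<lambda>(e, i). Inner e i) ` (medges H \<times> {..<k}) :: ('a, 'b) sub_vertex set)"
    using assms by (simp add: wf_multigraph_def)
  then have "finite {Inner e i :: ('a, 'b) sub_vertex |e i. e \<in> medges H \<and> 0 < i \<and> i < k}"
    by (rule rev_finite_subset) auto
  moreover have "sub_point k H e i \<in> mverts (Sub k H)" if "e \<in> medges H" "i \<le> k" for e i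
    using that orient[of e] assms by (auto simp: sub_point_def Sub_def wf_multigraph_def)
  ultimately show ?thesis
    using assms by (auto simp: wf_multigraph_def Sub_def card_insert_if)
qed

section \<open>The two graph classes\<close>

definition \<G>' :: "nat \<Rightarrow> 'a sgraph set" where
  "\<G>' k = {G. wf_sgraph G \<and>
     (\<nexists>C. is_cycle C \<and> subgraph C G \<and> order C < k) \<and>
     (\<forall>F. induced_subgraph F G \<longrightarrow> nu k F = tau k F)}"

text \<open>As multigraphs are finite, it is no restriction to take the edges of \<open>H\<close> to be natural
  numbers.\<close>

definition \<H>' :: "nat \<Rightarrow> 'a sgraph set" where
  "\<H>' k = {G. wf_sgraph G \<and>
     (\<forall>B \<in> blocks G. \<not> trivial_block B \<longrightarrow>
       (\<exists>H :: ('a, nat) multigraph. wf_multigraph H \<and> is_Sub k H B \<and>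
         (\<forall>K \<in> components_of (delete_verts G (mverts H)).
            verts K \<inter> (verts B - mverts H) \<noteq> {} \<longrightarrow> is_tree K \<and> k_paths k K = {})))}"

end

theory Submission
  imports Defs
begin

text \<open>
Equality \<open>\<nu>\<^sub>k = \<tau>\<^sub>k\<close> on a vertex set \<open>X\<close> means that some packing and some cover of the \<open>k\<close>-paths inside
\<open>X\<close> have the same size.

Let every non-trivial block be a subdivision as in \<open>\<H>'\<close>. If \<open>X\<close> contains a cycle, take its block
\<open>B = Sub\<^sub>k(H)\<close> and the component \<open>D\<close> of the cycle in the graph induced by \<open>X \<inter> V(B)\<close>. The set \<open>W = V(H) \<inter> D\<close>
meets every \<open>k\<close>-path of \<open>X\<close> that meets \<open>D\<close>, since a path avoiding \<open>W\<close> would lie in a component of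
\<open>G - V(H)\<close>. As \<open>D\<close> is connected and contains a cycle, every vertex of \<open>W\<close> can be given a subdivided edge
of its own, which yields \<open>|W|\<close> disjoint \<open>k\<close>-paths in \<open>D\<close>. So \<open>D\<close> can be split off, and induction applies
to \<open>X - D\<close>. In a forest one splits off a minimal subtree containing a \<open>k\<close>-path.

Conversely, a cover of a cycle of order \<open>m\<close> has at least \<open>m / k\<close> vertices, so equality forces \<open>k\<close> to divide
the order of every cycle, induced or not. For a theta graph this makes the length of each of its three
paths divisible by \<open>k\<close>, because \<open>k\<close> is odd. Moreover, if a set consists of a cycle of order \<open>nk\<close> and fewer
than \<open>k\<close> further vertices, then a minimum cover of it is one of the \<open>k\<close> residue classes of the cycle. A path
of \<open>r\<close> vertices attached to the cycle at \<open>a\<close> excludes the classes at distance \<open>1, \<dots>, r\<close> from \<open>a\<close>; for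
\<open>r = (k - 1) / 2\<close> only the class of \<open>a\<close> itself remains. Ears of a cycle provide such paths, so all branch
vertices of a block on a common cycle are congruent and determine \<open>V(H)\<close>. If the block is a cycle, the
classes excluded by the attached paths form punctured balls in \<open>\<int>/k\<close>. If these covered \<open>\<int>/k\<close>, they would
still do so after shortening the paths to fewer than \<open>k\<close> vertices in total, which is impossible.
\<close>

section \<open>Covering a circle by punctured balls\<close>

text \<open>The obstacle is that a minimum cover is rigid only on a small set: beside a cycle of
  order \<open>n * k\<close> there is room for fewer than \<open>k\<close> further vertices before a
  packing of \<open>n + 1\<close> paths becomes possible. Two ears cut down to
  \<open>(k - 1) / 2\<close> vertices each just fit into this budget, which settles blocks with
  branch vertices. If the block is a cycle, arbitrarily many paths may be attached to it, and the
  budget is met only thanks to a purely combinatorial fact about coverings of the circle, which is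
  why that fact stands at the beginning. The balls are punctured because the \<open>k\<close>-path
  made of \<open>r\<close> pendant vertices at \<open>a\<close> and the \<open>k - r\<close> cycle
  vertices from \<open>a\<close> onwards contains \<open>a\<close> itself: it misses exactly the
  classes of the \<open>r\<close> vertices before \<open>a\<close>, never the class of
  \<open>a\<close>. Oddness of \<open>k\<close> cancels a factor 2 in the theta argument and ensures
  that no position is at distance \<open>k / 2\<close> from its two nearest class members. The value
  \<open>k = 1\<close> is treated apart, as the argument against chords needs
  \<open>k > 2\<close>.\<close>

definition punctured_ball :: "(int \<Rightarrow> int) \<Rightarrow> int \<Rightarrow> int set" where
  "punctured_ball r x = {p. p \<noteq> x \<and> \<bar>p - x\<bar> \<le> r x}"

lemma periodic_mult:
  fixes f :: "int \<Rightarrow> 'b"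
  assumes "\<And>x. f (x + k) = f x"
  shows "f (x + k * t) = f x"
proof (induction t rule: int_induct[of _ 0])
  case base then show ?case by simp
next
  case (step1 i)
  then show ?case using assms[of "x + k * i"] by (simp add: algebra_simps)
next
  case (step2 i)
  then show ?case using assms[of "x + k * (i - 1)"] by (simp add: algebra_simps)
qed

lemma periodic_mod:
  fixes f :: "int \<Rightarrow> 'b"
  assumes "\<And>x. f (x + k) = f x"
  shows "f (x mod k) = f x"
  using periodic_mult[of f k "x mod k" "x div k", OF assms] by (simp add: algebra_simps)

lemma periodic_cong:
  fixes f :: "int \<Rightarrow> 'b"
  assumes "\<And>x. f (x + k) = f x" "k dvd x - y"
  shows "f x = f y"
  using periodic_mult[of f k y, OF assms(1)] assms(2)
  by (metis add.commute diff_add_cancel dvd_def)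

text \<open>In a cover of minimal total radius every ball \<open>x\<close> has a private point \<open>tip x\<close> at distance exactly
  \<open>r x\<close>, in direction \<open>s x\<close>. The ball is charged to the \<open>r x\<close> points from \<open>x\<close> to \<open>tip x\<close>. These charges can
  only collide if \<open>tip x\<close> is itself a centre pointing back to \<open>x\<close>; then the charge of \<open>x\<close> is shifted beyond
  or around \<open>tip x\<close>. One point per period remains uncharged, so the total radius is less than \<open>k\<close>.\<close>

locale min_cover =
  fixes k :: int and r :: "int \<Rightarrow> int" and s :: "int \<Rightarrow> int"
  assumes kpos: "k > 0"
    and rper: "\<And>x. r (x + k) = r x"
    and sper: "\<And>x. s (x + k) = s x"
    and rnonneg: "\<And>x. 0 \<le> r x"
    and rbound: "\<And>x. 2 * r x < k"
    and cover: "\<And>p. \<exists>x. p \<in> punctured_ball r x"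
    and sval: "\<And>x. s x = 1 \<or> s x = -1"
    and priv: "\<And>x z. 0 < r x \<Longrightarrow> z \<noteq> x \<Longrightarrow> x + s x * r x \<notin> punctured_ball r z"
begin

definition tip where "tip x = x + s x * r x"

definition clash where "clash x \<longleftrightarrow> 0 < r (tip x) \<and> s (tip x) = - s x"

text \<open>Clashing balls of equal radius point at each other, and the points between them would be
  charged twice; moving each charge forward by half the radius places it around the tip and
  separates the two. By \<open>clash_cases\<close> the only other kind of clash has
  \<open>r (tip x) > 2 * r x\<close>; there the charge of \<open>x\<close> moves to the next
  \<open>r x\<close> points beyond its tip.\<close>

definition shift where
  "shift x = (if clash x then (if r (tip x) = r x then r x div 2 else r x) else 0)"

definition charge where "charge x j = x + s x * (shift x + j)"

lemma tip_per: "tip (x + k) = tip x + k"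
  by (simp add: tip_def rper sper)

lemma clash_per: "clash (x + k) = clash x"
  by (simp add: clash_def rper sper tip_per)

lemma charge_per: "charge (x + k) j = charge x j + k"
  by (simp add: charge_def shift_def clash_per rper sper tip_per)

lemma uncovered:
  assumes "0 < r x" "z \<noteq> x" shows "tip x = z \<or> r z < \<bar>tip x - z\<bar>"
  using priv[OF assms] by (auto simp: punctured_ball_def tip_def)

lemma tip_inj: "0 < r x \<Longrightarrow> 0 < r y \<Longrightarrow> tip x = tip y \<Longrightarrow> x = y"
  using uncovered[of x y] rnonneg sval[of y] unfolding tip_def by fastforce

text \<open>If \<open>tip x\<close> points back, its own tip has distance
  \<open>\<bar>r x - r (tip x)\<bar>\<close> from \<open>x\<close>. As a private point it is either
  \<open>x\<close> itself or further from \<open>x\<close> than \<open>r x\<close>.\<close>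

lemma clash_cases:
  assumes "0 < r x" "clash x"
  shows "r (tip x) = r x \<and> tip (tip x) = x \<or> r (tip x) > 2 * r x"
proof -
  have "tip x \<noteq> x" using assms sval[of x] by (auto simp: tip_def)
  then have "tip (tip x) = x \<or> r x < \<bar>tip (tip x) - x\<bar>"
    using uncovered[of "tip x" x] assms by (auto simp: clash_def)
  then show ?thesis using assms sval[of x] by (auto simp: tip_def clash_def)
qed

text \<open>Under a clash this is the index of a point that stays uncharged: the midpoint of
  \<open>x\<close> and \<open>tip x\<close> if the radii agree and are even, the first point beyond
  the charge if they agree and are odd, and \<open>tip x\<close> itself if they differ.\<close>

definition spare where
  "spare x = (if r (tip x) = r x \<and> odd (r x) then r x + 1 else 0)"

lemma charge_inj_aux:
  assumes "0 < r x" "1 \<le> i \<and> i \<le> r x \<or> clash x \<and> i = spare x"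
    and "1 \<le> j" "j \<le> r y" "charge x i = charge y j"
  shows "x = y"
proof (rule ccontr)
  assume ne: "x \<noteq> y"
  have pos: "0 < r x" "0 < r y" using assms by auto
  have ntip: "tip x \<noteq> tip y" using tip_inj ne pos by blast
  define X where "X = tip x"
  define Y where "Y = tip y"
  have nx: "X \<noteq> x" "Y \<noteq> y" using pos sval[of x] sval[of y] by (auto simp: X_def Y_def tip_def)
  have 1: "X = y \<or> r y < \<bar>X - y\<bar>" "Y = x \<or> r x < \<bar>Y - x\<bar>"
    using uncovered[of x y] uncovered[of y x] pos ne by (auto simp: X_def Y_def)
  have 2: "X = y \<or> X = Y \<or> r X < \<bar>Y - X\<bar>" "Y = x \<or> X = Y \<or> r Y < \<bar>X - Y\<bar>"
    using uncovered[of y X] uncovered[of x Y] pos nx by (auto simp: X_def Y_def)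
  have cX: "X \<noteq> Y" using ntip by (simp add: X_def Y_def)
  have tX: "X = x + s x * r x" "Y = y + s y * r y" by (auto simp: X_def Y_def tip_def)
  have 3: "clash x \<Longrightarrow> (r X = r x \<and> tip X = x) \<or> r X > 2 * r x" "clash y \<Longrightarrow> (r Y = r y \<and> tip Y = y) \<or> r Y > 2 * r y"
    using clash_cases pos by (auto simp: X_def Y_def)
  have 4: "clash x \<longleftrightarrow> 0 < r X \<and> s X = - s x" "clash y \<longleftrightarrow> 0 < r Y \<and> s Y = - s y"
    by (auto simp: clash_def X_def Y_def)
  have 5: "clash x \<Longrightarrow> X \<noteq> y \<Longrightarrow> tip X = y \<or> r y < \<bar>tip X - y\<bar>"
     "clash y \<Longrightarrow> Y \<noteq> x \<Longrightarrow> tip Y = x \<or> r x < \<bar>tip Y - x\<bar>"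
    using uncovered[of X y] uncovered[of Y x] 4 by auto
  have 6: "clash x \<Longrightarrow> X \<noteq> Y \<Longrightarrow> tip X = Y \<or> r Y < \<bar>tip X - Y\<bar>"
     "clash y \<Longrightarrow> Y \<noteq> X \<Longrightarrow> tip Y = X \<or> r X < \<bar>tip Y - X\<bar>"
    using uncovered[of X Y] uncovered[of Y X] 4 by auto
  have tt: "tip X = X + s X * r X" "tip Y = Y + s Y * r Y" by (auto simp: tip_def)
  have 7: "tip x = tip Y \<Longrightarrow> clash y \<Longrightarrow> x = Y" "tip y = tip X \<Longrightarrow> clash x \<Longrightarrow> y = X"
    using tip_inj[of x Y] tip_inj[of y X] pos 4 by auto
  have sh: "shift x = (if clash x then (if r X = r x then r x div 2 else r x) else 0)"
    "shift y = (if clash y then (if r Y = r y then r y div 2 else r y) else 0)"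
    by (auto simp: shift_def X_def Y_def)
  have eq: "x + s x * (shift x + i) = y + s y * (shift y + j)"
    using assms by (simp add: charge_def)
  have nn: "r X \<ge> 0" "r Y \<ge> 0" using rnonneg by auto
  \<comment> \<open>Radii, tips, directions and shifts become variables. Once the two directions and
    the two clash conditions are fixed, all collected facts are linear.\<close>
  define rx ry rX rY where "rx = r x" "ry = r y" "rX = r X" "rY = r Y"
  note d = this[symmetric]
  define tX tY where "tX = tip X" "tY = tip Y"
  note d = d this[symmetric]
  define sx sy where "sx = s x" "sy = s y"
  note d = d this[symmetric]
  have sX: "clash x \<Longrightarrow> tX = X - sx * rX" "clash y \<Longrightarrow> tY = Y - sy * rY"
    using tt 4 d by auto
  have sgn: "sx = 1 \<or> sx = -1" "sy = 1 \<or> sy = -1" using sval d by metis+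
  have C: "\<not> clash x \<Longrightarrow> X = y \<Longrightarrow> sx = sy" "\<not> clash y \<Longrightarrow> Y = x \<Longrightarrow> sx = sy"
    "clash x \<Longrightarrow> X = y \<Longrightarrow> sy = - sx" "clash y \<Longrightarrow> Y = x \<Longrightarrow> sy = - sx"
    "X = y \<Longrightarrow> rX = ry \<and> tX = Y" "Y = x \<Longrightarrow> rY = rx \<and> tY = X"
    using 4 pos sgn d by (auto simp: d X_def Y_def)
  have lin: "sx = 1 \<Longrightarrow> X = x + rx" "sx = -1 \<Longrightarrow> X = x - rx"
    "sy = 1 \<Longrightarrow> Y = y + ry" "sy = -1 \<Longrightarrow> Y = y - ry"
    "clash x \<Longrightarrow> sx = 1 \<Longrightarrow> tX = X - rX" "clash x \<Longrightarrow> sx = -1 \<Longrightarrow> tX = X + rX"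
    "clash y \<Longrightarrow> sy = 1 \<Longrightarrow> tY = Y - rY" "clash y \<Longrightarrow> sy = -1 \<Longrightarrow> tY = Y + rY"
    using tX sX by (auto simp: d)
  define shx shy where "shx = shift x" "shy = shift y"
  note dsh = this[symmetric]
  have eql: "sx = 1 \<Longrightarrow> sy = 1 \<Longrightarrow> x + (shx + i) = y + (shy + j)"
    "sx = 1 \<Longrightarrow> sy = -1 \<Longrightarrow> x + (shx + i) = y - (shy + j)"
    "sx = -1 \<Longrightarrow> sy = 1 \<Longrightarrow> x - (shx + i) = y + (shy + j)"
    "sx = -1 \<Longrightarrow> sy = -1 \<Longrightarrow> x - (shx + i) = y - (shy + j)"
    using eq by (auto simp: d dsh)
  have shl: "\<not> clash x \<Longrightarrow> shx = 0" "clash x \<Longrightarrow> rX = rx \<Longrightarrow> 2 * shx \<le> rx \<and> rx \<le> 2 * shx + 1"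
     "clash x \<Longrightarrow> rX \<noteq> rx \<Longrightarrow> shx = rx"
     "\<not> clash y \<Longrightarrow> shy = 0" "clash y \<Longrightarrow> rY = ry \<Longrightarrow> 2 * shy \<le> ry \<and> ry \<le> 2 * shy + 1"
     "clash y \<Longrightarrow> rY \<noteq> ry \<Longrightarrow> shy = ry"
    using sh by (auto simp: d dsh)
  have spl: "1 \<le> i \<and> i \<le> rx \<or> clash x \<and> (i = 0 \<and> (rX = rx \<longrightarrow> 2 * shx = rx) \<or> i = rx + 1 \<and> rX = rx \<and> 2 * shx + 1 = rx)"
  proof -
    have sp: "spare x = (if rX = rx \<and> odd rx then rx + 1 else 0)"
      unfolding spare_def X_def[symmetric] d ..
    have "clash x \<Longrightarrow> rX = rx \<Longrightarrow> shx = rx div 2" using sh by (simp add: d dsh)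
    then show ?thesis using assms(2) unfolding sp d by (cases "odd rx"; cases "rX = rx") (auto elim: oddE evenE)
  qed
  note facts = spl assms(3-4) pos ne nx 1 2 cX nn
  note facts' = facts[unfolded d] 3[unfolded d] 5[unfolded d] 6[unfolded d] lin eql shl C
  consider (00) "\<not> clash x" "\<not> clash y" | (10) "clash x" "\<not> clash y" | (01) "\<not> clash x" "clash y"
    | (11) "clash x" "clash y" by blast
  then show False
  proof cases
    case 00
    from sgn show False
      by (elim disjE) (use 00 facts' in \<open>smt (z3)\<close>)+
  next
    case 10
    from sgn show False
      by (elim disjE) (use 10 facts' in \<open>smt (z3)\<close>)+
  next
    case 01
    from sgn show False
      by (elim disjE) (use 01 facts' in \<open>smt (z3)\<close>)+
  next
    case 11
    from sgn show False
      by (elim disjE) (use 11 facts' in \<open>smt (z3)\<close>)+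
  qed
qed

lemma charge_inj:
  assumes "1 \<le> i" "i \<le> r x" "1 \<le> j" "j \<le> r y" "charge x i = charge y j"
  shows "x = y \<and> i = j"
proof -
  have "x = y" using charge_inj_aux[of x i j y] assms by auto
  then show ?thesis using assms sval[of x] by (auto simp: charge_def)
qed

lemma charge_spare:
  assumes "0 < r x" "clash x" "1 \<le> j" "j \<le> r y"
  shows "charge x (spare x) \<noteq> charge y j"
proof
  assume eq: "charge x (spare x) = charge y j"
  have "x = y" using charge_inj_aux[of x "spare x" j y] assms eq by auto
  then show False using assms eq sval[of x] by (auto simp: charge_def spare_def split: if_splits)
qed

text \<open>The point \<open>x\<close> is itself charged, say to \<open>w\<close>. If the charge of
  \<open>w\<close> continues past \<open>x\<close>, one of its neighbouring points collides with the
  first charge of \<open>x\<close>, unless \<open>x\<close> is next to \<open>w\<close> and points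
  back at it. In that case one of the two tips lies in the other ball. So \<open>x\<close> is the
  last point charged to \<open>w\<close>.\<close>

lemma chain_predecessor:
  assumes noclash: "\<And>x. 0 < r x \<Longrightarrow> \<not> clash x"
    and full: "\<And>p. \<exists>x j. 1 \<le> j \<and> j \<le> r x \<and> charge x j = p"
    and x: "0 < r x"
  obtains w where "0 < r w" "tip w = x" "s w = s x"
proof -
  have ch: "charge y j = y + s y * j" if "0 < r y" for y j
    using noclash[OF that] by (simp add: charge_def shift_def)
  obtain w j where w: "1 \<le> j" "j \<le> r w" "charge w j = x" using full by blast
  then have rw: "0 < r w" by simp
  have eq: "x = w + s w * j" using w ch[OF rw] by simp
  have wx: "w \<noteq> x" using eq w sval[of w] by auto
  show thesis
  proof (cases "j = r w")
    case True
    then have "tip w = x" using eq by (simp add: tip_def)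
    moreover have "s w = s x" using noclash[OF rw] \<open>tip w = x\<close> x sval[of w] sval[of x]
      by (auto simp: clash_def)
    ultimately show ?thesis using that rw by blast
  next
    case False
    then have j: "j + 1 \<le> r w" using w by simp
    have ss: "s x = - s w"
    proof (rule ccontr)
      assume "s x \<noteq> - s w"
      then have "s x = s w" using sval[of w] sval[of x] by auto
      then have "charge w (j + 1) = charge x 1" using eq unfolding ch[OF rw] ch[OF x] by (simp add: algebra_simps)
      then show False using charge_inj[of "j + 1" w 1 x] w j x wx by auto
    qed
    have j1: "j = 1"
    proof (rule ccontr)
      assume "j \<noteq> 1"
      moreover have "charge w (j - 1) = charge x 1" using eq ss unfolding ch[OF rw] ch[OF x] by (simp add: algebra_simps)
      ultimately show False using charge_inj[of "j - 1" w 1 x] w j x wx by auto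
    qed
    have u: "tip w = x \<or> r x < \<bar>tip w - x\<bar>" "tip x = w \<or> r w < \<bar>tip x - w\<bar>"
      using uncovered[of w x] uncovered[of x w] rw x wx by auto
    have "tip x \<noteq> w" using noclash[OF x] ss rw by (auto simp: clash_def)
    then show ?thesis using u j1 eq ss j sval[of w] x by (auto simp: tip_def)
  qed
qed

text \<open>A clash supplies a spare point. If there is no clash and every point is charged, two
  predecessor steps from a ball \<open>x\<close> of maximal radius give \<open>v\<close>,
  \<open>w\<close>, \<open>x\<close> in one direction; then \<open>tip v = w\<close> has distance
  \<open>r w \<le> r x\<close> from \<open>x\<close>, against its privacy.\<close>

lemma spare_point: "\<exists>p. \<forall>x j. 1 \<le> j \<and> j \<le> r x \<longrightarrow> charge x j \<noteq> p"
proof (rule ccontr)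
  assume "\<not> ?thesis"
  then have full: "\<And>p. \<exists>x j. 1 \<le> j \<and> j \<le> r x \<and> charge x j = p" by blast
  then have noclash: "\<And>x. 0 < r x \<Longrightarrow> \<not> clash x"
    by (metis charge_spare)
  define m where "m = Max (r ` {0..<k})"
  have le: "r x \<le> m" for x
    using periodic_mod[of r k x, OF rper] kpos unfolding m_def
    by (metis Max_ge atLeastLessThan_iff finite_atLeastLessThan_int finite_imageI image_eqI
        pos_mod_bound pos_mod_sign)
  have "m \<in> r ` {0..<k}" unfolding m_def using kpos by (intro Max_in) auto
  then obtain x where x: "r x = m" by auto
  obtain y where "0 \<in> punctured_ball r y" using cover by blast
  then have "0 < r y" by (auto simp: punctured_ball_def)
  then have xp: "0 < r x" using le[of y] x by simp
  obtain w where w: "0 < r w" "tip w = x" "s w = s x"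
    using chain_predecessor[OF noclash full xp] by blast
  obtain v where v: "0 < r v" "tip v = w" "s v = s w"
    using chain_predecessor[OF noclash full w(1)] by blast
  have "x \<noteq> v" using w v sval[of v] by (auto simp: tip_def)
  then have "tip v = x \<or> r x < \<bar>tip v - x\<bar>" using uncovered[of v x] v by auto
  then show False using v w sval[of w] le[of w] x by (auto simp: tip_def)
qed

text \<open>Charges commute with translation by \<open>k\<close>. Hence they stay distinct modulo
  \<open>k\<close>, and all of them miss the residue of the spare point.\<close>

lemma sum_radius_less: "(\<Sum>x\<in>{0..<k}. r x) < k"
proof -
  obtain q where q: "\<And>x j. 1 \<le> j \<Longrightarrow> j \<le> r x \<Longrightarrow> charge x j \<noteq> q"
    using spare_point by blast
  define S where "S = (SIGMA x:{0..<k}. {1..r x})"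
  define f where "f = (\<lambda>(x, j). charge x j mod k)"
  have chm: "charge (x + k * t) j = charge x j + k * t" for x t j
  proof -
    have "(\<lambda>x. charge x j - x) (x + k * t) = (\<lambda>x. charge x j - x) x"
      by (rule periodic_mult) (simp add: charge_per)
    then show ?thesis by simp
  qed
  have shift_eq: "\<exists>t. a = b + k * t" if "a mod k = b mod k" for a b :: int
    using that by (metis mod_eqE)
  have "inj_on f S"
  proof (rule inj_onI, clarsimp simp: f_def S_def)
    fix x i y j
    assume A: "0 \<le> x" "x < k" "1 \<le> i" "i \<le> r x" "0 \<le> y" "y < k" "1 \<le> j" "j \<le> r y"
      "charge x i mod k = charge y j mod k"
    obtain t where "charge x i = charge y j + k * t" using shift_eq[OF A(9)] by blast
    then have "charge x i = charge (y + k * t) j" by (simp add: chm)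
    moreover have "r (y + k * t) = r y" using periodic_mult[of r k y t, OF rper] .
    ultimately have *: "x = y + k * t \<and> i = j" using charge_inj[of i x j "y + k * t"] A by auto
    then have "x mod k = y mod k" by simp
    moreover have "x mod k = x" "y mod k = y" using A by simp_all
    ultimately show "x = y \<and> i = j" using * by (metis (no_types))
  qed
  moreover have "f ` S \<subseteq> {0..<k} - {q mod k}"
  proof (clarsimp simp: f_def S_def kpos)
    fix x j assume A: "0 \<le> x" "x < k" "1 \<le> j" "j \<le> r x" "charge x j mod k = q mod k"
    obtain t where "q = charge x j + k * t" using shift_eq[of q "charge x j"] A(5) by auto
    then have "charge (x + k * t) j = q" by (simp add: chm)
    then show False using q[of j "x + k * t"] A periodic_mult[of r k x t, OF rper] by auto
  qed
  ultimately have "card S \<le> card ({0..<k} - {q mod k})"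
    by (metis card_image card_mono finite_Diff finite_atLeastLessThan_int)
  also have "\<dots> < nat k" using kpos by (simp add: card_Diff_singleton)
  finally have "int (card S) < k" using kpos by simp
  moreover have "int (card S) = (\<Sum>x\<in>{0..<k}. r x)"
    unfolding S_def by (simp add: card_SigmaI rnonneg)
  ultimately show ?thesis by simp
qed

end

text \<open>Minimality provides the private points demanded by \<open>min_cover\<close>: if the
  radius of one residue class is lowered by one, some point becomes uncovered, and this point was an
  end point of exactly one ball.\<close>

theorem punctured_cover_truncation:
  fixes k :: int and h :: "int \<Rightarrow> int"
  assumes k: "k > 0" and hper: "\<And>x. h (x + k) = h x" and hnn: "\<And>x. 0 \<le> h x"
    and hb: "\<And>x. 2 * h x < k" and hcov: "\<And>p. \<exists>x. p \<in> punctured_ball h x"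
  obtains r where "\<And>x. r (x + k) = r x" "\<And>x. 0 \<le> r x" "\<And>x. r x \<le> h x"
    "\<And>p. \<exists>x. p \<in> punctured_ball r x" "(\<Sum>x\<in>{0..<k}. r x) < k"
proof -
  define Q where "Q r \<longleftrightarrow> (\<forall>x. r (x + k) = r x) \<and> (\<forall>x. 0 \<le> r x \<and> r x \<le> h x)
    \<and> (\<forall>p. \<exists>x. p \<in> punctured_ball r x)" for r
  have "Q h" using assms by (auto simp: Q_def)
  then obtain r where r: "Q r" and min: "\<And>r'. Q r' \<Longrightarrow> nat (\<Sum>x\<in>{0..<k}. r x) \<le> nat (\<Sum>x\<in>{0..<k}. r' x)"
    using ex_has_least_nat[of Q h "\<lambda>r. nat (\<Sum>x\<in>{0..<k}. r x)"] by blast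
  have rper: "r (x + k) = r x" and rnn: "0 \<le> r x" and rh: "r x \<le> h x" for x
    using r by (auto simp: Q_def)
  have rcov: "\<exists>x. p \<in> punctured_ball r x" for p using r by (auto simp: Q_def)
  define P where "P x e \<longleftrightarrow> (\<forall>z. z \<noteq> x \<longrightarrow> x + e * r x \<notin> punctured_ball r z)" for x e :: int
  have Pper: "P (x + k) e = P x e" for x e
  proof -
    have *: "p + k \<in> punctured_ball r (z + k) \<longleftrightarrow> p \<in> punctured_ball r z" for p z
      by (simp add: punctured_ball_def rper)
    have sh: "(\<forall>z. F z) \<longleftrightarrow> (\<forall>z. F (z + k))" for F :: "int \<Rightarrow> bool"
      by (metis diff_add_cancel)
    have "x + k + e * r (x + k) = (x + e * r x) + k" by (simp add: rper)
    then show ?thesis unfolding P_def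
      by (subst sh) (simp only: * add_right_cancel)
  qed
  have ex: "P x 1 \<or> P x (-1)" if x: "0 < r x" for x
  proof -
    \<comment> \<open>The whole residue class of \<open>x\<close> is lowered, since the radii have
      to stay periodic.\<close>
    define r' where "r' y = (if k dvd y - x then r y - 1 else r y)" for y
    have rx: "r y = r x" if "k dvd y - x" for y
      using periodic_cong[of r k y x, OF rper that] .
    have per: "r' (y + k) = r' y" for y
    proof -
      have "k dvd y + k - x \<longleftrightarrow> k dvd y - x"
        by (metis add_diff_eq diff_add_eq dvd_add_triv_right_iff)
      then show ?thesis by (simp add: r'_def rper)
    qed
    have bnd: "0 \<le> r' y" "r' y \<le> r y" for y
      using rx[of y] x rnn[of y] by (auto simp: r'_def)
    have "k dvd x mod k - x" by (metis dvd_minus_mod minus_diff_eq dvd_minus_iff)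
    then have "r' (x mod k) < r (x mod k)" by (simp add: r'_def)
    then have "(\<Sum>y\<in>{0..<k}. r' y) < (\<Sum>y\<in>{0..<k}. r y)"
      using k bnd by (intro sum_strict_mono_ex1) auto
    moreover have "0 \<le> (\<Sum>y\<in>{0..<k}. r' y)" using bnd by (intro sum_nonneg) auto
    ultimately have "\<not> Q r'" using min[of r'] by linarith
    moreover have "r' y \<le> h y" for y using bnd[of y] rh[of y] by linarith
    ultimately obtain p where p: "\<And>y. p \<notin> punctured_ball r' y"
      using per bnd(1) by (auto simp: Q_def)
    obtain z where z: "p \<in> punctured_ball r z" using rcov by blast
    have zx: "k dvd z - x" using p[of z] z by (auto simp: punctured_ball_def r'_def split: if_splits)
    have pz: "\<bar>p - z\<bar> = r z" using p[of z] z zx by (auto simp: punctured_ball_def r'_def)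
    \<comment> \<open>Two balls of one class that share \<open>p\<close> have centres at distance at
      most \<open>2 * r x < k\<close>, so the centres coincide. This is the use of the bound on
      \<open>h\<close>.\<close>
    have other: "p \<notin> punctured_ball r y" if "y \<noteq> z" for y
    proof
      assume py: "p \<in> punctured_ball r y"
      then have yx: "k dvd y - x" using p[of y] by (auto simp: punctured_ball_def r'_def split: if_splits)
      then have "k dvd y - z" using zx by (metis diff_diff_eq2 diff_add_cancel dvd_diff)
      moreover have "\<bar>y - z\<bar> \<le> 2 * r x" using pz py rx[OF yx] rx[OF zx]
        by (auto simp: punctured_ball_def)
      moreover have "2 * r x < k" using hb[of x] rh[of x] by linarith
      ultimately show False using that
        by (metis dvd_imp_le_int abs_of_pos eq_iff_diff_eq_0 k le_less_trans not_le)
    qed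
    have "P z 1 \<or> P z (-1)"
    proof (cases "p = z + r z")
      case True then show ?thesis using other by (auto simp: P_def)
    next
      case False
      then have "p = z + - 1 * r z" using pz by auto
      then show ?thesis using other unfolding P_def by blast
    qed
    then show ?thesis using periodic_cong[of "\<lambda>x. P x e" k z x for e, OF Pper zx] by auto
  qed
  define s where "s x = (if P x 1 then 1 else -1 :: int)" for x
  interpret min_cover k r s
  proof
    show "x + s x * r x \<notin> punctured_ball r z" if "0 < r x" "z \<noteq> x" for x z
    proof -
      have "P x (s x)" using ex[OF that(1)] by (auto simp: s_def)
      then show ?thesis using that by (auto simp: P_def)
    qed
    show "2 * r x < k" for x using hb[of x] rh[of x] by linarith
  qed (use k rper rnn rcov in \<open>auto simp: s_def Pper\<close>)
  show thesis using that[OF rper rnn rh rcov sum_radius_less] .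
qed

section \<open>Paths as vertex lists\<close>

abbreviation walk :: "'a sgraph \<Rightarrow> 'a list \<Rightarrow> bool" where
  "walk G \<equiv> successively (\<lambda>x y. {x, y} \<in> edges G)"

definition gpath :: "'a sgraph \<Rightarrow> 'a list \<Rightarrow> bool" where
  "gpath G xs \<longleftrightarrow> xs \<noteq> [] \<and> distinct xs \<and> set xs \<subseteq> verts G \<and>
     walk G xs"

text \<open>Packings and covers depend only on the vertex sets of paths, so paths with equal vertex
  sets are identified. The restriction to \<open>X\<close> stands for passing to an induced
  subgraph.\<close>

definition kpath_sets :: "nat \<Rightarrow> 'a sgraph \<Rightarrow> 'a set \<Rightarrow> 'a set set" where
  "kpath_sets k G X = {set xs |xs. gpath G xs \<and> length xs = k \<and> set xs \<subseteq> X}"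

definition induced :: "'a sgraph \<Rightarrow> 'a set \<Rightarrow> 'a sgraph" where
  "induced G X = \<lparr>verts = X, edges = {e \<in> edges G. e \<subseteq> X}\<rparr>"

definition konig :: "nat \<Rightarrow> 'a sgraph \<Rightarrow> 'a set \<Rightarrow> bool" where
  "konig k G X \<longleftrightarrow> (\<exists>M T. M \<subseteq> kpath_sets k G X \<and> pairwise disjnt M \<and>
     T \<subseteq> X \<and> (\<forall>S \<in> kpath_sets k G X. T \<inter> S \<noteq> {}) \<and> card M = card T)"

lemma induced_simps [simp]: "verts (induced G X) = X" "edges (induced G X) = {e \<in> edges G. e \<subseteq> X}"
  by (simp_all add: induced_def)

lemma wf_induced: "wf_sgraph G \<Longrightarrow> X \<subseteq> verts G \<Longrightarrow> wf_sgraph (induced G X)"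
  by (auto simp: wf_sgraph_def intro: finite_subset)

lemma induced_subgraph_iff:
  "wf_sgraph G \<Longrightarrow> induced_subgraph F G \<longleftrightarrow> (\<exists>X \<subseteq> verts G. F = induced G X)"
  using wf_induced[of G]
  by (auto simp: induced_subgraph_def subgraph_def induced_def intro: sgraph.equality)

lemma path_edges_subset_iff:
  "path_edges xs \<subseteq> E \<longleftrightarrow> successively (\<lambda>x y. {x, y} \<in> E) xs"
  by (auto simp: path_edges_def successively_conv_nth)

lemma edge_ne: "wf_sgraph G \<Longrightarrow> {x, y} \<in> edges G \<Longrightarrow> x \<noteq> y"
  by (auto simp: wf_sgraph_def)

lemma edge_verts: "wf_sgraph G \<Longrightarrow> {x, y} \<in> edges G \<Longrightarrow> x \<in> verts G \<and> y \<in> verts G"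
  by (auto simp: wf_sgraph_def)

lemma wf_path: "distinct xs \<Longrightarrow> wf_sgraph \<lparr>verts = set xs, edges = path_edges xs\<rparr>"
  by (auto simp: wf_sgraph_def path_edges_def card_insert_if nth_eq_iff_index_eq)

lemma k_paths_iff:
  "P \<in> k_paths k G \<longleftrightarrow> (\<exists>xs. gpath G xs \<and> length xs = k \<and> P = \<lparr>verts = set xs, edges = path_edges xs\<rparr>)"
proof -
  have "subgraph \<lparr>verts = set xs, edges = path_edges xs\<rparr> G \<longleftrightarrow>
    set xs \<subseteq> verts G \<and> walk G xs" if "distinct xs" for xs
    using wf_path[OF that] by (simp add: subgraph_def path_edges_subset_iff)
  note sub = this
  have "P \<in> k_paths k G \<longleftrightarrow> (\<exists>xs. xs \<noteq> [] \<and> distinct xs \<and>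
    P = \<lparr>verts = set xs, edges = path_edges xs\<rparr> \<and> card (verts P) = k \<and> subgraph P G)"
    unfolding k_paths_def is_path_def order_def by blast
  also have "\<dots> \<longleftrightarrow> (\<exists>xs. gpath G xs \<and> length xs = k \<and> P = \<lparr>verts = set xs, edges = path_edges xs\<rparr>)"
    by (intro ex_cong1) (use sub in \<open>auto simp: gpath_def distinct_card\<close>)
  finally show ?thesis .
qed

lemma gpath_induced: "gpath (induced G X) xs \<longleftrightarrow> set xs \<subseteq> X \<and> xs \<noteq> [] \<and> distinct xs \<and>
     walk G xs"
proof -
  have "successively (\<lambda>x y. {x, y} \<in> edges (induced G X)) xs \<longleftrightarrow>
    walk G xs" if "set xs \<subseteq> X"
    by (rule successively_cong) (use that in auto)
  then show ?thesis unfolding gpath_def by auto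
qed

lemma kpath_sets_eq: "X \<subseteq> verts G \<Longrightarrow> kpath_sets k G X = verts ` k_paths k (induced G X)"
proof -
  assume "X \<subseteq> verts G"
  then have "gpath G xs \<and> length xs = k \<and> set xs \<subseteq> X \<longleftrightarrow> gpath (induced G X) xs \<and> length xs = k" for xs
    unfolding gpath_induced unfolding gpath_def by auto
  then have "kpath_sets k G X = {set xs |xs. gpath (induced G X) xs \<and> length xs = k}"
    unfolding kpath_sets_def by simp
  also have "\<dots> = verts ` k_paths k (induced G X)"
  proof (intro set_eqI iffI)
    fix S assume "S \<in> verts ` k_paths k (induced G X)"
    then obtain P where P: "P \<in> k_paths k (induced G X)" "S = verts P" by blast
    from P(1)[unfolded k_paths_iff] obtain xs where "gpath (induced G X) xs" "length xs = k"
      "P = \<lparr>verts = set xs, edges = path_edges xs\<rparr>" by (elim exE conjE)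
    then show "S \<in> {set xs |xs. gpath (induced G X) xs \<and> length xs = k}" using P(2) by auto
  next
    fix S assume "S \<in> {set xs |xs. gpath (induced G X) xs \<and> length xs = k}"
    then obtain xs where xs: "gpath (induced G X) xs" "length xs = k" "S = set xs" by blast
    then have "\<lparr>verts = set xs, edges = path_edges xs\<rparr> \<in> k_paths k (induced G X)"
      unfolding k_paths_iff by (intro exI[of _ xs]) simp
    then show "S \<in> verts ` k_paths k (induced G X)" using xs(3) by force
  qed
  finally show ?thesis .
qed

lemma kpath_sets_mono: "X \<subseteq> Y \<Longrightarrow> kpath_sets k G X \<subseteq> kpath_sets k G Y"
  by (auto simp: kpath_sets_def)

lemma kpath_setsD: "S \<in> kpath_sets k G X \<Longrightarrow> S \<subseteq> X \<and> card S = k \<and> finite S"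
  by (auto simp: kpath_sets_def gpath_def distinct_card)

lemma kpath_sets_restrict: "S \<in> kpath_sets k G X \<Longrightarrow> S \<subseteq> Y \<Longrightarrow> S \<in> kpath_sets k G Y"
  by (auto simp: kpath_sets_def)

text \<open>Choosing a cover vertex in every member is injective by disjointness; finiteness of
  \<open>M\<close> comes out as well.\<close>

lemma packing_le_cover:
  assumes "pairwise disjnt M" "finite T" "\<And>S. S \<in> M \<Longrightarrow> T \<inter> S \<noteq> {}"
  shows "finite M" "card M \<le> card T"
proof -
  have "\<forall>S\<in>M. \<exists>x. x \<in> T \<inter> S" using assms(3) by (auto simp: ex_in_conv)
  from bchoice[OF this] obtain f where f: "\<And>S. S \<in> M \<Longrightarrow> f S \<in> T \<inter> S" by blast
  have "inj_on f M"
  proof (rule inj_onI, rule ccontr)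
    fix S S' assume S: "S \<in> M" "S' \<in> M" "f S = f S'" "S \<noteq> S'"
    then have "disjnt S S'" using assms(1) by (simp add: pairwise_def)
    then show False using f[OF S(1)] f[OF S(2)] S(3) by (auto simp: disjnt_def)
  qed
  moreover have "f ` M \<subseteq> T" using f by blast
  ultimately show "finite M" "card M \<le> card T"
    using assms(2) by (auto intro: inj_on_finite card_inj_on_le)
qed

text \<open>Every packing size is at most every cover size, so the maximum of the former equals the
  minimum of the latter exactly if some number is of both kinds.\<close>

lemma nu_eq_tau_iff_konig:
  assumes "k > 0" "wf_sgraph G" "X \<subseteq> verts G"
  shows "nu k (induced G X) = tau k (induced G X) \<longleftrightarrow> konig k G X"
proof -
  have fin: "finite X" using assms finite_subset by (auto simp: wf_sgraph_def)
  define A where "A = {card M |M. M \<subseteq> kpath_sets k G X \<and> pairwise disjnt M}"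
  define B where "B = {card T |T. T \<subseteq> X \<and> (\<forall>S \<in> kpath_sets k G X. T \<inter> S \<noteq> {})}"
  have ne: "S \<noteq> {}" if "S \<in> kpath_sets k G X" for S using kpath_setsD[OF that] assms(1) by auto
  have A: "{card \<P> |\<P>. path_packing k (induced G X) \<P>} = A"
  proof (intro set_eqI iffI)
    fix c assume "c \<in> {card \<P> |\<P>. path_packing k (induced G X) \<P>}"
    then obtain P where P: "path_packing k (induced G X) P" "c = card P" by blast
    have sub: "P \<subseteq> k_paths k (induced G X)"
      and dj: "\<And>p q. p \<in> P \<Longrightarrow> q \<in> P \<Longrightarrow> p \<noteq> q \<Longrightarrow> verts p \<inter> verts q = {}"
      using P by (auto simp: path_packing_def pairwise_def)
    have kpath_sets: "verts p \<in> kpath_sets k G X" if "p \<in> P" for p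
      using that sub kpath_sets_eq[OF assms(3), of k] by auto
    have "inj_on verts P"
      using dj ne kpath_sets by (metis inf.idem inj_onI)
    moreover have "pairwise disjnt (verts ` P)"
      using dj by (auto simp: pairwise_def disjnt_def)
    ultimately show "c \<in> A" unfolding A_def P(2) using kpath_sets
      by (intro CollectI exI[of _ "verts ` P"]) (auto simp: card_image)
  next
    fix c assume "c \<in> A"
    then obtain M where M: "M \<subseteq> kpath_sets k G X" "pairwise disjnt M" "c = card M" by (auto simp: A_def)
    then have "\<forall>S\<in>M. \<exists>p. p \<in> k_paths k (induced G X) \<and> verts p = S"
      using kpath_sets_eq[OF assms(3), of k] by auto
    then obtain f where f: "\<And>S. S \<in> M \<Longrightarrow> f S \<in> k_paths k (induced G X) \<and> verts (f S) = S" by metis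
    have "inj_on f M" using f by (metis inj_onI)
    moreover have "path_packing k (induced G X) (f ` M)"
      unfolding path_packing_def pairwise_image using f M(2)
      by (auto simp: pairwise_def disjnt_def)
    ultimately show "c \<in> {card \<P> |\<P>. path_packing k (induced G X) \<P>}"
      using M(3) by (intro CollectI exI[of _ "f ` M"]) (auto simp: card_image)
  qed
  have B: "{card T |T. path_cover k (induced G X) T} = B"
    unfolding B_def path_cover_def kpath_sets_eq[OF assms(3)] by simp
  have le: "a \<le> b" if "a \<in> A" "b \<in> B" for a b
  proof -
    obtain M where M: "M \<subseteq> kpath_sets k G X" "pairwise disjnt M" "a = card M"
      using \<open>a \<in> A\<close> unfolding A_def by blast
    obtain T where T: "T \<subseteq> X" "\<forall>S \<in> kpath_sets k G X. T \<inter> S \<noteq> {}" "b = card T"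
      using \<open>b \<in> B\<close> unfolding B_def by blast
    have "finite T" using T(1) fin finite_subset by blast
    moreover have "\<And>S. S \<in> M \<Longrightarrow> T \<inter> S \<noteq> {}" using T(2) M(1) by blast
    ultimately show "a \<le> b" using packing_le_cover(2)[OF M(2)] M(3) T(3) by blast
  qed
  have "card {} \<in> A" unfolding A_def by (intro CollectI exI[of _ "{}"]) auto
  moreover have cb: "card X \<in> B" unfolding B_def
  proof (intro CollectI exI[of _ X] conjI ballI)
    show "X \<inter> S \<noteq> {}" if "S \<in> kpath_sets k G X" for S using ne[OF that] kpath_setsD[OF that] by blast
  qed simp_all
  ultimately have ne: "A \<noteq> {}" "B \<noteq> {}" by auto
  have "A \<subseteq> {..card X}" using le cb by auto
  then have fA: "finite A" by (rule finite_subset) simp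
  have "B \<subseteq> {..card X}" using fin by (auto simp: B_def intro: card_mono)
  then have fB: "finite B" by (rule finite_subset) simp
  have "Max A \<in> A" "Min B \<in> B" using ne fA fB by auto
  then have "Max A = Min B \<longleftrightarrow> A \<inter> B \<noteq> {}"
  proof -
    assume mm: "Max A \<in> A" "Min B \<in> B"
    have "Max A = c" if "c \<in> A" "c \<in> B" for c
      using le[OF mm(1) that(2)] Max_ge[OF fA that(1)] by simp
    moreover have "Min B = c" if "c \<in> A" "c \<in> B" for c
      using le[OF that(1) mm(2)] Min_le[OF fB that(2)] by simp
    ultimately have "Max A = Min B" if "A \<inter> B \<noteq> {}" using that by (metis IntE ex_in_conv)
    moreover have "A \<inter> B \<noteq> {}" if "Max A = Min B" using mm that by (metis IntI empty_iff)
    ultimately show ?thesis by (rule iffI[rotated])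
  qed
  also have "\<dots> \<longleftrightarrow> konig k G X"
  proof
    assume "A \<inter> B \<noteq> {}"
    then obtain c where "c \<in> A" "c \<in> B" by blast
    from \<open>c \<in> A\<close> obtain M where "M \<subseteq> kpath_sets k G X" "pairwise disjnt M" "c = card M"
      unfolding A_def by blast
    moreover from \<open>c \<in> B\<close> obtain T where "T \<subseteq> X" "\<forall>S \<in> kpath_sets k G X. T \<inter> S \<noteq> {}" "c = card T"
      unfolding B_def by blast
    ultimately show "konig k G X" unfolding konig_def by (intro exI[of _ M] exI[of _ T]) simp
  next
    assume "konig k G X"
    then obtain M T where MT: "M \<subseteq> kpath_sets k G X" "pairwise disjnt M"
     "T \<subseteq> X" "\<forall>S \<in> kpath_sets k G X. T \<inter> S \<noteq> {}" "card M = card T" unfolding konig_def by blast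
    have "card M \<in> A" unfolding A_def using MT by (intro CollectI exI[of _ M]) simp
    moreover have "card M \<in> B" unfolding B_def using MT by (intro CollectI exI[of _ T]) simp
    ultimately show "A \<inter> B \<noteq> {}" by blast
  qed
  finally show ?thesis unfolding nu_def tau_def A B .
qed

lemma konig_all_iff:
  assumes "k > 0" "wf_sgraph G"
  shows "(\<forall>F. induced_subgraph F G \<longrightarrow> nu k F = tau k F) \<longleftrightarrow> (\<forall>X \<subseteq> verts G. konig k G X)"
  using nu_eq_tau_iff_konig[OF assms] unfolding induced_subgraph_iff[OF assms(2)] by blast

lemma konig_empty:
  assumes "kpath_sets k G X = {}" shows "konig k G X"
  unfolding konig_def using assms by (intro exI[of _ "{}"]) auto

lemma konig_one:
  assumes "finite X" "X \<subseteq> verts G" shows "konig 1 G X"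
proof -
  have "S \<in> (\<lambda>x. {x}) ` X" if "S \<in> kpath_sets 1 G X" for S
    using that by (auto simp: kpath_sets_def length_Suc_conv)
  moreover have "{x} \<in> kpath_sets 1 G X" if "x \<in> X" for x
    unfolding kpath_sets_def using assms(2) that by (intro CollectI exI[of _ "[x]"]) (auto simp: gpath_def)
  ultimately have kp1: "kpath_sets 1 G X = (\<lambda>x. {x}) ` X" by blast
  moreover have "card ((\<lambda>x. {x}) ` X) = card X" by (simp add: card_image)
  ultimately show ?thesis
    unfolding konig_def kp1
    by (intro exI[of _ "(\<lambda>x. {x}) ` X"] exI[of _ X]) (simp add: pairwise_image card_image pairwise_def)
qed

text \<open>A packing and a cover for \<open>X - D\<close> are enlarged by \<open>M\<close> and
  \<open>W\<close>. In a forest \<open>W\<close> is a single vertex; in a subdivided block it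
  consists of the vertices of the multigraph in a component.\<close>

lemma konig_reduce:
  assumes fin: "finite X" and "k > 0" and W: "W \<subseteq> D" "D \<subseteq> X"
    and M: "M \<subseteq> kpath_sets k G D" "pairwise disjnt M" "card M = card W"
    and sep: "\<And>S. S \<in> kpath_sets k G X \<Longrightarrow> S \<inter> W = {} \<Longrightarrow> S \<inter> D = {}"
    and konig: "konig k G (X - D)"
  shows "konig k G X"
proof -
  obtain M' T where M': "M' \<subseteq> kpath_sets k G (X - D)" "pairwise disjnt M'"
    and T: "T \<subseteq> X - D" "\<And>S. S \<in> kpath_sets k G (X - D) \<Longrightarrow> T \<inter> S \<noteq> {}" and eq: "card M' = card T"
    using konig by (auto simp: konig_def)
  have disj: "disjnt S S'" if "S \<in> M" "S' \<in> M'" for S S'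
    using M(1) M'(1) that kpath_setsD[of S k G D] kpath_setsD[of S' k G "X - D"] unfolding disjnt_def by blast
  have finM: "finite M" "finite M'"
    using finite_subset[of M "Pow X"] finite_subset[of M' "Pow X"] M(1) M'(1) fin W(2) kpath_setsD by blast+
  have "M \<inter> M' = {}"
    using disj M(1) kpath_setsD[of _ k G D] assms(2) by (fastforce simp: disjnt_def)
  then have "card (M \<union> M') = card W + card T" using finM M(3) eq by (simp add: card_Un_disjoint)
  also have "\<dots> = card (W \<union> T)"
    using T(1) W fin by (subst card_Un_disjoint) (auto intro: finite_subset)
  finally have "card (M \<union> M') = card (W \<union> T)" .
  moreover have "M \<union> M' \<subseteq> kpath_sets k G X" using M(1) M'(1) W kpath_sets_mono[of D X] kpath_sets_mono[of "X - D" X] by blast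
  moreover have "pairwise disjnt (M \<union> M')"
    using M(2) M'(2) disj by (auto simp: pairwise_def disjnt_sym)
  moreover have "(W \<union> T) \<inter> S \<noteq> {}" if "S \<in> kpath_sets k G X" for S
  proof (cases "S \<inter> W = {}")
    case True
    then have "S \<inter> D = {}" using sep that by blast
    then have "S \<in> kpath_sets k G (X - D)" using kpath_sets_restrict[OF that] kpath_setsD[OF that] by blast
    then show ?thesis using T(2) by blast
  qed blast
  ultimately show ?thesis unfolding konig_def using W T(1)
    by (intro exI[of _ "M \<union> M'"] exI[of _ "W \<union> T"] conjI ballI) (blast | assumption)+
qed

section \<open>Connectivity inside a vertex set\<close>

text \<open>Connectivity in the subgraph induced by \<open>Z\<close>, without forming this graph, so
  that \<open>Z\<close> can vary freely. The relation is reflexive everywhere, also outside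
  \<open>Z\<close>; hence the membership assumptions further on.\<close>

definition reach :: "'a sgraph \<Rightarrow> 'a set \<Rightarrow> 'a \<Rightarrow> 'a \<Rightarrow> bool" where
  "reach G Z = (\<lambda>u v. {u, v} \<in> edges G \<and> u \<in> Z \<and> v \<in> Z)\<^sup>*\<^sup>*"

lemma reach_refl [simp, intro]: "reach G Z x x"
  by (simp add: reach_def)

lemma reach_trans: "reach G Z x y \<Longrightarrow> reach G Z y z \<Longrightarrow> reach G Z x z"
  by (simp add: reach_def)

lemma reach_edge: "{x, y} \<in> edges G \<Longrightarrow> x \<in> Z \<Longrightarrow> y \<in> Z \<Longrightarrow> reach G Z x y"
  by (auto simp: reach_def)

lemma reach_sym: "reach G Z x y \<Longrightarrow> reach G Z y x"
  unfolding reach_def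
  by (rule sympD[OF symp_rtranclp]) (auto simp: symp_def insert_commute)

lemma reach_mono: "reach G Z x y \<Longrightarrow> Z \<subseteq> Z' \<Longrightarrow> edges G \<subseteq> edges G' \<Longrightarrow> reach G' Z' x y"
  unfolding reach_def by (erule rtranclp_mono[THEN predicate2D, rotated]) auto

lemma reach_in: "reach G Z x y \<Longrightarrow> x \<in> Z \<Longrightarrow> y \<in> Z"
  unfolding reach_def by (induction rule: rtranclp_induct) auto

lemma reach_closed:
  assumes "reach G Z x y" "x \<in> A" "\<And>u v. u \<in> A \<Longrightarrow> v \<in> Z \<Longrightarrow> {u, v} \<in> edges G \<Longrightarrow> v \<in> A"
  shows "y \<in> A"
  using assms(1,2) unfolding reach_def by (induction rule: rtranclp_induct) (auto intro: assms(3))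

lemma reach_successively:
  assumes "walk G xs" "set xs \<subseteq> Z" "x \<in> set xs" "y \<in> set xs"
  shows "reach G Z x y"
proof -
  have "reach G Z (hd xs) z" if "z \<in> set xs" for z
    using assms(1,2) that
  proof (induction xs)
    case (Cons a xs)
    show ?case
    proof (cases "z = a")
      case False
      then have z: "z \<in> set xs" "xs \<noteq> []" using Cons.prems by auto
      then have "reach G Z (hd xs) z" using Cons by (auto simp: successively_Cons)
      moreover have "reach G Z a (hd xs)" using Cons.prems z
        by (intro reach_edge) (auto simp: successively_Cons)
      ultimately show ?thesis by (auto intro: reach_trans)
    qed simp
  qed simp
  then show ?thesis using assms(3,4) reach_sym reach_trans by metis
qed

lemma reach_path:
  assumes "reach G Z x y" "x \<in> Z"
  obtains xs where "xs \<noteq> []" "hd xs = x" "last xs = y" "distinct xs" "set xs \<subseteq> Z"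
    "walk G xs"
proof -
  have "\<exists>xs. xs \<noteq> [] \<and> hd xs = x \<and> last xs = y \<and> distinct xs \<and> set xs \<subseteq> Z \<and>
    walk G xs"
    using assms unfolding reach_def
  proof (induction rule: rtranclp_induct)
    case base
    then show ?case by (intro exI[of _ "[x]"]) auto
  next
    case (step y z)
    then obtain xs where xs: "xs \<noteq> []" "hd xs = x" "last xs = y" "distinct xs" "set xs \<subseteq> Z"
      "walk G xs" by blast
    show ?case
    proof (cases "z \<in> set xs")
      case True
      then obtain ys zs where "xs = ys @ z # zs" by (auto simp: in_set_conv_decomp)
      then show ?thesis using xs
        by (intro exI[of _ "ys @ [z]"]) (auto simp: successively_append_iff hd_append split: if_splits)
    next
      case False
      then show ?thesis using xs step
        by (intro exI[of _ "xs @ [z]"]) (auto simp: successively_append_iff)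
    qed
  qed
  then show thesis using that by blast
qed

lemma reach_first_hit:
  assumes "reach G Z x y" "x \<in> Z" "y \<in> A"
  obtains xs a where "a \<in> A" "a \<in> Z" "distinct (xs @ [a])" "set xs \<subseteq> Z - A"
    "walk G (xs @ [a])" "hd (xs @ [a]) = x"
proof -
  obtain xs where xs: "xs \<noteq> []" "hd xs = x" "last xs = y" "distinct xs" "set xs \<subseteq> Z"
    "walk G xs" using reach_path[OF assms(1,2)] .
  then have "\<exists>a\<in>set xs. a \<in> A" using assms(3) last_in_set by blast
  then obtain ys a zs where "xs = ys @ a # zs" "a \<in> A" "\<forall>y\<in>set ys. y \<notin> A"
    by (rule split_list_first_propE)
  then show thesis using xs that[of a ys]
    by (auto simp: successively_append_iff hd_append split: if_splits)
qed

lemma adj_rel_reach: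
  assumes "wf_sgraph G"
  shows "(x, y) \<in> (adj_rel G)\<^sup>* \<longleftrightarrow> reach G (verts G) x y"
proof -
  have "(\<lambda>x y. (x, y) \<in> adj_rel G) = (\<lambda>u v. {u, v} \<in> edges G \<and> u \<in> verts G \<and> v \<in> verts G)"
    using edge_verts[OF assms] by (auto simp: adj_rel_def fun_eq_iff)
  moreover have "(x, y) \<in> (adj_rel G)\<^sup>* \<longleftrightarrow> (\<lambda>x y. (x, y) \<in> adj_rel G)\<^sup>*\<^sup>* x y"
    by (simp add: rtranclp_rtrancl_eq)
  ultimately show ?thesis by (simp add: reach_def)
qed

lemma connected_graph_iff:
  "wf_sgraph G \<Longrightarrow> connected_graph G \<longleftrightarrow>
    verts G \<noteq> {} \<and> (\<forall>x\<in>verts G. \<forall>y\<in>verts G. reach G (verts G) x y)"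
  by (simp add: connected_graph_def adj_rel_reach)

lemma reach_induced: "Z \<subseteq> X \<Longrightarrow> reach (induced G X) Z = reach G Z"
  unfolding reach_def by (rule arg_cong[of _ _ rtranclp]) (auto simp: fun_eq_iff)

lemma delete_verts_eq: "wf_sgraph G \<Longrightarrow> delete_verts G X = induced G (verts G - X)"
  by (auto simp: delete_verts_def induced_def wf_sgraph_def)

definition component_at :: "'a sgraph \<Rightarrow> 'a \<Rightarrow> 'a sgraph" where
  "component_at G v = induced G {w. reach G (verts G) v w}"

lemma comp_in_components:
  assumes wf: "wf_sgraph G" and v: "v \<in> verts G"
  shows "component_at G v \<in> components_of G"
proof -
  define A where "A = {w. reach G (verts G) v w}"
  have A: "A \<subseteq> verts G" using reach_in v by (fastforce simp: A_def)
  have wfA: "wf_sgraph (induced G A)" using wf_induced[OF wf A] .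
  have "reach G A v w" if "reach G (verts G) v w" for w
  proof -
    have "w \<in> {w. reach G A v w \<and> w \<in> A}" using that
    proof (rule reach_closed)
      show "v \<in> {w. reach G A v w \<and> w \<in> A}" by (simp add: A_def)
      fix u w assume u: "u \<in> {w. reach G A v w \<and> w \<in> A}" and w: "w \<in> verts G" "{u, w} \<in> edges G"
      have "w \<in> A" using u w A reach_edge[of u w G "verts G"] reach_trans unfolding A_def by fastforce
      then show "w \<in> {w. reach G A v w \<and> w \<in> A}"
        using u w reach_edge[of u w G A] reach_trans by fastforce
    qed
    then show ?thesis by simp
  qed
  then have con: "connected_graph (induced G A)"
    unfolding connected_graph_iff[OF wfA] using reach_induced[of A A G]
    by (auto simp: A_def intro: reach_trans reach_sym)
  have "subgraph (induced G A) G" using wfA A by (auto simp: subgraph_def)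
  moreover have "K = induced G A" if K: "subgraph K G" "connected_graph K" "subgraph (induced G A) K" for K
  proof -
    have wfK: "wf_sgraph K" "verts K \<subseteq> verts G" "edges K \<subseteq> edges G" using K by (auto simp: subgraph_def)
    have "v \<in> verts K" using K by (auto simp: subgraph_def A_def)
    then have "verts K \<subseteq> A" using K(2) wfK reach_mono[of K "verts K" v _ "verts G" G]
      by (auto simp: connected_graph_iff A_def)
    then have "verts K = A" using K(3) by (auto simp: subgraph_def)
    moreover have "edges K = edges (induced G A)"
      using K(3) wfK \<open>verts K = A\<close> by (auto simp: subgraph_def wf_sgraph_def)
    ultimately show ?thesis by (auto intro: sgraph.equality)
  qed
  ultimately show ?thesis using con
    by (auto simp: components_of_def maximal_subgraph_def component_at_def A_def)
qed

lemma components_eq_comp: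
  assumes wf: "wf_sgraph G" and K: "K \<in> components_of G" and v: "v \<in> verts K"
  shows "K = component_at G v"
proof -
  have sub: "subgraph K G" and con: "connected_graph K"
    and max: "\<And>K'. subgraph K' G \<Longrightarrow> connected_graph K' \<Longrightarrow> subgraph K K' \<Longrightarrow> K' = K"
    using K by (auto simp: components_of_def maximal_subgraph_def)
  have wfK: "wf_sgraph K" "verts K \<subseteq> verts G" "edges K \<subseteq> edges G" using sub by (auto simp: subgraph_def)
  have vG: "v \<in> verts G" using v wfK by blast
  have c: "component_at G v \<in> components_of G" using comp_in_components[OF wf vG] .
  have "verts K \<subseteq> {w. reach G (verts G) v w}"
    using con v wfK reach_mono[of K "verts K" v _ "verts G" G] by (auto simp: connected_graph_iff)
  moreover have "e \<subseteq> verts K" if "e \<in> edges K" for e using that wfK(1) by (simp add: wf_sgraph_def)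
  ultimately have "subgraph K (component_at G v)" using wfK
    unfolding subgraph_def component_at_def induced_simps by blast
  then show ?thesis using max[of "component_at G v"] c
    by (auto simp: components_of_def maximal_subgraph_def)
qed

lemma component_nonempty: "K \<in> components_of G \<Longrightarrow> verts K \<noteq> {}"
  by (auto simp: components_of_def maximal_subgraph_def connected_graph_def)

lemma component_subgraph: "K \<in> components_of G \<Longrightarrow> subgraph K G \<and> connected_graph K"
  by (simp add: components_of_def maximal_subgraph_def)

lemma components_of_conv:
  assumes "wf_sgraph G" shows "components_of G = component_at G ` verts G"
proof (intro equalityI subsetI)
  fix K assume K: "K \<in> components_of G"
  then obtain v where v: "v \<in> verts K" using component_nonempty[OF K] by blast
  moreover have "verts K \<subseteq> verts G" using component_subgraph[OF K] by (simp add: subgraph_def)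
  ultimately show "K \<in> component_at G ` verts G" using components_eq_comp[OF assms K v] by blast
next
  fix K assume "K \<in> component_at G ` verts G"
  then show "K \<in> components_of G" using comp_in_components[OF assms] by blast
qed

lemma comp_eq_iff:
  assumes "wf_sgraph G" "u \<in> verts G" "v \<in> verts G"
  shows "component_at G u = component_at G v \<longleftrightarrow> reach G (verts G) u v"
proof
  assume "component_at G u = component_at G v"
  then have "{w. reach G (verts G) u w} = {w. reach G (verts G) v w}"
    by (metis component_at_def induced_simps(1))
  then show "reach G (verts G) u v" by auto
next
  assume "reach G (verts G) u v"
  then have "{w. reach G (verts G) u w} = {w. reach G (verts G) v w}"
    using reach_trans reach_sym by fast
  then show "component_at G u = component_at G v" by (simp add: component_at_def)
qed

definition nonsep :: "'a sgraph \<Rightarrow> bool" where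
  "nonsep F \<longleftrightarrow> connected_graph F \<and> (\<nexists>x. cutvertex F x)"

text \<open>A connected graph has one component, so \<open>x\<close> is a cutvertex iff two vertices
  of \<open>F - x\<close> lie in different components. Deleting a non-vertex changes nothing, which
  lets \<open>x\<close> range over the whole type.\<close>

lemma nonsep_iff:
  assumes wf: "wf_sgraph F"
  shows "nonsep F \<longleftrightarrow> verts F \<noteq> {} \<and> (\<forall>x\<in>verts F. \<forall>y\<in>verts F. reach F (verts F) x y) \<and>
    (\<forall>x. \<forall>u\<in>verts F - {x}. \<forall>v\<in>verts F - {x}. reach F (verts F - {x}) u v)"
proof -
  have fin: "finite (verts F)" using wf by (simp add: wf_sgraph_def)
  have "cutvertex F x \<longleftrightarrow> x \<in> verts F \<and> \<not> (\<forall>u\<in>verts F - {x}. \<forall>v\<in>verts F - {x}. reach F (verts F - {x}) u v)"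
    if con: "connected_graph F" for x
  proof -
    obtain a where a: "a \<in> verts F" using con by (auto simp: connected_graph_def)
    have "component_at F v = component_at F a" if "v \<in> verts F" for v
      using comp_eq_iff[OF wf that a] con that a by (auto simp: connected_graph_iff[OF wf])
    then have "component_at F ` verts F = (\<lambda>_. component_at F a) ` verts F"
      by (intro image_cong) simp_all
    then have "components_of F = {component_at F a}"
      using a unfolding components_of_conv[OF wf] by auto
    then have one: "card (components_of F) = 1" by simp
    define D where "D = delete_verts F {x}"
    have D: "D = induced F (verts F - {x})" by (simp add: D_def delete_verts_eq[OF wf])
    have wfD: "wf_sgraph D" using wf_induced[OF wf] by (auto simp: D)
    have vD: "verts D = verts F - {x}" by (simp add: D)
    have cD: "components_of D = component_at D ` (verts F - {x})"
      using components_of_conv[OF wfD] by (simp add: vD)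
    have eq: "component_at D u = component_at D v \<longleftrightarrow> reach F (verts F - {x}) u v"
      if "u \<in> verts F - {x}" "v \<in> verts F - {x}" for u v
      using comp_eq_iff[OF wfD, of u v] that unfolding vD by (simp add: D reach_induced)
    have "card (components_of D) > 1 \<longleftrightarrow> (\<exists>u\<in>verts F - {x}. \<exists>v\<in>verts F - {x}. component_at D u \<noteq> component_at D v)"
      unfolding cD using fin by (subst not_le[symmetric], subst card_le_Suc0_iff_eq[unfolded One_nat_def[symmetric]]) auto
    then show ?thesis using eq one by (auto simp: cutvertex_def D_def[symmetric])
  qed
  moreover have "x \<notin> verts F \<Longrightarrow> verts F - {x} = verts F" for x by auto
  ultimately show ?thesis unfolding nonsep_def connected_graph_iff[OF wf] 
    by (metis (no_types, lifting))
qed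

section \<open>Cycles as periodic functions\<close>

text \<open>Indexing by all integers with period \<open>m\<close> avoids wrap-around: arcs are
  images of intervals, rotation and reflection are substitutions. The edges of the cycle lie in
  \<open>G\<close>, but chords are allowed.\<close>

definition icyc :: "'a sgraph \<Rightarrow> int \<Rightarrow> (int \<Rightarrow> 'a) \<Rightarrow> bool" where
  "icyc G m c \<longleftrightarrow> 3 \<le> m \<and> (\<forall>i j. c i = c j \<longleftrightarrow> m dvd i - j) \<and> (\<forall>i. {c i, c (i + 1)} \<in> edges G)"

lemma icycD:
  assumes "icyc G m c"
  shows "3 \<le> m" "c i = c j \<longleftrightarrow> m dvd i - j" "{c i, c (i + 1)} \<in> edges G" "{c (i - 1), c i} \<in> edges G"
  using assms spec[of "\<lambda>i. {c i, c (i + 1)} \<in> edges G" "i - 1"] by (auto simp: icyc_def)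

lemma icyc_shift: "icyc G m c \<Longrightarrow> icyc G m (\<lambda>i. c (i + t))"
  by (simp add: icyc_def) (metis add.assoc add.commute)

lemma icyc_rev: "icyc G m c \<Longrightarrow> icyc G m (\<lambda>i. c (- i))"
proof -
  assume c: "icyc G m c"
  have "{c (- i), c (- i - 1)} \<in> edges G" for i
    using icycD(4)[OF c, of "- i"] by (simp add: insert_commute)
  moreover have "m dvd - i + j \<longleftrightarrow> m dvd i - j" for i j
    by (metis dvd_minus_iff minus_diff_eq uminus_add_conv_diff)
  ultimately show ?thesis using c by (simp add: icyc_def)
qed

lemma icyc_mono: "icyc G m c \<Longrightarrow> edges G \<subseteq> edges G' \<Longrightarrow> icyc G' m c"
  by (auto simp: icyc_def)

lemma icyc_periodic: "icyc G m c \<Longrightarrow> c (i + m) = c i"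
  using icycD(2)[of G m c "i + m" i] by simp

lemma icyc_mod: "icyc G m c \<Longrightarrow> c (i mod m) = c i"
  using icycD(2)[of G m c "i mod m" i] by (metis dvd_minus_mod dvd_minus_iff minus_diff_eq)

lemma icyc_verts: "wf_sgraph G \<Longrightarrow> icyc G m c \<Longrightarrow> range c \<subseteq> verts G"
  using edge_verts icycD(3) by fastforce

lemma icyc_inj: "icyc G m c \<Longrightarrow> inj_on c {a..<a + m}"
proof (rule inj_onI)
  fix i j assume c: "icyc G m c" and ij: "i \<in> {a..<a + m}" "j \<in> {a..<a + m}" "c i = c j"
  then have "m dvd i - j" using icycD(2) by blast
  moreover have "\<bar>i - j\<bar> < m" using ij by auto
  ultimately show "i = j" by (metis dvd_imp_le_int abs_of_nonneg eq_iff_diff_eq_0 not_le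
        abs_ge_zero le_less_trans less_le_not_le abs_of_pos)
qed

lemma icyc_range: "icyc G m c \<Longrightarrow> range c = c ` {a..<a + m}"
proof (intro equalityI subsetI)
  fix x assume c: "icyc G m c" and "x \<in> range c"
  then obtain i where i: "x = c i" by blast
  have "c (a + (i - a) mod m) = c i"
  proof -
    have "m dvd (i - a) mod m - (i - a)" by (metis dvd_minus_iff dvd_minus_mod minus_diff_eq)
    moreover have "a + (i - a) mod m - i = (i - a) mod m - (i - a)" by simp
    ultimately show ?thesis using icycD(2)[OF c] by metis
  qed
  moreover have "a + (i - a) mod m \<in> {a..<a + m}" using icycD(1)[OF c] by auto
  ultimately show "x \<in> c ` {a..<a + m}" using i by (metis imageI)
qed auto

lemma icyc_card: "icyc G m c \<Longrightarrow> finite (range c) \<and> int (card (range c)) = m"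
  using icyc_range[of G m c 0] icyc_inj[of G m c 0] icycD(1)[of G m c]
  by (simp add: card_image)

lemma icyc_obtain:
  assumes "icyc G m c" "x \<in> range c"
  obtains i where "a \<le> i" "i < a + m" "x = c i"
  using assms icyc_range[OF assms(1), of a] by auto

lemma icyc_of_list:
  assumes "distinct xs" "3 \<le> length xs" "walk G xs"
    "{last xs, hd xs} \<in> edges G"
  defines "c \<equiv> \<lambda>i. xs ! nat (i mod int (length xs))"
  shows "icyc G (int (length xs)) c" "range c = set xs" "\<And>i. i < length xs \<Longrightarrow> c (int i) = xs ! i"
proof -
  let ?m = "int (length xs)"
  have m: "?m > 0" using assms(2) by (cases xs) auto
  have lt: "nat (i mod ?m) < length xs" and nn: "0 \<le> i mod ?m" for i using m by (simp_all add: nat_less_iff)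
  have "c i = c j \<longleftrightarrow> ?m dvd i - j" for i j
  proof -
    have "c i = c j \<longleftrightarrow> i mod ?m = j mod ?m"
      unfolding c_def using nth_eq_iff_index_eq[OF assms(1) lt lt, of i j] nn eq_nat_nat_iff by metis
    then show ?thesis by (simp add: mod_eq_dvd_iff)
  qed
  moreover have "{c i, c (i + 1)} \<in> edges G" for i
  proof (cases "i mod ?m = ?m - 1")
    case True
    then have "(i + 1) mod ?m = 0" using m by (simp add: mod_add_left_eq[symmetric])
    then have "c (i + 1) = xs ! 0" "c i = xs ! nat (?m - 1)" using True by (simp_all add: c_def)
    moreover have "xs \<noteq> []" "nat (?m - 1) = length xs - 1" using m by auto
    ultimately have "c (i + 1) = hd xs" "c i = last xs" by (simp_all add: hd_conv_nth last_conv_nth)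
    then show ?thesis using assms(4) by simp
  next
    case False
    have s: "0 \<le> i mod ?m" "i mod ?m < ?m" using m by auto
    have "(i mod ?m + 1) mod ?m = i mod ?m + 1" using s False by (intro mod_pos_pos_trivial) auto
    then have "(i + 1) mod ?m = i mod ?m + 1" by (simp add: mod_add_left_eq)
    then have "nat ((i + 1) mod ?m) = Suc (nat (i mod ?m))" "Suc (nat (i mod ?m)) < length xs"
      using s False by auto
    then show ?thesis using successively_nth[OF assms(3)] by (simp add: c_def)
  qed
  ultimately show c: "icyc G ?m c" using assms(2) by (simp add: icyc_def)
  show cn: "c (int i) = xs ! i" if "i < length xs" for i using that by (simp add: c_def)
  show "range c = set xs"
  proof (intro equalityI subsetI)
    show "x \<in> set xs" if "x \<in> range c" for x using that lt by (auto simp: c_def)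
    show "x \<in> range c" if "x \<in> set xs" for x using that cn by (metis in_set_conv_nth rangeI)
  qed
qed

definition cyc_graph :: "(int \<Rightarrow> 'a) \<Rightarrow> 'a sgraph" where
  "cyc_graph c = \<lparr>verts = range c, edges = range (\<lambda>i. {c i, c (i + 1)})\<rparr>"

lemma icyc_cyc_graph: "icyc G m c \<Longrightarrow> icyc (cyc_graph c) m c"
  by (simp add: icyc_def cyc_graph_def)

lemma icyc_neighbours_ne:
  assumes "icyc G m c" shows "c (i - 1) \<noteq> c (i + 1)" "c i \<noteq> c (i + 1)"
proof -
  have "\<not> m dvd 2" "\<not> m dvd 1" using icycD(1)[OF assms] zdvd_imp_le[of m 2] zdvd_imp_le[of m 1] by auto
  moreover have "c (i + 1) = c (i - 1) \<longleftrightarrow> m dvd 2" "c (i + 1) = c i \<longleftrightarrow> m dvd 1"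
    using icycD(2)[OF assms, of "i + 1" "i - 1"] icycD(2)[OF assms, of "i + 1" i] by simp_all
  ultimately show "c (i - 1) \<noteq> c (i + 1)" "c i \<noteq> c (i + 1)" by metis+
qed

lemma wf_cyc_graph: "icyc G m c \<Longrightarrow> wf_sgraph (cyc_graph c)"
  using icyc_card[of G m c] icyc_neighbours_ne[of G m c]
  by (auto simp: wf_sgraph_def cyc_graph_def)

lemma cyc_graph_subgraph: "wf_sgraph G \<Longrightarrow> icyc G m c \<Longrightarrow> subgraph (cyc_graph c) G"
  using wf_cyc_graph[of G m c] icyc_verts[of G m c] icycD(3)[of G m c]
  by (auto simp: subgraph_def cyc_graph_def)

lemma icyc_path_list:
  assumes "icyc G m c" "int l \<le> m" "xs = map (\<lambda>i. c (a + int i)) [0..<l]"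
  shows "distinct xs" "walk G xs" "length xs = l"
    "set xs = c ` {a..<a + int l}"
proof -
  have "inj_on (\<lambda>i. c (a + int i)) {0..<l}"
  proof (rule inj_onI)
    fix x y assume xy: "x \<in> {0..<l}" "y \<in> {0..<l}" "c (a + int x) = c (a + int y)"
    then have "a + int x = a + int y" using icyc_inj[OF assms(1), of a] assms(2)
      by (intro inj_onD[of c]) auto
    then show "x = y" by simp
  qed
  then show "distinct xs" using assms(3) by (simp add: distinct_map)
  show "walk G xs"
    unfolding successively_conv_nth
  proof (intro allI impI)
    fix i assume "Suc i < length xs"
    then have "xs ! i = c (a + int i)" "xs ! Suc i = c (a + int i + 1)"
      by (simp_all add: assms(3) algebra_simps)
    then show "{xs ! i, xs ! Suc i} \<in> edges G" using icycD(3)[OF assms(1)] by simp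
  qed
  show "length xs = l" using assms(3) by simp
  have "(\<lambda>i. a + int i) ` {0..<l} = {a..<a + int l}"
  proof (intro equalityI subsetI)
    fix x assume "x \<in> {a..<a + int l}"
    then show "x \<in> (\<lambda>i. a + int i) ` {0..<l}" by (intro image_eqI[of _ _ "nat (x - a)"]) auto
  qed auto
  moreover have "set xs = c ` ((\<lambda>i. a + int i) ` {0..<l})" by (simp add: assms(3) image_image)
  ultimately show "set xs = c ` {a..<a + int l}" by simp
qed

lemma is_cycle_imp_icyc:
  assumes "is_cycle C" "subgraph C G"
  obtains c where "icyc G (int (order C)) c" "range c = verts C"
proof -
  obtain xs where xs: "3 \<le> length xs" "distinct xs"
    "C = \<lparr>verts = set xs, edges = insert {last xs, hd xs} (path_edges xs)\<rparr>"
    using assms(1) by (auto simp: is_cycle_def)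
  then have "{last xs, hd xs} \<in> edges G" "walk G xs"
    using assms(2) by (auto simp: subgraph_def path_edges_subset_iff[symmetric])
  moreover have "order C = length xs" "verts C = set xs" using xs by (auto simp: order_def distinct_card)
  ultimately show thesis using icyc_of_list[OF xs(2,1)] that by metis
qed

lemma icyc_imp_is_cycle:
  assumes wf: "wf_sgraph G" and c: "icyc G m c"
  obtains C where "is_cycle C" "subgraph C G" "int (order C) = m" "verts C = range c"
proof -
  define xs where "xs = map (\<lambda>i. c (0 + int i)) [0..<nat m]"
  have m: "3 \<le> m" using icycD(1)[OF c] .
  note l = icyc_path_list[OF c _ xs_def]
  have xs: "distinct xs" "walk G xs" "length xs = nat m" "set xs = range c"
    using l m icyc_range[OF c, of 0] by auto
  have lh: "last xs = c (m - 1)" "hd xs = c m"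
    using m icyc_periodic[OF c, of 0] by (auto simp: xs_def last_map hd_map of_nat_diff)
  define C where "C = \<lparr>verts = set xs, edges = insert {last xs, hd xs} (path_edges xs)\<rparr>"
  have e: "{last xs, hd xs} \<in> edges G" using lh icycD(4)[OF c, of m] by simp
  have "is_cycle C" using xs m unfolding is_cycle_def C_def by (intro exI[of _ xs]) auto
  moreover have "subgraph C G"
  proof -
    have sub: "set xs \<subseteq> verts G" using xs icyc_verts[OF wf c] by simp
    have sub2: "insert {last xs, hd xs} (path_edges xs) \<subseteq> edges G"
      using e xs(2) by (simp add: path_edges_subset_iff)
    have "xs \<noteq> []" using xs(3) m by (cases xs) auto
    then have "{last xs, hd xs} \<subseteq> set xs" by simp
    moreover have "e \<subseteq> set xs" if "e \<in> path_edges xs" for e using that by (auto simp: path_edges_def)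
    ultimately have "\<forall>e\<in>insert {last xs, hd xs} (path_edges xs). e \<subseteq> set xs" by blast
    moreover have "card e = 2" if "e \<in> edges G" for e using that wf by (simp add: wf_sgraph_def)
    ultimately have "wf_sgraph C" using sub2 unfolding wf_sgraph_def C_def by auto
    then show ?thesis using sub sub2 by (simp add: subgraph_def C_def)
  qed
  moreover have "int (order C) = m" "verts C = range c"
    using xs(4) icyc_card[OF c] by (simp_all add: order_def C_def)
  ultimately show thesis using that by blast
qed

section \<open>Blocks\<close>

text \<open>Connectedness and the absence of cutvertices become one condition on the removal of at
  most one vertex, so later arguments treat both at once.\<close>

lemma nonsep_iff_small:
  assumes wf: "wf_sgraph F"
  shows "nonsep F \<longleftrightarrow> verts F \<noteq> {} \<and> (\<forall>S. S = {} \<or> (\<exists>x. S = {x}) \<longrightarrow>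
    (\<forall>u\<in>verts F - S. \<forall>v\<in>verts F - S. reach F (verts F - S) u v))"
proof -
  have *: "(\<forall>S. S = {} \<or> (\<exists>x. S = {x}) \<longrightarrow> P S) \<longleftrightarrow> P {} \<and> (\<forall>x. P {x})" for P :: "'a set \<Rightarrow> bool"
    by blast
  show ?thesis unfolding nonsep_iff[OF wf] * by simp
qed

lemma nonsepD:
  assumes "nonsep F" "wf_sgraph F" "S = {} \<or> (\<exists>x. S = {x})" "u \<in> verts F - S" "v \<in> verts F - S"
  shows "reach F (verts F - S) u v"
  using assms nonsep_iff_small by metis

lemma reach_icyc:
  assumes c: "icyc G m c" and "i \<le> j" "\<And>l. i \<le> l \<Longrightarrow> l \<le> j \<Longrightarrow> c l \<in> Z"
  shows "reach G Z (c i) (c j)"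
  using assms(2,3)
proof (induction rule: int_ge_induct)
  case (step j)
  have "reach G Z (c i) (c j)" using step by simp
  moreover have "reach G Z (c j) (c (j + 1))" using step icycD(3)[OF c] by (intro reach_edge) auto
  ultimately show ?case by (rule reach_trans)
qed simp

lemma nonsep_cyc_graph:
  assumes c: "icyc G m c" shows "nonsep (cyc_graph c)"
proof -
  let ?C = "cyc_graph c"
  have c': "icyc ?C m c" using icyc_cyc_graph[OF c] .
  have V: "verts ?C = range c" by (simp add: cyc_graph_def)
  have "reach ?C (range c - S) u v"
    if S: "S = {} \<or> (\<exists>x. S = {x})" and u: "u \<in> range c - S" and v: "v \<in> range c - S" for S u v
  proof -
    show ?thesis
    proof (cases "\<exists>a. S = {c a}")
      case True
      then obtain b where b: "S = {c b}" by blast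
      \<comment> \<open>Cutting at \<open>c b\<close> unrolls the cycle into the arc of indices
        strictly between \<open>b\<close> and \<open>b + m\<close>.\<close>
      have ne: "c l \<notin> S" if "b < l" "l < b + m" for l
        using icycD(2)[OF c, of l b] that zdvd_not_zless[of "l - b" m] b by auto
      obtain i where i: "b \<le> i" "i < b + m" "u = c i" using icyc_obtain[OF c, of u b] u by blast
      obtain j where j: "b \<le> j" "j < b + m" "v = c j" using icyc_obtain[OF c, of v b] v by blast
      have ij: "b < i" "b < j" using i j u v b by (auto simp: le_less)
      show ?thesis
      proof (cases "i \<le> j")
        case True
        show ?thesis unfolding i j using ij i j ne by (intro reach_icyc[OF c' True]) auto
      next
        case False
        then have "j \<le> i" by simp
        show ?thesis unfolding i j using ij i j ne
          by (intro reach_sym[OF reach_icyc[OF c' \<open>j \<le> i\<close>]]) auto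
      qed
    next
      case False
      then have ne: "c l \<notin> S" for l using S by auto
      obtain i where i: "u = c i" using u by blast
      obtain j where j: "i \<le> j" "v = c j" using icyc_obtain[OF c, of v i] v by blast
      show ?thesis unfolding i j(2) using ne j(1) by (intro reach_icyc[OF c']) auto
    qed
  qed
  then show ?thesis unfolding nonsep_iff_small[OF wf_cyc_graph[OF c]] V by blast
qed

lemma blocksD:
  assumes "B \<in> blocks G"
  shows "subgraph B G" "wf_sgraph B" "nonsep B" "verts B \<subseteq> verts G" "edges B \<subseteq> edges G"
    "\<And>K. subgraph K G \<Longrightarrow> nonsep K \<Longrightarrow> subgraph B K \<Longrightarrow> K = B"
  using assms unfolding blocks_def maximal_subgraph_def nonsep_def[symmetric] subgraph_def by blast+

text \<open>Among the candidates, one with the largest number of vertices plus edges is maximal with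
  respect to the subgraph relation.\<close>

lemma block_containing:
  assumes wf: "wf_sgraph G" and C: "subgraph C G" "nonsep C"
  obtains B where "B \<in> blocks G" "subgraph C B"
proof -
  define P where "P K \<longleftrightarrow> subgraph K G \<and> nonsep K \<and> subgraph C K" for K
  define f where "f K = card (verts K) + card (edges K)" for K :: "'a sgraph"
  have fin: "finite (verts G)" "finite (edges G)"
    using wf finite_subset[of "edges G" "Pow (verts G)"] by (auto simp: wf_sgraph_def)
  have "P C" using C by (auto simp: P_def subgraph_def)
  moreover have "\<forall>K. P K \<longrightarrow> f K < card (verts G) + card (edges G) + 1"
    using fin by (auto simp: P_def f_def subgraph_def intro!: le_imp_less_Suc add_mono card_mono)
  ultimately obtain B where B: "P B" "\<And>K. P K \<Longrightarrow> f K \<le> f B"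
    using ex_has_greatest_nat[of P C f] by blast
  have "K = B" if K: "subgraph K G" "nonsep K" "subgraph B K" for K
  proof -
    have s: "verts B \<subseteq> verts K" "edges B \<subseteq> edges K" "verts K \<subseteq> verts G" "edges K \<subseteq> edges G"
      using K by (auto simp: subgraph_def)
    have "subgraph C K" using B(1) s by (auto simp: P_def subgraph_def)
    then have le: "f K \<le> f B" using B(2) K by (simp add: P_def)
    have fK: "finite (verts K)" "finite (edges K)" using s fin by (auto intro: finite_subset)
    have "card (verts B) \<le> card (verts K)" "card (edges B) \<le> card (edges K)"
      using s fK by (auto intro: card_mono)
    then have "card (verts K) \<le> card (verts B)" "card (edges K) \<le> card (edges B)" using le by (auto simp: f_def)
    then have "verts B = verts K" "edges B = edges K" using s fK card_seteq by metis+
    then show ?thesis by (auto intro: sgraph.equality)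
  qed
  then have "B \<in> blocks G" using B(1)
    unfolding blocks_def maximal_subgraph_def nonsep_def[symmetric] P_def by blast
  then show thesis using that B(1) by (auto simp: P_def)
qed

lemma cycle_in_block:
  assumes wf: "wf_sgraph G" and c: "icyc G m c"
  obtains B where "B \<in> blocks G" "icyc B m c" "\<not> trivial_block B"
proof -
  obtain B where B: "B \<in> blocks G" "subgraph (cyc_graph c) B"
    using block_containing[OF wf cyc_graph_subgraph[OF wf c] nonsep_cyc_graph[OF c]] .
  have "icyc B m c" using icyc_mono[OF icyc_cyc_graph[OF c]] B(2) by (auto simp: subgraph_def)
  moreover have "card (range c) \<le> card (verts B)" "int (card (range c)) = m"
    using B icyc_card[OF c] blocksD(2)[OF B(1)]
    by (auto simp: subgraph_def cyc_graph_def wf_sgraph_def intro: card_mono)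
  then have "\<not> trivial_block B" using icycD(1)[OF c] by (auto simp: trivial_block_def order_def)
  ultimately show thesis using that B by blast
qed

text \<open>A deleted vertex blocks at most one of the two ways from a vertex of the ear to the ends
  in \<open>B\<close>. The ear may be empty: then only the remaining edges between vertices of
  \<open>B\<close> are added, which is how blocks turn out to be induced.\<close>

lemma nonsep_add_ear:
  assumes wf: "wf_sgraph G" and B: "subgraph B G" "nonsep B"
    and xs: "distinct xs" "set xs \<inter> verts B = {}" "set xs \<subseteq> verts G"
      "walk G xs"
    and ends: "xs \<noteq> [] \<Longrightarrow> b \<in> verts B \<and> b' \<in> verts B \<and> b \<noteq> b' \<and>
      {b, hd xs} \<in> edges G \<and> {last xs, b'} \<in> edges G"
  shows "nonsep (induced G (verts B \<union> set xs))"
proof -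
  let ?Z = "verts B \<union> set xs"
  have wfB: "wf_sgraph B" "verts B \<subseteq> verts G" "edges B \<subseteq> edges G" using B by (auto simp: subgraph_def)
  have wfZ: "wf_sgraph (induced G ?Z)" using wf_induced[OF wf] wfB xs by simp
  have toB: "\<exists>z \<in> verts B - S. reach G (?Z - S) u z"
    if S: "S = {} \<or> (\<exists>x. S = {x})" and u: "u \<in> ?Z - S" for S u
  proof (cases "u \<in> verts B")
    case True then show ?thesis using u by blast
  next
    case False
    then have ux: "u \<in> set xs" using u by blast
    then have e: "b \<in> verts B" "b' \<in> verts B" "b \<noteq> b'" "{b, hd xs} \<in> edges G" "{last xs, b'} \<in> edges G"
      using ends[OF length_pos_if_in_set[OF ux, THEN length_greater_0_conv[THEN iffD1]]] by blast+
    obtain ys zs where d: "xs = ys @ u # zs" using ux by (auto simp: in_set_conv_decomp)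
    have s: "walk G (b # ys @ [u])"
      "walk G ((u # zs) @ [b'])"
      using xs(4) e unfolding d by (auto simp: successively_append_iff successively_Cons hd_append split: if_splits)
    show ?thesis
    proof (cases "b' \<notin> S \<and> set zs \<inter> S = {}")
      case True
      then have "set ((u # zs) @ [b']) \<subseteq> ?Z - S" using d e u by auto
      then have "reach G (?Z - S) u b'" by (rule reach_successively[OF s(2)]) auto
      then show ?thesis using e True by blast
    next
      case False
      then have "b \<notin> S \<and> set ys \<inter> S = {}" using S e xs(1,2) d by auto
      then have "set (b # ys @ [u]) \<subseteq> ?Z - S" "b \<in> verts B - S" using d e u by auto
      then have "reach G (?Z - S) u b" by (intro reach_successively[OF s(1)]) auto
      then show ?thesis using \<open>b \<in> verts B - S\<close> by blast
    qed
  qed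
  have "reach (induced G ?Z) (?Z - S) u v"
    if S: "S = {} \<or> (\<exists>x. S = {x})" and u: "u \<in> ?Z - S" "v \<in> ?Z - S" for S u v
  proof -
    obtain z where z: "z \<in> verts B - S" "reach G (?Z - S) u z" using toB[OF S u(1)] by blast
    obtain z' where z': "z' \<in> verts B - S" "reach G (?Z - S) v z'" using toB[OF S u(2)] by blast
    have "reach B (verts B - S) z z'" using nonsepD[OF B(2) wfB(1) S z(1) z'(1)] .
    then have "reach G (?Z - S) z z'" by (rule reach_mono) (use wfB in auto)
    then have "reach G (?Z - S) u v" using z z' reach_trans reach_sym by metis
    then show ?thesis by (simp add: reach_induced)
  qed
  moreover have "verts B \<noteq> {}" using B(2) by (auto simp: nonsep_def connected_graph_def)
  ultimately show ?thesis unfolding nonsep_iff_small[OF wfZ] by auto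
qed

lemma block_absorbs:
  assumes wf: "wf_sgraph G" and B: "B \<in> blocks G"
    and xs: "distinct xs" "set xs \<inter> verts B = {}" "set xs \<subseteq> verts G"
      "walk G xs"
    and ends: "xs \<noteq> [] \<Longrightarrow> b \<in> verts B \<and> b' \<in> verts B \<and> b \<noteq> b' \<and>
      {b, hd xs} \<in> edges G \<and> {last xs, b'} \<in> edges G"
  shows "induced G (verts B \<union> set xs) = B"
proof (rule blocksD(6)[OF B])
  note b = blocksD[OF B]
  have wfZ: "wf_sgraph (induced G (verts B \<union> set xs))" using wf_induced[OF wf] b xs by simp
  then show "subgraph (induced G (verts B \<union> set xs)) G" using b xs by (auto simp: subgraph_def)
  show "nonsep (induced G (verts B \<union> set xs))"
    using nonsep_add_ear[OF wf b(1,3) xs ends] by blast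
  have "e \<subseteq> verts B" if "e \<in> edges B" for e using that b(2) by (simp add: wf_sgraph_def)
  then show "subgraph B (induced G (verts B \<union> set xs))"
    using b unfolding subgraph_def induced_simps by blast
qed

lemma block_induced:
  assumes "wf_sgraph G" "B \<in> blocks G"
  shows "B = induced G (verts B)"
  using block_absorbs[OF assms, of "[]"] by simp

lemma block_edge:
  assumes "wf_sgraph G" "B \<in> blocks G" "x \<in> verts B" "y \<in> verts B" "{x, y} \<in> edges G"
  shows "{x, y} \<in> edges B"
  using arg_cong[OF block_induced[OF assms(1,2)], of edges] assms(3-5) by simp

text \<open>A path outside \<open>B\<close> joining two different vertices of \<open>B\<close> would
  be an ear and enlarge the block. Thus everything attached to a block hangs at a single
  vertex.\<close>

lemma block_no_ear:
  assumes wf: "wf_sgraph G" and B: "B \<in> blocks G" and r: "reach G (verts G - verts B) u v"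
    and u: "u \<in> verts G - verts B"
    and b: "b \<in> verts B" "b' \<in> verts B" "{b, u} \<in> edges G" "{v, b'} \<in> edges G"
  shows "b = b'"
proof (rule ccontr)
  assume ne: "b \<noteq> b'"
  obtain xs where xs: "xs \<noteq> []" "hd xs = u" "last xs = v" "distinct xs" "set xs \<subseteq> verts G - verts B"
    "walk G xs" using reach_path[OF r u] .
  have "induced G (verts B \<union> set xs) = B"
    using block_absorbs[OF wf B xs(4) _ _ xs(6), of b b'] xs b ne by blast
  then have "set xs \<subseteq> verts B" by (metis induced_simps(1) Un_upper2)
  then show False using xs(1,5) hd_in_set[OF xs(1)] by blast
qed

lemma nontrivial_block_card:
  assumes B: "B \<in> blocks G" and "\<not> trivial_block B"
  shows "3 \<le> card (verts B)"
proof (rule ccontr)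
  note b = blocksD[OF B]
  have conn: "connected_graph B" using b(3) by (simp add: nonsep_def)
  then have V: "verts B \<noteq> {}" "finite (verts B)" using b(2) by (auto simp: connected_graph_def wf_sgraph_def)
  then have "card (verts B) \<noteq> 0" by simp
  moreover assume "\<not> 3 \<le> card (verts B)"
  ultimately consider (1) "card (verts B) = 1" | (2) "card (verts B) = 2" by linarith
  then show False
  proof cases
    case 1
    then obtain v where v: "verts B = {v}" by (auto simp: card_1_singleton_iff)
    have "edges B = {}"
    proof (rule ccontr)
      assume "edges B \<noteq> {}"
      then obtain e where "e \<subseteq> {v}" "card e = 2" using b(2) v by (auto simp: wf_sgraph_def)
      then show False using card_mono[of "{v}" e] by simp
    qed
    then have "complete B" using v by (auto simp: complete_def)
    then show False using assms(2) 1 by (simp add: trivial_block_def order_def)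
  next
    case 2
    then obtain u v where uv: "verts B = {u, v}" "u \<noteq> v" by (auto simp: card_2_iff)
    have "reach B {u, v} u v" using conn uv by (auto simp: connected_graph_iff[OF b(2)])
    then have "\<exists>w. {u, w} \<in> edges B" using uv(2) unfolding reach_def
      by (auto elim: converse_rtranclpE)
    then obtain w where w: "{u, w} \<in> edges B" by blast
    then have "w = v" using edge_verts[OF b(2) w] edge_ne[OF b(2) w] uv by auto
    have "e = {u, v}" if e: "e \<in> edges B" for e
    proof -
      have "e \<subseteq> {u, v}" "card e = 2" using b(2) e uv by (auto simp: wf_sgraph_def)
      then show ?thesis using uv by (intro card_seteq) auto
    qed
    then have "edges B = {{u, v}}" using w \<open>w = v\<close> by blast
    then have "complete B" using uv by (auto simp: complete_def)
    then show False using assms(2) 2 by (simp add: trivial_block_def order_def)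
  qed
qed

text \<open>There is a third vertex, so connectivity of \<open>B - x\<close> gives \<open>y\<close>
  a neighbour \<open>z\<close> other than \<open>x\<close>, and connectivity of \<open>B - y\<close>
  gives a path from \<open>z\<close> to \<open>x\<close>, closed up through \<open>y\<close>. The
  final shift by \<open>-1\<close> moves \<open>x\<close>, the last entry of the list, to index
  0.\<close>

lemma nonsep_edge_on_cycle:
  assumes wf: "wf_sgraph B" and B: "nonsep B" "3 \<le> card (verts B)" and e: "{x, y} \<in> edges B"
  obtains m c where "icyc B m c" "c 0 = x" "c 1 = y"
proof -
  have xy: "x \<in> verts B" "y \<in> verts B" "x \<noteq> y" using edge_verts[OF wf e] edge_ne[OF wf e] by auto
  have "\<not> verts B \<subseteq> {x, y}"
    using B(2) card_mono[of "{x, y}" "verts B"] card_insert_le_m1[of 2 "{y}" x] by (auto simp: xy)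
  then obtain t where t: "t \<in> verts B" "t \<noteq> x" "t \<noteq> y" by blast
  have "reach B (verts B - {x}) y t" using nonsepD[OF B(1) wf, of "{x}" y t] xy t by auto
  then obtain z where z: "{y, z} \<in> edges B" "z \<in> verts B - {x}"
    using t(3) unfolding reach_def by (auto elim: converse_rtranclpE)
  have zy: "z \<noteq> y" using edge_ne[OF wf z(1)] by auto
  have "reach B (verts B - {y}) z x" using nonsepD[OF B(1) wf, of "{y}" z x] xy z zy by auto
  then obtain ps where ps: "ps \<noteq> []" "hd ps = z" "last ps = x" "distinct ps" "set ps \<subseteq> verts B - {y}"
    "walk B ps" using reach_path z zy by (metis Diff_iff singletonD)
  have "length ps \<noteq> 1" using ps z(2) by (auto simp: length_Suc_conv)
  then have len: "3 \<le> length (y # ps)" using ps(1) by (cases ps) (auto simp: Suc_le_eq)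
  define c where "c = (\<lambda>i. (y # ps) ! nat (i mod int (length (y # ps))))"
  have "distinct (y # ps)" "walk B (y # ps)"
    "{last (y # ps), hd (y # ps)} \<in> edges B"
    using ps z e by (auto simp: successively_Cons)
  note l = icyc_of_list[OF this(1) len this(2,3), folded c_def]
  have nth: "c (int i) = (y # ps) ! i" if "i < length (y # ps)" for i using l(3)[OF that] by (simp add: c_def)
  have "(y # ps) ! length ps = x" using ps by (auto simp: nth_Cons' last_conv_nth)
  then have "c (int (length ps)) = x" using nth[of "length ps"] by simp
  moreover have "int (length (y # ps)) dvd - 1 - int (length ps)" by (intro dvdI[of _ _ "-1"]) simp
  then have "c (- 1) = c (int (length ps))" using icycD(2)[OF l(1)] by blast
  moreover have "c 0 = y" using nth[of 0] by simp
  ultimately show thesis using that[of _ "\<lambda>i. c (i + - 1)"] icyc_shift[OF l(1), of "-1"] by auto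
qed

section \<open>Covers of a cycle\<close>

lemma gpath_rev: "gpath G xs \<Longrightarrow> gpath G (rev xs)"
  by (simp add: gpath_def insert_commute)

lemma icyc_window_kpath:
  assumes wf: "wf_sgraph G" and c: "icyc G m c" and k: "0 < k" "int k \<le> m"
  shows "c ` {a..<a + int k} \<in> kpath_sets k G (range c)"
proof -
  define xs where "xs = map (\<lambda>i. c (a + int i)) [0..<k]"
  note l = icyc_path_list[OF c k(2) xs_def]
  have "xs \<noteq> []" using l(3) k by auto
  moreover have "set xs \<subseteq> verts G" using l(4) icyc_verts[OF wf c] by auto
  ultimately have "gpath G xs" using l by (simp add: gpath_def)
  then show ?thesis unfolding kpath_sets_def using l by (intro CollectI exI[of _ xs]) auto
qed

lemma konig_E:
  assumes "konig k G X"
  obtains M T where "M \<subseteq> kpath_sets k G X" "pairwise disjnt M" "T \<subseteq> X"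
    "\<forall>S\<in>kpath_sets k G X. T \<inter> S \<noteq> {}" "card M = card T"
proof -
  from assms[unfolded konig_def] obtain M T where "M \<subseteq> kpath_sets k G X" "pairwise disjnt M" "T \<subseteq> X"
    "\<forall>S\<in>kpath_sets k G X. T \<inter> S \<noteq> {}" "card M = card T" by (elim exE conjE)
  then show thesis by (intro that[of M T]) simp_all
qed

text \<open>Pairs of a window of \<open>k\<close> consecutive cycle vertices and an element of
  \<open>T\<close> in it are counted twice: every window is a \<open>k\<close>-path and is hit, and
  every element of \<open>T\<close> on the cycle lies in \<open>k\<close> windows. The bound on
  \<open>card T\<close> comes from the packing of the same size, whose members have \<open>k\<close>
  vertices each.\<close>

lemma cycle_cover_count:
  assumes wf: "wf_sgraph G" and c: "icyc G m c" and k: "0 < k" "int k \<le> m"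
    and X: "X \<subseteq> verts G" "range c \<subseteq> X" and konig: "konig k G X"
  obtains T where "T \<subseteq> X" "\<forall>S\<in>kpath_sets k G X. T \<inter> S \<noteq> {}" "k * card T \<le> card X"
    "\<forall>j. 1 \<le> card {l \<in> {0..<int k}. c (j + l) \<in> T}"
    "(\<Sum>j\<in>{0..<m}. card {l \<in> {0..<int k}. c (j + l) \<in> T}) = k * card (T \<inter> range c)"
proof -
  have finX: "finite X" using X(1) wf finite_subset by (auto simp: wf_sgraph_def)
  obtain M T where M: "M \<subseteq> kpath_sets k G X" "pairwise disjnt M" and T: "T \<subseteq> X"
    "\<forall>S\<in>kpath_sets k G X. T \<inter> S \<noteq> {}" "card M = card T" by (rule konig_E[OF konig])
  have finT: "finite T" using T(1) finX finite_subset by blast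
  have Mk: "S \<subseteq> X \<and> card S = k \<and> finite S" if "S \<in> M" for S using kpath_setsD[of S k G X] M(1) that by blast
  have "card (\<Union>M) = (\<Sum>S\<in>M. card S)"
    using M(2) Mk by (intro card_Union_disjoint) simp_all
  also have "\<dots> = (\<Sum>S\<in>M. k)" using Mk by (intro sum.cong) simp_all
  also have "\<dots> = k * card T" using T(3) by simp
  finally have "k * card T = card (\<Union>M)" by simp
  also have "\<dots> \<le> card X" using finX Mk by (intro card_mono) blast+
  finally have 1: "k * card T \<le> card X" .
  have 2: "1 \<le> card {l \<in> {0..<int k}. c (j + l) \<in> T}" for j
  proof -
    have "c ` {j..<j + int k} \<in> kpath_sets k G X"
      using icyc_window_kpath[OF wf c k] kpath_sets_mono[OF X(2)] by blast
    then obtain i where "i \<in> {j..<j + int k}" "c i \<in> T" using T(2) by fast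
    then have "i - j \<in> {l \<in> {0..<int k}. c (j + l) \<in> T}" by simp
    then have "{l \<in> {0..<int k}. c (j + l) \<in> T} \<noteq> {}" by blast
    moreover have "finite {l \<in> {0..<int k}. c (j + l) \<in> T}" by (rule finite_subset[of _ "{0..<int k}"]) auto
    ultimately have "0 < card {l \<in> {0..<int k}. c (j + l) \<in> T}" using card_gt_0_iff by blast
    then show ?thesis by linarith
  qed
  have sh: "card {j \<in> {0..<m}. c (j + l) \<in> T} = card (T \<inter> range c)" for l
  proof (rule bij_betw_same_card)
    note cl = icyc_shift[OF c, of l]
    have "range (\<lambda>j. c (j + l)) = range c"
      by (auto simp: image_iff) (metis diff_add_cancel)
    moreover have "range (\<lambda>j. c (j + l)) = (\<lambda>j. c (j + l)) ` {0..<m}"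
      using icyc_range[OF cl, of 0] by simp
    ultimately have R: "range c = (\<lambda>j. c (j + l)) ` {0..<m}" by simp
    have "T \<inter> range c = (\<lambda>j. c (j + l)) ` {j \<in> {0..<m}. c (j + l) \<in> T}" unfolding R by blast
    moreover have "inj_on (\<lambda>j. c (j + l)) {j \<in> {0..<m}. c (j + l) \<in> T}"
      using icyc_inj[OF cl, of 0] by (rule inj_on_subset) auto
    ultimately show "bij_betw (\<lambda>j. c (j + l)) {j \<in> {0..<m}. c (j + l) \<in> T} (T \<inter> range c)"
      by (simp add: bij_betw_def)
  qed
  have "(\<Sum>j\<in>{0..<m}. card {l \<in> {0..<int k}. c (j + l) \<in> T}) =
    (\<Sum>l\<in>{0..<int k}. card {j \<in> {0..<m}. c (j + l) \<in> T})"
  proof -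
    have cs: "card {l \<in> I. P l} = (\<Sum>l\<in>I. if P l then 1 else 0)" if "finite I" for I :: "int set" and P
      using sum.inter_filter[OF that, of "\<lambda>_. 1::nat" P] by simp
    show ?thesis unfolding cs[OF finite_atLeastLessThan_int] by (rule sum.swap)
  qed
  also have "\<dots> = k * card (T \<inter> range c)" using sh by simp
  finally show thesis using that[OF T(1,2) 1] 2 by blast
qed

text \<open>On the vertex set of the cycle the two counts read \<open>m \<le> k * card T\<close> and
  \<open>k * card T \<le> m\<close>.\<close>

lemma cycle_length_dvd:
  assumes wf: "wf_sgraph G" and c: "icyc G m c" and k: "0 < k" "int k \<le> m" and konig: "konig k G (range c)"
  shows "int k dvd m"
proof -
  note cc = icyc_card[OF c]
  obtain T where T: "T \<subseteq> range c" "\<forall>S\<in>kpath_sets k G (range c). T \<inter> S \<noteq> {}" "k * card T \<le> card (range c)"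
    "\<forall>j. 1 \<le> card {l \<in> {0..<int k}. c (j + l) \<in> T}"
    "(\<Sum>j\<in>{0..<m}. card {l \<in> {0..<int k}. c (j + l) \<in> T}) = k * card (T \<inter> range c)"
    by (rule cycle_cover_count[OF wf c k icyc_verts[OF wf c] order_refl konig])
  have "(\<Sum>j\<in>{0..<m}. 1) \<le> (\<Sum>j\<in>{0..<m}. card {l \<in> {0..<int k}. c (j + l) \<in> T})"
    using T(4) by (intro sum_mono) blast
  then have "nat m \<le> k * card T" using T(1,5) by (simp add: Int_absorb2)
  moreover have "nat m = card (range c)" using cc by (metis nat_int)
  ultimately have "nat m = k * card T" using T(3) by linarith
  moreover have "m = int (nat m)" using icycD(1)[OF c] by simp
  ultimately have "m = int k * int (card T)" by simp
  then show ?thesis by simp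
qed

text \<open>The bound on \<open>card X\<close> gives \<open>card T \<le> n\<close>, while the
  windows require at least \<open>n\<close> cover vertices on the cycle. So \<open>T\<close> lies on
  the cycle, every window contains exactly one element of \<open>T\<close>, and membership in
  \<open>T\<close> has period \<open>k\<close>.\<close>

lemma cycle_class_cover:
  assumes wf: "wf_sgraph G" and c: "icyc G (int (n * k)) c" and k: "0 < k" "0 < n"
    and X: "X \<subseteq> verts G" "range c \<subseteq> X" "card X < (n + 1) * k" and konig: "konig k G X"
  obtains i where "\<forall>S\<in>kpath_sets k G X. \<exists>j. int k dvd j - i \<and> c j \<in> S"
proof -
  have km: "int k \<le> int (n * k)" using k by simp
  have finX: "finite X" using X(1) wf finite_subset by (auto simp: wf_sgraph_def)
  define w where "w T j = card {l \<in> {0..<int k}. c (j + l) \<in> T}" for T j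
  obtain T where T: "T \<subseteq> X" "\<forall>S\<in>kpath_sets k G X. T \<inter> S \<noteq> {}" "k * card T \<le> card X"
    "\<forall>j. 1 \<le> card {l \<in> {0..<int k}. c (j + l) \<in> T}"
    "(\<Sum>j\<in>{0..<int (n * k)}. card {l \<in> {0..<int k}. c (j + l) \<in> T}) = k * card (T \<inter> range c)"
    by (rule cycle_cover_count[OF wf c k(1) km X(1,2) konig])
  note T = T[folded w_def]
  have finT: "finite T" using T(1) finX finite_subset by blast
  have "k * card T < (n + 1) * k" using T(3) X(3) by simp
  then have Tn: "card T \<le> n" by (metis Suc_eq_plus1 less_Suc_eq_le mult.commute mult_less_cancel1)
  have ge: "(\<Sum>j\<in>{0..<int (n * k)}. 1) \<le> (\<Sum>j\<in>{0..<int (n * k)}. w T j)"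
    using T(4) by (intro sum_mono) blast
  have one: "(\<Sum>j\<in>{0..<int (n * k)}. 1 :: nat) = n * k" unfolding card_eq_sum[symmetric] by (simp add: nat_mult_distrib)
  have "n * k \<le> k * card (T \<inter> range c)" using T(5) ge one by linarith
  then have "n \<le> card (T \<inter> range c)" using k by (simp add: mult.commute)
  moreover have "card (T \<inter> range c) \<le> card T" using finT by (intro card_mono) auto
  ultimately have eq: "card (T \<inter> range c) = n" "card T = n" using Tn by auto
  then have Tc: "T \<subseteq> range c" using finT by (metis card_subset_eq inf_le1 inf.cobounded2)
  have w1: "w T j = 1" for j
  proof -
    have per: "w T (i + int (n * k)) = w T i" for i
      unfolding w_def using icyc_periodic[OF c] by (metis (no_types, opaque_lifting) add.assoc add.commute)
    have "w T i = 1" if "i \<in> {0..<int (n * k)}" for i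
    proof (rule ccontr)
      assume "w T i \<noteq> 1"
      then have "1 < w T i" using T(4)[rule_format, of i] by simp
      then have "(\<Sum>j\<in>{0..<int (n * k)}. 1) < (\<Sum>j\<in>{0..<int (n * k)}. w T j)"
        using T(4) that by (intro sum_strict_mono_ex1) auto
      then show False using T(5) one mult.commute[of n k] unfolding eq by linarith
    qed
    moreover have "j mod int (n * k) \<in> {0..<int (n * k)}" using k by simp
    ultimately show ?thesis using periodic_mod[of "w T" "int (n * k)" j, OF per] by metis
  qed
  \<comment> \<open>The windows starting at \<open>j\<close> and \<open>j + 1\<close> differ only in
    \<open>c j\<close> and \<open>c (j + k)\<close>, and each contains exactly one vertex of
    \<open>T\<close>.\<close>
  have step: "c j \<in> T \<longleftrightarrow> c (j + int k) \<in> T" for j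
  proof -
    let ?R = "{l \<in> {1..<int k}. c (j + l) \<in> T}"
    let ?A = "{l \<in> {0}. c (j + l) \<in> T}" and ?B = "{l \<in> {int k}. c (j + l) \<in> T}"
    have "{l \<in> {0..<int k}. c (j + l) \<in> T} = ?A \<union> ?R" using k by auto
    moreover have fin: "finite ?R" by (rule finite_subset[of _ "{1..<int k}"]) auto
    have "card (?A \<union> ?R) = card ?A + card ?R" by (intro card_Un_disjoint fin) auto
    ultimately have "w T j = card ?A + card ?R" unfolding w_def by (simp only:)
    moreover have "w T (j + 1) = card (?R \<union> ?B)"
      unfolding w_def
    proof (rule bij_betw_same_card[of "\<lambda>l. l + 1"], rule bij_betw_imageI)
      show "(\<lambda>l. l + 1) ` {l \<in> {0..<int k}. c (j + 1 + l) \<in> T} = ?R \<union> ?B"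
      proof (intro equalityI subsetI)
        fix x assume "x \<in> ?R \<union> ?B"
        then show "x \<in> (\<lambda>l. l + 1) ` {l \<in> {0..<int k}. c (j + 1 + l) \<in> T}"
          using k by (intro image_eqI[of _ _ "x - 1"]) auto
      qed (use k in \<open>auto simp: algebra_simps\<close>)
    qed (simp add: inj_on_def)
    moreover have "card (?R \<union> ?B) = card ?R + card ?B" by (intro card_Un_disjoint fin) auto
    ultimately have "card ?A = card ?B" using w1 by simp
    then show ?thesis by (cases "c j \<in> T"; cases "c (j + int k) \<in> T") (simp_all add: Collect_conv_if)
  qed
  have shift: "c j \<in> T \<longleftrightarrow> c i \<in> T" if "int k dvd j - i" for i j
    using periodic_cong[of "\<lambda>j. c j \<in> T" "int k" j i] step that by simp
  have "T \<noteq> {}" using eq k by auto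
  then obtain i where i: "c i \<in> T" using Tc by blast
  have only: "int k dvd j - i" if "c j \<in> T" for j
  proof (rule ccontr)
    assume nd: "\<not> int k dvd j - i"
    define e where "e = (j - i) mod int k"
    have e: "0 \<le> e" "e < int k" "e \<noteq> 0" using k nd by (auto simp: e_def dvd_eq_mod_eq_0)
    have "int k dvd j - i - e" unfolding e_def by (rule dvd_minus_mod)
    then have "int k dvd j - (i + e)" by (simp add: algebra_simps)
    then have "c (i + e) \<in> T" using shift that by blast
    then have "{0, e} \<subseteq> {l \<in> {0..<int k}. c (i + l) \<in> T}" using e i k by auto
    moreover have "finite {l \<in> {0..<int k}. c (i + l) \<in> T}" by (rule finite_subset[of _ "{0..<int k}"]) auto
    ultimately have "card {0, e} \<le> w T i" unfolding w_def by (intro card_mono)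
    then show False using w1[of i] e by simp
  qed
  show thesis
  proof (rule that[of i], rule ballI)
    fix S assume "S \<in> kpath_sets k G X"
    then obtain x where "x \<in> T" "x \<in> S" using T(2) by fast
    then show "\<exists>j. int k dvd j - i \<and> c j \<in> S" using Tc only by blast
  qed
qed

lemma pendant_window_kpath:
  assumes wf: "wf_sgraph G" and c: "icyc G m c" and k: "int k \<le> m"
    and ys: "gpath G (c a # ys)" "set ys \<inter> range c = {}" "length ys < k"
  shows "set ys \<union> c ` {a..<a + int (k - length ys)} \<in> kpath_sets k G (range c \<union> set ys)"
proof -
  define l where "l = k - length ys"
  define xs where "xs = map (\<lambda>i. c (a + int i)) [0..<l]"
  have l: "0 < l" "int l \<le> m" using ys(3) k by (auto simp: l_def)
  note p = icyc_path_list[OF c l(2) xs_def]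
  have xs: "xs \<noteq> []" "hd xs = c a" using l p(3) by (auto simp: xs_def hd_map)
  have "gpath G (rev ys @ xs)"
    unfolding gpath_def
  proof (intro conjI)
    show "distinct (rev ys @ xs)" using p ys by (auto simp: gpath_def)
    show "set (rev ys @ xs) \<subseteq> verts G" using p(4) icyc_verts[OF wf c] ys(1) by (auto simp: gpath_def)
    show "walk G (rev ys @ xs)"
      using p(2) ys(1) xs
      by (auto simp: gpath_def successively_append_iff successively_Cons insert_commute last_rev)
  qed (use xs in simp)
  moreover have "length (rev ys @ xs) = k" using p(3) ys(3) by (simp add: l_def)
  moreover have "set (rev ys @ xs) = set ys \<union> c ` {a..<a + int (k - length ys)}"
    using p(4) by (simp add: l_def)
  ultimately show ?thesis unfolding kpath_sets_def by (intro CollectI exI[of _ "rev ys @ xs"]) auto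
qed

text \<open>The \<open>r\<close> vertices attached at \<open>a\<close>, followed by the cycle
  vertices from \<open>a\<close> to \<open>a + k - r - 1\<close>, form a \<open>k\<close>-path. It
  misses the class of \<open>a - d\<close> for \<open>1 \<le> d \<le> r\<close>, so this class is
  not the covering one. The bound on the total length makes \<open>cycle_class_cover\<close>
  applicable.\<close>

lemma pendants_avoid_class:
  assumes wf: "wf_sgraph G" and c: "icyc G (int (n * k)) c" and k: "0 < k" "0 < n" and A: "finite A"
    and ys: "\<And>a. a \<in> A \<Longrightarrow> gpath G (c a # ys a)" "\<And>a. a \<in> A \<Longrightarrow> set (ys a) \<inter> range c = {}"
    and disj: "\<And>a b. a \<in> A \<Longrightarrow> b \<in> A \<Longrightarrow> a \<noteq> b \<Longrightarrow> set (ys a) \<inter> set (ys b) = {}"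
    and len: "(\<Sum>a\<in>A. length (ys a)) < k"
    and konig: "\<And>X. X \<subseteq> verts G \<Longrightarrow> konig k G X"
  obtains i where "\<And>a d. a \<in> A \<Longrightarrow> 1 \<le> d \<Longrightarrow> d \<le> int (length (ys a)) \<Longrightarrow>
    \<not> int k dvd a + d - i \<and> \<not> int k dvd a - d - i"
proof -
  define X where "X = range c \<union> (\<Union>a\<in>A. set (ys a))"
  have X: "X \<subseteq> verts G" "range c \<subseteq> X"
    using icyc_verts[OF wf c] ys(1) by (auto simp: X_def gpath_def)
  have "card (\<Union>a\<in>A. set (ys a)) \<le> (\<Sum>a\<in>A. card (set (ys a)))" using A by (rule card_UN_le)
  also have "\<dots> \<le> (\<Sum>a\<in>A. length (ys a))" by (intro sum_mono card_length)
  finally have "card (\<Union>a\<in>A. set (ys a)) < k" using len by simp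
  moreover have "card (range c) = n * k" using icyc_card[OF c] of_nat_eq_iff by blast
  moreover have "card X \<le> card (range c) + card (\<Union>a\<in>A. set (ys a))"
    unfolding X_def by (rule card_Un_le)
  ultimately have cX: "card X < (n + 1) * k" by simp
  obtain i where i: "\<forall>S\<in>kpath_sets k G X. \<exists>j. int k dvd j - i \<and> c j \<in> S"
    by (rule cycle_class_cover[OF wf c k X cX konig[OF X(1)]])
  have km: "int k \<le> int (n * k)" using k by simp
  \<comment> \<open>Stated for an arbitrary parametrization \<open>c'\<close> of the cycle, so that
    the reflected one yields the classes on the other side of \<open>a\<close>.\<close>
  have half: False
    if c': "icyc G (int (n * k)) c'" "range c' = range c" and g: "gpath G (c' a # ys b)"
      and b: "b \<in> A" "length (ys b) < k" and d: "1 \<le> d" "d \<le> int (length (ys b))"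
      and hit: "\<forall>S\<in>kpath_sets k G X. \<exists>j. int k dvd j - i' \<and> c' j \<in> S" and dv: "int k dvd a - d - i'"
    for c' a b d i'
  proof -
    have "set (ys b) \<union> c' ` {a..<a + int (k - length (ys b))} \<in> kpath_sets k G (range c' \<union> set (ys b))"
      using pendant_window_kpath[OF wf c'(1) km g _ b(2)] ys(2)[OF b(1)] c'(2) by simp
    moreover have "range c' \<union> set (ys b) \<subseteq> X" using c'(2) b by (auto simp: X_def)
    ultimately have "set (ys b) \<union> c' ` {a..<a + int (k - length (ys b))} \<in> kpath_sets k G X"
      using kpath_sets_mono by (meson subsetD)
    from bspec[OF hit this] obtain j where j: "int k dvd j - i'" "c' j \<in> set (ys b) \<union> c' ` {a..<a + int (k - length (ys b))}"
      by blast
    have "c' j \<notin> set (ys b)" using ys(2)[OF b(1)] c'(2) by auto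
    then obtain e where e: "a \<le> e" "e < a + int (k - length (ys b))" "c' j = c' e" using j(2) by auto
    then have "int (n * k) dvd j - e" using icycD(2)[OF c'(1)] by blast
    then have "int k dvd j - e" by (metis dvd_trans dvd_triv_right of_nat_mult)
    from dvd_diff[OF dvd_diff[OF j(1) this] dv] have "int k dvd (j - i') - (j - e) - (a - d - i')" .
    then have "int k dvd e - a + d" by (simp add: algebra_simps)
    moreover have "0 < e - a + d" "e - a + d < int k" using e d b by auto
    ultimately show False using zdvd_imp_le by fastforce
  qed
  show thesis
  proof (rule that[of i])
    fix a d assume a: "a \<in> A" and d: "1 \<le> d" "d \<le> int (length (ys a))"
    have "length (ys a) \<le> (\<Sum>a\<in>A. length (ys a))" using a A by (intro member_le_sum) auto
    then have lk: "length (ys a) < k" using len by simp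
    have "\<not> int k dvd a - d - i" using half[OF c refl ys(1)[OF a] a lk d i] by blast
    moreover have "\<not> int k dvd a + d - i"
    proof
      assume dv: "int k dvd a + d - i"
      have r: "range (\<lambda>i. c (- i)) = range c" by (auto simp: image_iff) (metis minus_minus)
      have "(- a) - d - (- i) = - (a + d - i)" by simp
      then have "int k dvd (- a) - d - (- i)" using dv by (simp only: dvd_minus_iff)
      have "\<exists>j. int k dvd j - (- i) \<and> c (- j) \<in> S" if "S \<in> kpath_sets k G X" for S
      proof -
        from bspec[OF i that] obtain j where "int k dvd j - i" "c j \<in> S" by blast
        moreover have "- j - (- i) = - (j - i)" by simp
        ultimately have "int k dvd - j - (- i) \<and> c (- (- j)) \<in> S"
          by (simp only: dvd_minus_iff) simp
        then show ?thesis by blast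
      qed
      then have hit: "\<forall>S\<in>kpath_sets k G X. \<exists>j. int k dvd j - (- i) \<and> c (- j) \<in> S" by blast
      have "gpath G (c (- (- a)) # ys a)" using ys(1)[OF a] by simp
      from half[OF icyc_rev[OF c] r this a lk d hit] show False using \<open>int k dvd (- a) - d - (- i)\<close> by blast
    qed
    ultimately show "\<not> int k dvd a + d - i \<and> \<not> int k dvd a - d - i" by blast
  qed
qed

section \<open>Forests\<close>

lemma kpath_setsE:
  assumes "S \<in> kpath_sets k G X"
  obtains xs where "gpath G xs" "length xs = k" "set xs \<subseteq> X" "S = set xs"
  using assms unfolding kpath_sets_def by (elim CollectE exE conjE) (rule that)

lemma kpath_sets_reach:
  assumes "S \<in> kpath_sets k G X" "u \<in> S" "v \<in> S" "S \<subseteq> Z"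
  shows "reach G Z u v"
proof -
  obtain xs where "gpath G xs" "S = set xs" by (rule kpath_setsE[OF assms(1)])
  then show ?thesis using assms(2-4) by (intro reach_successively[of G xs]) (simp_all add: gpath_def)
qed

text \<open>A part of \<open>X\<close> that is attached to the rest only through \<open>w\<close>.
  It may be disconnected, so that \<open>X\<close> itself qualifies and the minimisation can
  start.\<close>

definition limb :: "nat \<Rightarrow> 'a sgraph \<Rightarrow> 'a set \<Rightarrow> 'a \<Rightarrow> 'a set \<Rightarrow> bool" where
  "limb k G X w D \<longleftrightarrow> w \<in> D \<and> D \<subseteq> X \<and> kpath_sets k G D \<noteq> {} \<and>
     (\<forall>u\<in>D - {w}. \<forall>v\<in>X - D. {u, v} \<notin> edges G)"

text \<open>In a smallest limb no \<open>k\<close>-path avoids \<open>w\<close>. Otherwise let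
  \<open>D1\<close> be its component in \<open>D - w\<close>: edges of \<open>X\<close> leave
  \<open>D1\<close> only towards \<open>w\<close>, and only from one vertex \<open>r\<close>, as two
  would close a cycle through \<open>w\<close>. Then \<open>D1\<close> with root \<open>r\<close> is
  a smaller limb. Consequently every \<open>k\<close>-path meeting \<open>D\<close> contains
  \<open>w\<close>.\<close>

lemma forest_step:
  assumes wf: "wf_sgraph G" and k: "k > 0" and X: "X \<subseteq> verts G"
    and acyc: "\<And>m c. icyc G m c \<Longrightarrow> \<not> range c \<subseteq> X" and ne: "kpath_sets k G X \<noteq> {}"
  obtains w D where "w \<in> D" "D \<subseteq> X" "kpath_sets k G D \<noteq> {}"
    "\<forall>S\<in>kpath_sets k G X. w \<notin> S \<longrightarrow> S \<inter> D = {}"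
proof -
  have finX: "finite X" using X wf finite_subset by (auto simp: wf_sgraph_def)
  obtain S0 where S0: "S0 \<in> kpath_sets k G X" using ne by blast
  then obtain x0 where "x0 \<in> S0" using kpath_setsD[OF S0] k by fastforce
  then have "x0 \<in> X" using kpath_setsD[OF S0] by blast
  then have "limb k G X x0 X" using ne by (simp add: limb_def)
  then have "case (x0, X) of (w, D) \<Rightarrow> limb k G X w D" by simp
  from ex_has_least_nat[of "\<lambda>(w, D). limb k G X w D", OF this, of "\<lambda>(w, D). card D"]
  obtain w D where wD: "limb k G X w D" and min: "\<And>w' D'. limb k G X w' D' \<Longrightarrow> card D \<le> card D'"
    by fast
  have l: "w \<in> D" "D \<subseteq> X" "kpath_sets k G D \<noteq> {}" and
    att: "\<And>u v. u \<in> D \<Longrightarrow> u \<noteq> w \<Longrightarrow> v \<in> X \<Longrightarrow> v \<notin> D \<Longrightarrow> {u, v} \<notin> edges G"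
    using wD by (auto simp: limb_def)
  have none: "kpath_sets k G (D - {w}) = {}"
  proof (rule ccontr)
    assume "kpath_sets k G (D - {w}) \<noteq> {}"
    then obtain S where S: "S \<in> kpath_sets k G (D - {w})" by blast
    then obtain s where s: "s \<in> S" using kpath_setsD[OF S] k by fastforce
    have SD: "S \<subseteq> D - {w}" using kpath_setsD[OF S] by blast
    define D1 where "D1 = {v. reach G (D - {w}) s v}"
    have D1: "D1 \<subseteq> D - {w}" unfolding D1_def using reach_in s SD by fastforce
    have "S \<subseteq> D1" unfolding D1_def using kpath_sets_reach[OF S s _ SD] by blast
    then have kp1: "kpath_sets k G D1 \<noteq> {}" using kpath_sets_restrict[OF S] by blast
    have out: "v = w" if "u \<in> D1" "v \<in> X" "v \<notin> D1" "{u, v} \<in> edges G" for u v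
    proof (rule ccontr)
      assume vw: "v \<noteq> w"
      have u: "u \<in> D" "u \<noteq> w" using D1 that(1) by auto
      then have "v \<in> D" using att that vw by blast
      then have "reach G (D - {w}) u v" using that u vw by (intro reach_edge) auto
      then have "v \<in> D1" using that(1) reach_trans unfolding D1_def by fast
      then show False using that by simp
    qed
    have "card D1 < card D"
      using D1 l finX by (intro psubset_card_mono) (auto intro: finite_subset)
    then have nolimb: "\<not> limb k G X r D1" for r using min[of r D1] by linarith
    have "s \<in> D1" by (simp add: D1_def)
    \<comment> \<open>If no edge led to \<open>w\<close>, nothing would leave \<open>D1\<close>
      within \<open>X\<close>, and the vertex \<open>s\<close> could serve as root.\<close>
    have "\<exists>r. r \<in> D1 \<and> {r, w} \<in> edges G"
    proof (rule ccontr)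
      assume no: "\<nexists>r. r \<in> D1 \<and> {r, w} \<in> edges G"
      have "{u, v} \<notin> edges G" if "u \<in> D1 - {s}" "v \<in> X - D1" for u v
        using out[of u v] no that by blast
      then have "limb k G X s D1" using \<open>s \<in> D1\<close> D1 l(2) kp1 unfolding limb_def by blast
      then show False using nolimb by blast
    qed
    then obtain r where r: "r \<in> D1" "{r, w} \<in> edges G" by blast
    have "\<not> limb k G X r D1" by (rule nolimb)
    then obtain u v where u: "u \<in> D1" "u \<noteq> r" "v \<in> X" "v \<notin> D1" "{u, v} \<in> edges G"
      using r(1) D1 l(2) kp1 unfolding limb_def by blast
    have "v = w" using out[OF u(1,3,4,5)] .
    have "reach G (D - {w}) r u"
      using r(1) u(1) reach_sym reach_trans unfolding D1_def by (metis mem_Collect_eq)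
    then obtain ps where ps: "ps \<noteq> []" "hd ps = r" "last ps = u" "distinct ps" "set ps \<subseteq> D - {w}"
      "walk G ps"
      using r(1) D1 by (elim reach_path) auto
    have "length ps \<noteq> 1" using ps(2,3) u(2) by (auto simp: length_Suc_conv)
    then have "3 \<le> length (w # ps)" using ps(1) by (cases ps) (auto simp: Suc_le_eq)
    moreover have "distinct (w # ps)" using ps by auto
    moreover have "walk G (w # ps)"
      using ps r by (simp add: successively_Cons insert_commute)
    moreover have "{last (w # ps), hd (w # ps)} \<in> edges G" using ps u \<open>v = w\<close> by simp
    ultimately obtain m c where "icyc G m c" "range c = set (w # ps)"
      using icyc_of_list[of "w # ps" G] by blast
    moreover have "set (w # ps) \<subseteq> X" using ps(5) l by auto
    ultimately show False using acyc by metis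
  qed
  have "\<forall>S\<in>kpath_sets k G X. w \<notin> S \<longrightarrow> S \<inter> D = {}"
  proof (intro ballI impI, rule ccontr)
    fix S assume S: "S \<in> kpath_sets k G X" and wS: "w \<notin> S" and "S \<inter> D \<noteq> {}"
    then obtain u where u: "u \<in> S" "u \<in> D" by blast
    have SX: "S \<subseteq> X - {w}" using kpath_setsD[OF S] wS by blast
    have "v \<in> D - {w}" if v: "v \<in> S" for v
      using kpath_sets_reach[OF S u(1) v SX]
    proof (rule reach_closed)
      show "u \<in> D - {w}" using u wS by blast
      show "y \<in> D - {w}" if "x \<in> D - {w}" "y \<in> X - {w}" "{x, y} \<in> edges G" for x y
        using att[of x y] that by blast
    qed
    then have "S \<in> kpath_sets k G (D - {w})" using kpath_sets_restrict[OF S] by blast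
    then show False using none by blast
  qed
  then show thesis using that l by blast
qed

section \<open>Paths and blocks\<close>

text \<open>A walk that leaves the block re-enters it at the vertex where it left, so its excursions
  can be cut out. For an end point outside \<open>B\<close> the induction therefore records the
  vertex \<open>b\<close> of departure.\<close>

lemma block_reach:
  assumes wf: "wf_sgraph G" and B: "B \<in> blocks G" and Z: "Z \<subseteq> verts G"
    and r: "reach G Z u w" and u: "u \<in> verts B" and w: "w \<in> verts B"
  shows "reach G (Z \<inter> verts B) u w"
proof -
  have "(y \<in> verts B \<longrightarrow> reach G (Z \<inter> verts B) u y) \<and>
    (y \<notin> verts B \<longrightarrow> (\<exists>b y'. b \<in> verts B \<and> reach G (Z \<inter> verts B) u b \<and> {b, y'} \<in> edges G \<and>
      y' \<in> Z - verts B \<and> reach G (Z - verts B) y' y))" if "reach G Z u y" for y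
    using that unfolding reach_def[of G Z]
  proof (induction rule: rtranclp_induct)
    case base
    then show ?case using u by simp
  next
    case (step y z)
    then have e: "{y, z} \<in> edges G" "y \<in> Z" "z \<in> Z" by auto
    show ?case
    proof (cases "y \<in> verts B")
      case True
      then have ry: "reach G (Z \<inter> verts B) u y" using step by blast
      show ?thesis
      proof (cases "z \<in> verts B")
        case zB: True
        then have "reach G (Z \<inter> verts B) y z" using e True by (intro reach_edge) auto
        then show ?thesis using ry zB reach_trans by fast
      next
        case False
        then show ?thesis using ry True e by blast
      qed
    next
      case False
      then obtain b y' where b: "b \<in> verts B" "reach G (Z \<inter> verts B) u b" "{b, y'} \<in> edges G"
        "y' \<in> Z - verts B" "reach G (Z - verts B) y' y" using step by blast
      show ?thesis
      proof (cases "z \<in> verts B")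
        case True
        have "reach G (verts G - verts B) y' y" by (rule reach_mono[OF b(5)]) (use Z in auto)
        then have "b = z" using block_no_ear[OF wf B _ _ b(1) True b(3) e(1)] b(4) Z by blast
        then show ?thesis using b(2) True by simp
      next
        case zB: False
        have "reach G (Z - verts B) y z" using e False zB by (intro reach_edge) auto
        then have "reach G (Z - verts B) y' z" using b(5) reach_trans by fast
        then show ?thesis using b zB by blast
      qed
    qed
  qed
  then show ?thesis using r w by blast
qed

section \<open>Subdivisions as systems of segments\<close>

text \<open>Of the multigraph only its vertices and edge names survive:
  \<open>q e 0, ..., q e k\<close> is the path that replaces the edge \<open>e\<close>, closed up if
  \<open>e\<close> is a loop.\<close>

definition segments :: "nat \<Rightarrow> 'a sgraph \<Rightarrow> 'a set \<Rightarrow> nat set \<Rightarrow> (nat \<Rightarrow> nat \<Rightarrow> 'a) \<Rightarrow> bool" where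
  "segments k B W E q \<longleftrightarrow> W \<subseteq> verts B \<and>
     (\<forall>e\<in>E. q e 0 \<in> W \<and> q e k \<in> W) \<and>
     (\<forall>e\<in>E. \<forall>i. 0 < i \<and> i < k \<longrightarrow> q e i \<in> verts B - W) \<and>
     (\<forall>e\<in>E. \<forall>e'\<in>E. \<forall>i j. 0 < i \<and> i < k \<and> 0 < j \<and> j < k \<and> q e i = q e' j \<longrightarrow> e = e' \<and> i = j) \<and>
     (\<forall>v\<in>verts B - W. \<exists>e\<in>E. \<exists>i. 0 < i \<and> i < k \<and> v = q e i) \<and>
     (\<forall>e\<in>E. \<forall>i<k. {q e i, q e (Suc i)} \<in> edges B) \<and>
     (\<forall>d\<in>edges B. \<exists>e\<in>E. \<exists>i<k. d = {q e i, q e (Suc i)})"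

lemma is_Sub_segments:
  fixes H :: "('a, nat) multigraph"
  assumes H: "wf_multigraph H" and S: "is_Sub k H B" and k: "k > 0"
  obtains q where "segments k B (mverts H) (medges H) q"
proof -
  obtain \<phi> where v: "bij_betw \<phi> (mverts (Sub k H)) (verts B)"
    and e: "bij_betw (\<lambda>d. \<phi> ` ends (Sub k H) d) (medges (Sub k H)) (edges B)"
    and o: "\<forall>v \<in> mverts H. \<phi> (Orig v) = v" using S unfolding is_Sub_def by (elim exE conjE)
  define q where "q = (\<lambda>e i. \<phi> (sub_point k H e i))"
  have V: "mverts (Sub k H) = Orig ` mverts H \<union> {Inner e i |e i. e \<in> medges H \<and> 0 < i \<and> i < k}"
    by (simp add: Sub_def)
  have inj: "\<phi> x = \<phi> y \<longleftrightarrow> x = y" if "x \<in> mverts (Sub k H)" "y \<in> mverts (Sub k H)" for x y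
    using v that by (auto simp: bij_betw_def dest: inj_onD)
  have im: "\<phi> x \<in> verts B" if "x \<in> mverts (Sub k H)" for x
    using v that by (auto simp: bij_betw_def)
  have Winj: "\<phi> x \<notin> mverts H" if "x \<in> mverts (Sub k H)" "\<And>v. x \<noteq> Orig v" for x
  proof
    assume x: "\<phi> x \<in> mverts H"
    then have "\<phi> (Orig (\<phi> x)) = \<phi> x" using o by blast
    moreover have "Orig (\<phi> x) \<in> mverts (Sub k H)" using x V by blast
    ultimately show False using inj[of "Orig (\<phi> x)" x] that by metis
  qed
  have or: "fst (orient H e) \<in> mverts H \<and> snd (orient H e) \<in> mverts H" if "e \<in> medges H" for e
  proof -
    have sub: "ends H e \<subseteq> mverts H" and "card (ends H e) = 1 \<or> card (ends H e) = 2"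
      using H that by (auto simp: wf_multigraph_def)
    then obtain x y where "ends H e = {x, y}" by (auto simp: card_1_singleton_iff card_2_iff)
    then have "case (x, y) of (x, y) \<Rightarrow> ends H e = {x, y}" by simp
    then have "case orient H e of (x, y) \<Rightarrow> ends H e = {x, y}" unfolding orient_def by (rule someI)
    then show ?thesis using sub by (auto split: prod.splits)
  qed
  have inn: "Inner e i \<in> mverts (Sub k H)" if "e \<in> medges H" "0 < i" "i < k" for e i
    using that V by blast
  have qi: "q e i = \<phi> (Inner e i)" if "0 < i" "i < k" for e i using that by (simp add: q_def sub_point_def)
  have "segments k B (mverts H) (medges H) q"
    unfolding segments_def
  proof (intro conjI ballI allI impI)
    show "mverts H \<subseteq> verts B"
    proof
      fix v assume v: "v \<in> mverts H"
      then have "Orig v \<in> mverts (Sub k H)" using V by blast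
      then show "v \<in> verts B" using im[of "Orig v"] o v by simp
    qed
    show "q e 0 \<in> mverts H" "q e k \<in> mverts H" if "e \<in> medges H" for e
      using or[OF that] o k by (simp_all add: q_def sub_point_def)
    show "q e i \<in> verts B - mverts H" if "e \<in> medges H" "0 < i \<and> i < k" for e i
      using that qi[of i e] im[OF inn, of e i] Winj[OF inn, of e i] by simp
    have "e = e' \<and> i = j" if "e \<in> medges H" "e' \<in> medges H" "0 < i" "i < k" "0 < j" "j < k"
      "q e i = q e' j" for e e' i j
    proof -
      have "\<phi> (Inner e i) = \<phi> (Inner e' j)" using that(7) unfolding qi[OF that(3,4)] qi[OF that(5,6)] .
      then have "Inner e i = (Inner e' j :: ('a, nat) sub_vertex)"
        using inj[OF inn[OF that(1,3,4)] inn[OF that(2,5,6)]] by blast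
      then show ?thesis by simp
    qed
    then show "e = e'" "i = j" if "e \<in> medges H" "e' \<in> medges H"
       "0 < i \<and> i < k \<and> 0 < j \<and> j < k \<and> q e i = q e' j" for e e' i j
      using that by blast+
    show "\<exists>e\<in>medges H. \<exists>i. 0 < i \<and> i < k \<and> x = q e i" if x: "x \<in> verts B - mverts H" for x
    proof -
      have "x \<in> \<phi> ` mverts (Sub k H)" using v x by (simp add: bij_betw_def)
      then obtain y where y: "y \<in> mverts (Sub k H)" "x = \<phi> y" by blast
      moreover have "y \<notin> Orig ` mverts H" using x y(2) o by auto
      ultimately obtain e i where ei: "y = Inner e i" "e \<in> medges H" "0 < i" "i < k" using V by blast
      have "x = q e i" unfolding y(2) ei(1) qi[OF ei(3,4)] ..
      then show ?thesis using ei(2-4) by (intro bexI[of _ e] exI[of _ i]) simp_all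
    qed
    show "{q e i, q e (Suc i)} \<in> edges B" if "e \<in> medges H" "i < k" for e i
    proof -
      have "(e, i) \<in> medges (Sub k H)" using that by (simp add: Sub_def)
      then have "\<phi> ` ends (Sub k H) (e, i) \<in> edges B" using e by (auto simp: bij_betw_def)
      then show ?thesis by (simp add: Sub_def q_def)
    qed
    show "\<exists>e\<in>medges H. \<exists>i<k. d = {q e i, q e (Suc i)}" if "d \<in> edges B" for d
    proof -
      have "d \<in> (\<lambda>d. \<phi> ` ends (Sub k H) d) ` medges (Sub k H)" using e that by (simp add: bij_betw_def)
      then obtain p where p: "d = \<phi> ` ends (Sub k H) p" "p \<in> medges H \<times> {..<k}" by (auto simp: Sub_def)
      then obtain e i where "p = (e, i)" "e \<in> medges H" "i < k" by blast
      then show ?thesis using p(1)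
        by (intro bexI[of _ e] exI[of _ i]) (simp_all add: Sub_def q_def)
    qed
  qed
  then show thesis by (rule that)
qed

locale segment_system =
  fixes k :: nat and B :: "'a sgraph" and W :: "'a set" and E :: "nat set" and q :: "nat \<Rightarrow> nat \<Rightarrow> 'a"
  assumes k: "k \<ge> 3" and segs: "segments k B W E q" and wfB: "wf_sgraph B"
begin

lemma W_sub: "W \<subseteq> verts B"
  using segs by (simp add: segments_def)

lemma q_ends: "e \<in> E \<Longrightarrow> q e 0 \<in> W" "e \<in> E \<Longrightarrow> q e k \<in> W"
  using segs by (simp_all add: segments_def)

lemma q_inner: "e \<in> E \<Longrightarrow> 0 < i \<Longrightarrow> i < k \<Longrightarrow> q e i \<in> verts B \<and> q e i \<notin> W"
  using segs by (simp add: segments_def)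

lemma q_inj: "e \<in> E \<Longrightarrow> e' \<in> E \<Longrightarrow> 0 < i \<Longrightarrow> i < k \<Longrightarrow> 0 < j \<Longrightarrow> j < k \<Longrightarrow> q e i = q e' j \<Longrightarrow> e = e' \<and> i = j"
  using segs unfolding segments_def by (elim conjE) metis

lemma q_surj:
  assumes "v \<in> verts B" "v \<notin> W"
  obtains e i where "e \<in> E" "0 < i" "i < k" "v = q e i"
proof -
  have "\<forall>v\<in>verts B - W. \<exists>e\<in>E. \<exists>i. 0 < i \<and> i < k \<and> v = q e i" using segs by (simp add: segments_def)
  then show thesis using assms that by blast
qed

lemma edge_q:
  assumes "{x, y} \<in> edges B"
  obtains e i where "e \<in> E" "i < k" "{x, y} = {q e i, q e (Suc i)}"
proof -
  have "\<forall>d\<in>edges B. \<exists>e\<in>E. \<exists>i<k. d = {q e i, q e (Suc i)}" using segs by (simp add: segments_def)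
  then show thesis using assms that by blast
qed

lemma inner_neighbours:
  assumes e: "e \<in> E" "0 < i" "i < k" and y: "{q e i, y} \<in> edges B"
  shows "y = q e (i - 1) \<or> y = q e (Suc i)"
proof -
  obtain e' j where j: "e' \<in> E" "j < k" "{q e i, y} = {q e' j, q e' (Suc j)}" by (rule edge_q[OF y])
  have nW: "q e i \<notin> W" using q_inner e by blast
  from j(3) consider "q e i = q e' j" "y = q e' (Suc j)" | "q e i = q e' (Suc j)" "y = q e' j"
    by (auto simp: doubleton_eq_iff)
  then show ?thesis
  proof cases
    case 1
    then have "0 < j" using nW q_ends(1)[OF j(1)] by (cases j) auto
    then have "e = e' \<and> i = j" using q_inj[OF e(1) j(1) e(2,3) _ j(2)] 1 by blast
    then show ?thesis using 1 by simp
  next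
    case 2
    then have "Suc j \<noteq> k" using nW q_ends(2)[OF j(1)] by auto
    then have "e = e' \<and> i = Suc j" using q_inj[OF e(1) j(1) e(2,3), of "Suc j"] 2 j(2) by simp
    then show ?thesis using 2 by simp
  qed
qed

lemma W_neighbours:
  assumes "{w, y} \<in> edges B" "w \<in> W"
  obtains e where "e \<in> E" "w = q e 0" "y = q e 1" | e where "e \<in> E" "w = q e k" "y = q e (k - 1)"
proof -
  obtain e j where j: "e \<in> E" "j < k" "{w, y} = {q e j, q e (Suc j)}" by (rule edge_q[OF assms(1)])
  from j(3) consider "w = q e j" "y = q e (Suc j)" | "w = q e (Suc j)" "y = q e j"
    by (auto simp: doubleton_eq_iff)
  then show thesis
  proof cases
    case 1
    then have "j = 0" using q_inner[OF j(1), of j] j(2) assms(2) by (cases j) auto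
    then show thesis using 1 j that(1) by simp
  next
    case 2
    then have "Suc j = k" using q_inner[OF j(1), of "Suc j"] j(2) assms(2) by (cases "Suc j = k") auto
    then show thesis using 2 j that(2)[of e] by auto
  qed
qed

text \<open>Inner vertices have degree two, so a walk that starts in \<open>W\<close> and never
  turns back has to follow one segment, in one of its two directions.\<close>

lemma walk_segment:
  assumes f0: "f 0 \<in> W" and adj: "\<And>j. j < l \<Longrightarrow> {f j, f (Suc j)} \<in> edges B"
    and nb: "\<And>j. Suc j < l \<Longrightarrow> f (Suc (Suc j)) \<noteq> f j" and l: "1 \<le> l" "l \<le> k"
  shows "\<exists>e\<in>E. (\<forall>j\<le>l. f j = q e j) \<or> (\<forall>j\<le>l. f j = q e (k - j))"
  using l(1) adj nb l(2)
proof (induction l rule: dec_induct)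
  case base
  have "{f 0, f 1} \<in> edges B" using base(1)[of 0] by simp
  then show ?case using f0
  proof (cases rule: W_neighbours)
    case (1 e)
    then have "\<forall>j\<le>1. f j = q e j" by (auto simp: le_Suc_eq)
    then show ?thesis using 1(1) by blast
  next
    case (2 e)
    then have "\<forall>j\<le>1. f j = q e (k - j)" by (auto simp: le_Suc_eq)
    then show ?thesis using 2(1) by blast
  qed
next
  case (step l)
  have "\<exists>e\<in>E. (\<forall>j\<le>l. f j = q e j) \<or> (\<forall>j\<le>l. f j = q e (k - j))"
    using step.IH step.prems by simp
  then obtain e where e: "e \<in> E" and or: "(\<forall>j\<le>l. f j = q e j) \<or> (\<forall>j\<le>l. f j = q e (k - j))" by blast
  have l: "1 \<le> l" "l < k" using step by auto
  have ed: "{f l, f (Suc l)} \<in> edges B" using step.prems(1)[of l] by simp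
  have nb': "f (Suc l) \<noteq> f (l - 1)" using step.prems(2)[of "l - 1"] l by simp
  from or show ?case
  proof
    assume a: "\<forall>j\<le>l. f j = q e j"
    then have "f (Suc l) = q e (l - 1) \<or> f (Suc l) = q e (Suc l)"
      using inner_neighbours[OF e, of l "f (Suc l)"] l ed by simp
    then have "f (Suc l) = q e (Suc l)" using nb' a by simp
    then have "\<forall>j\<le>Suc l. f j = q e j" using a by (simp add: le_Suc_eq)
    then show ?thesis using e by blast
  next
    assume a: "\<forall>j\<le>l. f j = q e (k - j)"
    then have "f (Suc l) = q e (k - l - 1) \<or> f (Suc l) = q e (Suc (k - l))"
      using inner_neighbours[OF e, of "k - l" "f (Suc l)"] l ed by simp
    moreover have "Suc (k - l) = k - (l - 1)" "k - l - 1 = k - Suc l" using l by auto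
    ultimately have "f (Suc l) = q e (k - Suc l)" using nb' a by simp
    then have "\<forall>j\<le>Suc l. f j = q e (k - j)" using a by (simp add: le_Suc_eq)
    then show ?thesis using e by blast
  qed
qed

text \<open>On a cycle avoiding \<open>W\<close>, take a vertex whose position within its segment is
  greatest. Both of its neighbours on the cycle would have to be its predecessor on the
  segment.\<close>

lemma cycle_meets_W:
  assumes c: "icyc B m c" obtains a where "c a \<in> W"
proof (rule ccontr)
  assume "\<not> thesis"
  then have nW: "c i \<notin> W" for i using that by blast
  have "\<exists>e\<in>E. \<exists>o'. 0 < o' \<and> o' < k \<and> c i = q e o'" for i
    using q_surj[OF _ nW, of i] icyc_verts[OF wfB c] by (metis rangeI subsetD)
  then obtain ee oo where eo: "\<And>i. ee i \<in> E \<and> 0 < oo i \<and> oo i < k \<and> c i = q (ee i) (oo i)" by metis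
  obtain i where max: "\<And>j. oo j \<le> oo i"
    using ex_has_greatest_nat[of "\<lambda>_. True" 0 oo k] eo by (metis less_imp_le_nat)
  have nbr: "x = q (ee i) (oo i - 1)" if x: "{c i, x} \<in> edges B" "x = c j" for x j
  proof -
    have "x = q (ee i) (oo i - 1) \<or> x = q (ee i) (Suc (oo i))"
      using inner_neighbours[of "ee i" "oo i" x] eo[of i] x by simp
    moreover have "x \<noteq> q (ee i) (Suc (oo i))"
    proof
      assume a: "x = q (ee i) (Suc (oo i))"
      have "x \<notin> W" using x nW by simp
      then have "Suc (oo i) \<noteq> k" using a q_ends(2)[of "ee i"] eo[of i] by auto
      moreover have "q (ee i) (Suc (oo i)) = q (ee j) (oo j)" using a x(2) eo[of j] by metis
      ultimately have "ee i = ee j \<and> Suc (oo i) = oo j"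
        using eo[of i] eo[of j] by (intro q_inj) simp_all
      then show False using max[of j] by simp
    qed
    ultimately show ?thesis by blast
  qed
  have "c (i + 1) = q (ee i) (oo i - 1)" using nbr[OF icycD(3)[OF c] refl] .
  moreover have "{c i, c (i - 1)} \<in> edges B" using icycD(4)[OF c, of i] by (simp add: insert_commute)
  then have "c (i - 1) = q (ee i) (oo i - 1)" using nbr[OF _ refl] by blast
  ultimately show False using icyc_neighbours_ne(1)[OF c, of i] by simp
qed

lemma cycle_segment:
  assumes c: "icyc B m c" and a: "c a \<in> W"
  shows "\<exists>e\<in>E. (\<forall>j\<le>k. c (a + int j) = q e j) \<or> (\<forall>j\<le>k. c (a + int j) = q e (k - j))"
proof (rule walk_segment)
  show "{c (a + int j), c (a + int (Suc j))} \<in> edges B" for j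
    using icycD(3)[OF c, of "a + int j"] by (simp add: algebra_simps)
  show "c (a + int (Suc (Suc j))) \<noteq> c (a + int j)" for j
    using icyc_neighbours_ne(1)[OF c, of "a + int j + 1"] by (simp add: algebra_simps)
qed (use a k in auto)

text \<open>From a vertex of \<open>W\<close> the cycle runs through an entire segment and so
  returns to \<open>W\<close> after \<open>k\<close> steps and not earlier.\<close>

lemma cycle_W_iff:
  assumes c: "icyc B m c" and a: "c a \<in> W"
  shows "c j \<in> W \<longleftrightarrow> int k dvd j - a"
proof -
  have nxt: "c (b + int k) \<in> W" "\<And>j. 0 < j \<Longrightarrow> j < k \<Longrightarrow> c (b + int j) \<notin> W" if b: "c b \<in> W" for b
  proof -
    obtain e where e: "e \<in> E" "(\<forall>j\<le>k. c (b + int j) = q e j) \<or> (\<forall>j\<le>k. c (b + int j) = q e (k - j))"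
      using cycle_segment[OF c b] by blast
    show "c (b + int k) \<in> W" using e q_ends[OF e(1)] by auto
    fix j assume j: "0 < j" "j < k"
    show "c (b + int j) \<notin> W"
      using e(2) q_inner[OF e(1), of j] q_inner[OF e(1), of "k - j"] j by auto
  qed
  have prev: "c (b - int k) \<in> W" if b: "c b \<in> W" for b
  proof -
    \<comment> \<open>Going back \<open>k\<close> steps is the same as going forward
      \<open>k * (m - 1)\<close> steps, since the difference \<open>k * m\<close> is a multiple of
      the period.\<close>
    have "c (b + int k * (m - 1)) \<in> W"
    proof -
      have "c (b + int k * int n) \<in> W" for n
      proof (induction n)
        case (Suc n)
        have "b + int k * int (Suc n) = b + int k * int n + int k" by (simp add: algebra_simps)
        then have "b + int k * int (Suc n) = (b + int k * int n) + int k" by simp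
        then show ?case using nxt(1)[OF Suc] by (simp only:)
      qed (use b in simp)
      moreover have "m - 1 = int (nat (m - 1))" using icycD(1)[OF c] by simp
      ultimately show ?thesis by metis
    qed
    moreover have "m dvd b + int k * (m - 1) - (b - int k)"
      by (intro dvdI[of _ _ "int k"]) (simp add: algebra_simps)
    then have "c (b + int k * (m - 1)) = c (b - int k)" using icycD(2)[OF c] by blast
    ultimately show ?thesis by simp
  qed
  have per: "c (x + int k) \<in> W \<longleftrightarrow> c x \<in> W" for x
    using nxt(1)[of x] prev[of "x + int k"] by auto
  have cong: "c x \<in> W \<longleftrightarrow> c y \<in> W" if "int k dvd x - y" for x y
    using periodic_cong[of "\<lambda>x. c x \<in> W" "int k" x y] per that by simp
  show ?thesis
  proof
    assume "int k dvd j - a" then show "c j \<in> W" using cong[of j a] a by simp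
  next
    assume j: "c j \<in> W"
    define r where "r = (j - a) mod int k"
    have r: "0 \<le> r" "r < int k" using k by (auto simp: r_def)
    have "int k dvd j - a - r" unfolding r_def by (rule dvd_minus_mod)
    then have "c (a + r) \<in> W" using cong[of j "a + r"] j by (simp add: algebra_simps)
    then have "r = 0" using nxt(2)[OF a, of "nat r"] r by (cases "r = 0") (simp_all add: nat_less_iff)
    then show "int k dvd j - a" by (simp add: r_def dvd_eq_mod_eq_0)
  qed
qed

lemma cycle_length: assumes c: "icyc B m c" shows "int k dvd m"
proof -
  obtain a where a: "c a \<in> W" by (rule cycle_meets_W[OF c])
  then have "c (a + m) \<in> W" using icyc_periodic[OF c] by simp
  then show ?thesis using cycle_W_iff[OF c a, of "a + m"] by simp
qed

end

section \<open>Disjoint \<open>k\<close>-paths in a connected part of a subdivision\<close>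

lemma segment_path:
  assumes wf: "wf_sgraph G" and wfB: "wf_sgraph B" and sub: "edges B \<subseteq> edges G" 
    and d: "distinct xs" and s: "walk B xs" and len: "2 \<le> length xs"
  shows "gpath G xs"
proof -
  have sG: "walk G xs"
    by (rule successively_mono[OF s]) (use sub in auto)
  have "x \<in> verts G" if x: "x \<in> set xs" for x
  proof -
    obtain i where i: "i < length xs" "x = xs ! i" using x by (auto simp: in_set_conv_nth)
    show ?thesis
    proof (cases "Suc i < length xs")
      case True
      then have "{xs ! i, xs ! Suc i} \<in> edges G" using successively_nth[OF sG] by blast
      then show ?thesis using edge_verts[OF wf] i by blast
    next
      case False
      then obtain j where j: "i = Suc j" using i len by (cases i) auto
      then have "{xs ! j, xs ! Suc j} \<in> edges G" using successively_nth[OF sG] i by blast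
      then show ?thesis using edge_verts[OF wf] i j by blast
    qed
  qed
  moreover have "xs \<noteq> []" using len by auto
  ultimately show ?thesis using d sG by (auto simp: gpath_def)
qed

text \<open>The invariant for growing a packing. A segment used by \<open>M\<close> has both ends in \<open>A\<close>, so a segment from
  \<open>A\<close> to a new vertex of \<open>W\<close> is still unused.\<close>

definition packing_inv :: "nat \<Rightarrow> 'a sgraph \<Rightarrow> 'a set \<Rightarrow> 'a set \<Rightarrow> nat set \<Rightarrow> (nat \<Rightarrow> nat \<Rightarrow> 'a) \<Rightarrow>
    'a set \<Rightarrow> 'a set set \<Rightarrow> bool" where
  "packing_inv k G D W E q A M \<longleftrightarrow> A \<subseteq> W \<inter> D \<and> A \<noteq> {} \<and> finite M \<and> M \<subseteq> kpath_sets k G D \<and> pairwise disjnt M \<and>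
     card M = card A \<and> (\<forall>S\<in>M. S \<inter> W \<subseteq> A) \<and>
     (\<forall>S\<in>M. \<forall>e\<in>E. \<forall>i. 0 < i \<and> i < k \<and> q e i \<in> S \<longrightarrow> q e 0 \<in> A \<and> q e k \<in> A)"

text \<open>The cycle is cut in front of each of its vertices in \<open>W\<close>. Every piece has
  \<open>k\<close> vertices, only its first one in \<open>W\<close>, and the segment it follows has
  both ends on the cycle, as the invariant demands.\<close>

lemma packing_base:
  assumes wf: "wf_sgraph G" and seg: "segment_system k B W E q" and sub: "edges B \<subseteq> edges G"
    and c: "icyc B m c" and D: "range c \<subseteq> D"
  obtains M where "packing_inv k G D W E q (W \<inter> range c) M"
proof -
  interpret segment_system k B W E q by (rule seg)
  obtain a where a: "c a \<in> W" by (rule cycle_meets_W[OF c])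
  define d where "d = (\<lambda>i. c (i + a))"
  have d: "icyc B m d" unfolding d_def by (rule icyc_shift[OF c])
  have d0: "d 0 \<in> W" using a by (simp add: d_def)
  have rd: "range d = range c" unfolding d_def by (auto simp: image_iff) (metis diff_add_cancel)
  have m3: "3 \<le> m" using icycD(1)[OF c] .
  have "int k dvd m" by (rule cycle_length[OF c])
  then obtain n' where n': "m = int k * n'" by (elim dvdE)
  have "0 < int k * n'" using n' m3 by simp
  then have "0 < n'" using k by (simp add: zero_less_mult_iff)
  define n where "n = nat n'"
  have n: "m = int (n * k)" "0 < n" using n' \<open>0 < n'\<close> by (auto simp: n_def mult.commute)
  have Wd: "d j \<in> W \<longleftrightarrow> int k dvd j" for j using cycle_W_iff[OF d d0, of j] by simp
  define P where "P t = d ` {int (t * k)..<int (t * k) + int k}" for t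
  have inj: "i = j" if "d i = d j" "0 \<le> i" "i < m" "0 \<le> j" "j < m" for i j
    using inj_onD[OF icyc_inj[OF d, of 0], of i j] that by simp
  have rng: "0 \<le> i \<and> i < m" if "t < n" "i \<in> {int (t * k)..<int (t * k) + int k}" for i t
  proof -
    have "Suc t * k \<le> n * k" using that(1) by (intro mult_right_mono) auto
    then have "int (t * k) + int k \<le> m" unfolding n(1) of_nat_add[symmetric] by (simp only: of_nat_le_iff) simp
    then show ?thesis using that(2) of_nat_0_le_iff[of "t * k", where ?'a = int]
      unfolding atLeastLessThan_iff by linarith
  qed
  have Pdisj: "t = t'" if t: "t < n" "t' < n" "x \<in> P t" "x \<in> P t'" for t t' x
  proof -
    obtain i where i: "x = d i" "i \<in> {int (t * k)..<int (t * k) + int k}" using t(3) unfolding P_def by blast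
    obtain j where j: "x = d j" "j \<in> {int (t' * k)..<int (t' * k) + int k}" using t(4) unfolding P_def by blast
    have ij: "i = j" using inj[of i j] i j rng[OF t(1) i(2)] rng[OF t(2) j(2)] by simp
    have dv: "i div int k = int s" if i': "i \<in> {int (s * k)..<int (s * k) + int k}" for s
    proof -
      have "i = int k * int s + (i - int (s * k))" by simp
      moreover have "0 \<le> i - int (s * k)" "i - int (s * k) < int k" using i' by auto
      ultimately show ?thesis using k by (intro int_div_pos_eq[of i "int k" "int s"]) simp_all
    qed
    show ?thesis using dv[OF i(2)] dv[OF j(2)[folded ij]] by simp
  qed
  have dP: "d (int (t * k)) \<in> P t" for t using k by (auto simp: P_def)
  have injP: "inj_on P {..<n}"
  proof (rule inj_onI)
    fix t t' assume "t \<in> {..<n}" "t' \<in> {..<n}" "P t = P t'"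
    then show "t = t'" using Pdisj[of t t' "d (int (t * k))"] dP[of t] by simp
  qed
  have Wc: "W \<inter> range c = (\<lambda>t. d (int (t * k))) ` {..<n}"
  proof (intro equalityI subsetI)
    fix x assume "x \<in> W \<inter> range c"
    then obtain j where j: "0 \<le> j" "j < 0 + m" "x = d j" "x \<in> W"
      using icyc_obtain[OF d, of x 0] rd by blast
    then have "int k dvd j" using Wd by simp
    then obtain t where t: "j = int k * t" by (elim dvdE)
    have "0 \<le> t" using t j(1) k by (simp add: zero_le_mult_iff)
    moreover have "t < int n" using t j(2) k n(1) by (simp add: mult.commute)
    ultimately show "x \<in> (\<lambda>t. d (int (t * k))) ` {..<n}" using t j(3)
      by (intro image_eqI[of _ _ "nat t"]) (auto simp: mult.commute)
  next
    fix x assume "x \<in> (\<lambda>t. d (int (t * k))) ` {..<n}"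
    then show "x \<in> W \<inter> range c" using Wd rd by auto
  qed
  have "inj_on (\<lambda>t. d (int (t * k))) {..<n}"
  proof (rule inj_onI)
    fix t t' assume "t \<in> {..<n}" "t' \<in> {..<n}" "d (int (t * k)) = d (int (t' * k))"
    then show "t = t'" using Pdisj[of t t' "d (int (t * k))"] dP[of t] dP[of t'] by simp
  qed
  then have cW: "card (W \<inter> range c) = n" by (simp add: Wc card_image)
  have dG: "icyc G m d" by (rule icyc_mono[OF d sub])
  have km: "int k \<le> m" unfolding n(1) of_nat_le_iff using n(2) by simp
  have Pkp: "P t \<in> kpath_sets k G D" for t
    using icyc_window_kpath[OF wf dG _ km] k D rd kpath_sets_mono[of "range d" D k G] unfolding P_def by auto
  have PS: "q e 0 \<in> W \<inter> range c \<and> q e k \<in> W \<inter> range c"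
    if t: "t < n" and e: "e \<in> E" "0 < i" "i < k" "q e i \<in> P t" for t e i
  proof -
    obtain j where "q e i = d j" "j \<in> {int (t * k)..<int (t * k) + int k}" using e(4) unfolding P_def by blast
    then have j: "q e i = d j" "int (t * k) \<le> j" "j < int (t * k) + int k" by simp_all
    define s where "s = nat (j - int (t * k))"
    have s: "j = int (t * k) + int s" "s < k" using j by (auto simp: s_def)
    have ds: "d (int (t * k)) \<in> W" using Wd by simp
    obtain e' where e': "e' \<in> E"
      "(\<forall>j\<le>k. d (int (t * k) + int j) = q e' j) \<or> (\<forall>j\<le>k. d (int (t * k) + int j) = q e' (k - j))"
      using cycle_segment[OF d ds] by blast
    have "0 < s" using q_inner[OF e(1-3)] ds j(1) s by (cases s) auto
    have "q e i = q e' s \<or> q e i = q e' (k - s)" using e'(2) s j(1) by auto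
    then have "e = e'" using q_inj[OF e(1) e'(1) e(2,3), of s] q_inj[OF e(1) e'(1) e(2,3), of "k - s"]
      \<open>0 < s\<close> s(2) by auto
    moreover have "d (int (t * k) + int 0) \<in> range c" "d (int (t * k) + int k) \<in> range c" using rd by blast+
    ultimately show ?thesis using e'(2) q_ends[OF e(1)] by (metis IntI diff_self_eq_0 le0 order_refl diff_zero)
  qed
  have "packing_inv k G D W E q (W \<inter> range c) (P ` {..<n})"
    unfolding packing_inv_def
  proof (intro conjI ballI allI impI)
    show "W \<inter> range c \<subseteq> W \<inter> D" using D by blast
    show "W \<inter> range c \<noteq> {}" using a by blast
    show "P ` {..<n} \<subseteq> kpath_sets k G D" using Pkp by blast
    show "pairwise disjnt (P ` {..<n})"
    proof (rule pairwiseI)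
      fix S S' assume "S \<in> P ` {..<n}" "S' \<in> P ` {..<n}" "S \<noteq> S'"
      then obtain t t' where "t < n" "t' < n" "S = P t" "S' = P t'" by blast
      then show "disjnt S S'" using Pdisj[of t t'] \<open>S \<noteq> S'\<close> unfolding disjnt_def by blast
    qed
    show "card (P ` {..<n}) = card (W \<inter> range c)" using injP cW by (simp add: card_image)
    show "S \<inter> W \<subseteq> W \<inter> range c" if "S \<in> P ` {..<n}" for S
      using that rd by (auto simp: P_def)
    show "q e 0 \<in> W \<inter> range c" "q e k \<in> W \<inter> range c"
      if "S \<in> P ` {..<n}" "e \<in> E" "0 < i \<and> i < k \<and> q e i \<in> S" for S e i
      using that PS[of _ e i] by blast+
  qed simp
  then show thesis by (rule that)
qed

text \<open>A path from \<open>A\<close> to a new vertex \<open>z\<close> of \<open>W\<close>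
  without vertices of \<open>W\<close> in between is exactly one segment. Without its first vertex
  \<open>y\<close>, which may already be in use, it has \<open>k\<close> vertices.\<close>

lemma packing_extend:
  assumes wf: "wf_sgraph G" and seg: "segment_system k B W E q" and sub: "edges B \<subseteq> edges G"
    and inv: "packing_inv k G D W E q A M"
    and xs: "distinct (y # vs @ [z])" "walk B (y # vs @ [z])"
      "set vs \<inter> W = {}" "y \<in> A" "z \<in> W" "z \<notin> A" "set (vs @ [z]) \<subseteq> D"
    and finA: "finite A"
  shows "packing_inv k G D W E q (insert z A) (insert (set (vs @ [z])) M)"
proof -
  interpret segment_system k B W E q by (rule seg)
  note I = inv[unfolded packing_inv_def]
  have AW: "A \<subseteq> W \<inter> D" and A0: "A \<noteq> {}" and fM: "finite M" and Mk: "M \<subseteq> kpath_sets k G D" and Md: "pairwise disjnt M"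
    and cM: "card M = card A" and MW: "\<And>S. S \<in> M \<Longrightarrow> S \<inter> W \<subseteq> A"
    and Mq: "\<And>S e i. S \<in> M \<Longrightarrow> e \<in> E \<Longrightarrow> 0 < i \<Longrightarrow> i < k \<Longrightarrow> q e i \<in> S \<Longrightarrow> q e 0 \<in> A \<and> q e k \<in> A"
    using I by (simp_all, blast)
  let ?L = "y # vs @ [z]"
  define f where "f j = ?L ! j" for j
  have f0: "f 0 \<in> W" using xs(4) AW by (auto simp: f_def)
  have flen: "f (Suc (length vs)) = z" by (simp add: f_def nth_append)
  have fin: "f j \<in> set vs" if "0 < j" "j \<le> length vs" for j
    using that by (cases j) (auto simp: f_def nth_append)
  have adj: "{f j, f (Suc j)} \<in> edges B" if "j < Suc (length vs)" for j
    using successively_nth[OF xs(2), of j] that by (simp add: f_def)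
  have nb: "f (Suc (Suc j)) \<noteq> f j" if "Suc j < Suc (length vs)" for j
    using nth_eq_iff_index_eq[OF xs(1), of "Suc (Suc j)" j] that by (simp add: f_def)
  \<comment> \<open>A shorter path would end at an inner vertex of a segment; a longer one would
    meet \<open>W\<close> after \<open>k\<close> steps.\<close>
  have lk: "\<not> Suc (length vs) < k"
  proof
    assume lt: "Suc (length vs) < k"
    obtain e where "e \<in> E" "(\<forall>j\<le>Suc (length vs). f j = q e j) \<or> (\<forall>j\<le>Suc (length vs). f j = q e (k - j))"
      using walk_segment[of f "Suc (length vs)", OF f0 adj nb] lt by auto
    then have "z = q e (Suc (length vs)) \<or> z = q e (k - Suc (length vs))" using flen by auto
    then show False using q_inner[OF \<open>e \<in> E\<close>, of "Suc (length vs)"] q_inner[OF \<open>e \<in> E\<close>, of "k - Suc (length vs)"] lt xs(5) by auto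
  qed
  obtain e where e: "e \<in> E" and fe: "(\<forall>j\<le>k. f j = q e j) \<or> (\<forall>j\<le>k. f j = q e (k - j))"
    using walk_segment[of f k, OF f0 adj nb] lk k by auto
  have "f k \<in> W" using fe q_ends[OF e] by auto
  then have lenk: "Suc (length vs) = k" using lk fin[of k] xs(3) k by (cases "k \<le> length vs") auto
  have yz: "(y = q e 0 \<and> z = q e k) \<or> (y = q e k \<and> z = q e 0)"
    using fe flen lenk by (auto simp: f_def)
  have vs_inner: "\<exists>i. 0 < i \<and> i < k \<and> v = q e i" if v: "v \<in> set vs" for v
  proof -
    obtain i where i: "i < length vs" "v = vs ! i" using v by (auto simp: in_set_conv_nth)
    then have "v = f (Suc i)" by (simp add: f_def nth_append)
    then have "v = q e (Suc i) \<or> v = q e (k - Suc i)" using fe i lenk by auto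
    moreover have "0 < Suc i" "Suc i < k" "0 < k - Suc i" "k - Suc i < k" using i lenk by auto
    ultimately show ?thesis by blast
  qed
  let ?S = "set (vs @ [z])"
  have disj: "disjnt ?S S" if S: "S \<in> M" for S
  proof -
    have "z \<notin> S" using MW[OF S] xs(5,6) by blast
    moreover have "v \<notin> S" if v: "v \<in> set vs" for v
    proof
      assume "v \<in> S"
      obtain i where "0 < i" "i < k" "v = q e i" using vs_inner[OF v] by blast
      then have "q e 0 \<in> A \<and> q e k \<in> A" using Mq[OF S e] \<open>v \<in> S\<close> by blast
      then show False using yz xs(6) by blast
    qed
    ultimately show ?thesis by (auto simp: disjnt_def)
  qed
  have gp: "gpath G (vs @ [z])"
  proof (rule segment_path[OF wf wfB sub])
    show "distinct (vs @ [z])" using xs(1) by simp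
    show "walk B (vs @ [z])" using xs(2) by (simp add: successively_Cons)
    show "2 \<le> length (vs @ [z])" using lenk k by simp
  qed
  then have Skp: "?S \<in> kpath_sets k G D" unfolding kpath_sets_def using lenk xs(7)
    by (intro CollectI exI[of _ "vs @ [z]"]) simp
  have "?S \<notin> M" using disj[of ?S] by (auto simp: disjnt_def)
  show ?thesis unfolding packing_inv_def
  proof (intro conjI ballI allI impI)
    show "insert z A \<subseteq> W \<inter> D" using AW xs(5,7) by auto
    show "insert ?S M \<subseteq> kpath_sets k G D" using Mk Skp by blast
    show "pairwise disjnt (insert ?S M)" using Md disj disjnt_sym by (auto simp: pairwise_insert)
    show "card (insert ?S M) = card (insert z A)" using fM finA \<open>?S \<notin> M\<close> xs(6) cM by simp
    show "S \<inter> W \<subseteq> insert z A" if "S \<in> insert ?S M" for S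
      using that MW[of S] xs(3) by auto
    fix S e' i assume S: "S \<in> insert ?S M" and e': "e' \<in> E" and i: "0 < i \<and> i < k \<and> q e' i \<in> S"
    have "q e' 0 \<in> insert z A \<and> q e' k \<in> insert z A"
    proof (cases "S \<in> M")
      case True then show ?thesis using Mq[OF True e'] i by blast
    next
      case False
      then have "q e' i \<in> ?S" using S i by blast
      moreover have "q e' i \<noteq> z" using q_inner[OF e', of i] i xs(5) by auto
      ultimately have "q e' i \<in> set vs" by auto
      then obtain j where "0 < j" "j < k" "q e' i = q e j" using vs_inner by blast
      then have "e' = e" using q_inj[OF e' e, of i j] i by blast
      then show ?thesis using yz xs(4) by blast
    qed
    then show "q e' 0 \<in> insert z A" "q e' k \<in> insert z A" by blast+
  qed (use fM in simp_all)
qed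

lemma subdivision_step:
  assumes wf: "wf_sgraph G" and B: "B \<in> blocks G" and seg: "segment_system k B W E q"
    and comps: "\<And>K. K \<in> components_of (delete_verts G W) \<Longrightarrow>
      verts K \<inter> (verts B - W) \<noteq> {} \<Longrightarrow> k_paths k K = {}"
    and X: "X \<subseteq> verts G" and c: "icyc B m c" and cX: "range c \<subseteq> X"
  obtains D W' M where "W' \<subseteq> D" "D \<subseteq> X" "D \<noteq> {}" "M \<subseteq> kpath_sets k G D" "pairwise disjnt M"
    "card M = card W'" "\<forall>S\<in>kpath_sets k G X. S \<inter> W' = {} \<longrightarrow> S \<inter> D = {}"
proof -
  interpret segment_system k B W E q by (rule seg)
  note b = blocksD[OF B]
  have finB: "finite (verts B)" using b(2) by (simp add: wf_sgraph_def)
  have finW: "finite W" using W_sub finB finite_subset by blast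
  define Y where "Y = X \<inter> verts B"
  define D where "D = {v. reach G Y (c 0) v}"
  have cB: "range c \<subseteq> verts B" by (rule icyc_verts[OF b(2) c])
  have cG: "icyc G m c" by (rule icyc_mono[OF c b(5)])
  have c0: "c 0 \<in> Y" using cX cB by (auto simp: Y_def)
  have DY: "D \<subseteq> Y" unfolding D_def using reach_in[OF _ c0] by blast
  have cD: "range c \<subseteq> D"
  proof
    fix x assume "x \<in> range c"
    then obtain j where j: "0 \<le> j" "x = c j" using icyc_obtain[OF c, of x 0] by blast
    have "reach G Y (c 0) (c j)" by (rule reach_icyc[OF cG j(1)]) (use cX cB in \<open>auto simp: Y_def\<close>)
    then show "x \<in> D" by (simp add: D_def j)
  qed
  obtain M0 where M0: "packing_inv k G D W E q (W \<inter> range c) M0"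
    by (rule packing_base[OF wf seg b(5) c cD])
  define P where "P p \<longleftrightarrow> packing_inv k G D W E q (fst p) (snd p)" for p
  have P0: "P (W \<inter> range c, M0)" using M0 by (simp add: P_def)
  have Pb: "\<forall>p. P p \<longrightarrow> card (fst p) < card W + 1"
    using card_mono[OF finW] by (auto simp: P_def packing_inv_def le_imp_less_Suc)
  \<comment> \<open>An instance of the invariant with \<open>A\<close> as large as possible. It
    remains to see that \<open>A\<close> then exhausts \<open>W \<inter> D\<close>.\<close>
  obtain p where p: "P p" "\<forall>p'. P p' \<longrightarrow> card (fst p') \<le> card (fst p)"
    using ex_has_greatest_nat[of P _ "\<lambda>p. card (fst p)", OF P0 Pb] by blast
  define A M where "A = fst p" and "M = snd p"
  have inv: "packing_inv k G D W E q A M" using p(1) by (simp add: P_def A_def M_def)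
  have max: "card A' \<le> card A" if "packing_inv k G D W E q A' M'" for A' M'
    using p(2)[rule_format, of "(A', M')"] that by (simp add: P_def A_def)
  have AW: "A \<subseteq> W \<inter> D" "A \<noteq> {}" "M \<subseteq> kpath_sets k G D" "pairwise disjnt M" "card M = card A"
    using inv by (simp_all add: packing_inv_def)
  have finA: "finite A" using AW(1) finW finite_subset by blast
  have "A = W \<inter> D"
  proof (rule ccontr)
    assume "A \<noteq> W \<inter> D"
    then obtain w where w: "w \<in> W" "w \<in> D" "w \<notin> A" using AW(1) by blast
    obtain a where a: "a \<in> A" using AW(2) by blast
    have "a \<in> D" using a AW(1) by blast
    then have "reach G Y (c 0) a" "reach G Y (c 0) w" using w by (simp_all add: D_def)
    then have raw: "reach G Y a w" using reach_sym reach_trans by fast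
    have "a \<in> Y" "w \<in> W - A" using \<open>a \<in> D\<close> DY w by blast+
    \<comment> \<open>The path stops at its first vertex in \<open>W - A\<close>; what follows its
      last vertex in \<open>A\<close> then meets \<open>W\<close> only at \<open>z\<close>.\<close>
    obtain us z where us: "z \<in> W - A" "z \<in> Y" "distinct (us @ [z])" "set us \<subseteq> Y - (W - A)"
      "walk G (us @ [z])" "hd (us @ [z]) = a"
      by (rule reach_first_hit[OF raw \<open>a \<in> Y\<close> \<open>w \<in> W - A\<close>])
    have "us \<noteq> []" using us(1,6) a by (cases us) auto
    then have "a \<in> set us" using us(6) by (cases us) auto
    then have "\<exists>x\<in>set us. x \<in> A" using a by blast
    then obtain us1 y vs where sp: "us = us1 @ y # vs" "y \<in> A" "\<forall>v\<in>set vs. v \<notin> A"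
      by (rule split_list_last_propE)
    have inY: "set (y # vs @ [z]) \<subseteq> Y" using sp us by auto
    have sG: "walk G (y # vs @ [z])"
      using us(5) unfolding sp by (simp add: successively_append_iff)
    have sB: "walk B (y # vs @ [z])"
    proof (rule successively_mono[OF sG])
      show "{u, v} \<in> edges B" if "u \<in> set (y # vs @ [z])" "v \<in> set (y # vs @ [z])" "{u, v} \<in> edges G" for u v
        using that inY block_edge[OF wf B, of u v] unfolding Y_def by blast
    qed
    have "x \<in> D" if "x \<in> set (vs @ [z])" for x
    proof -
      have "reach G Y y x" by (rule reach_successively[OF sG inY]) (use that in auto)
      moreover have "reach G Y (c 0) y" using sp(2) AW(1) by (auto simp: D_def)
      ultimately show ?thesis unfolding D_def using reach_trans by fast
    qed
    then have "packing_inv k G D W E q (insert z A) (insert (set (vs @ [z])) M)"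
      using sp us by (intro packing_extend[OF wf seg b(5) inv _ sB _ sp(2) _ _ _ finA]) auto
    then have "card (insert z A) \<le> card A" by (rule max)
    then show False using us(1) finA by simp
  qed
  have sep: "\<forall>S\<in>kpath_sets k G X. S \<inter> A = {} \<longrightarrow> S \<inter> D = {}"
  proof (intro ballI impI, rule ccontr)
    fix S assume S: "S \<in> kpath_sets k G X" and SA: "S \<inter> A = {}" and "S \<inter> D \<noteq> {}"
    then obtain u where u: "u \<in> S" "u \<in> D" by blast
    have SG: "S \<subseteq> X" "S \<subseteq> verts G" using kpath_setsD[OF S] X by auto
    have uB: "u \<in> verts B" using u DY by (auto simp: Y_def)
    show False
    proof (cases "S \<inter> W = {}")
      case True
      define F where "F = induced G (verts G - W)"
      have F: "delete_verts G W = F" by (simp add: F_def delete_verts_eq[OF wf])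
      have wfF: "wf_sgraph F" unfolding F_def by (intro wf_induced[OF wf]) auto
      define K where "K = component_at F u"
      have uF: "u \<in> verts F" using u SG True by (auto simp: F_def)
      have K: "K \<in> components_of (delete_verts G W)" unfolding F K_def by (rule comp_in_components[OF wfF uF])
      have vK: "verts K = {v. reach G (verts G - W) u v}"
        by (simp add: K_def component_at_def F_def reach_induced)
      have "u \<in> verts K" by (simp add: vK)
      then have none: "k_paths k K = {}" using comps[OF K] uB u True by blast
      obtain xs where xs: "gpath G xs" "length xs = k" "S = set xs" by (rule kpath_setsE[OF S])
      have SW: "S \<subseteq> verts G - W" using SG True by blast
      have SK: "S \<subseteq> verts K" unfolding vK using kpath_sets_reach[OF S u(1) _ SW] by blast
      have "K = induced F (verts K)" by (simp add: K_def component_at_def)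
      then have "gpath K xs \<longleftrightarrow> gpath (induced F (verts K)) xs" by simp
      moreover have "gpath F xs" unfolding F_def gpath_induced using xs SW by (simp add: gpath_def)
      ultimately have "gpath K xs" using SK xs unfolding gpath_induced by (simp add: gpath_def)
      then have "\<lparr>verts = set xs, edges = path_edges xs\<rparr> \<in> k_paths k K"
        unfolding k_paths_iff using xs(2) by blast
      then show False using none by blast
    next
      case False
      then obtain w where w: "w \<in> S" "w \<in> W" by blast
      \<comment> \<open>The \<open>k\<close>-path may leave the block on its way from
        \<open>u\<close> to \<open>w\<close>. With the excursions cut out, it connects
        \<open>u\<close> to \<open>w\<close> within \<open>X \<inter> verts B\<close>, so
        \<open>w\<close> belongs to \<open>D\<close>.\<close>
      have "reach G (S \<inter> verts B) u w"
        using block_reach[OF wf B SG(2) kpath_sets_reach[OF S u(1) w(1) order_refl] uB] w W_sub by blast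
      then have "reach G Y u w" by (rule reach_mono) (use SG in \<open>auto simp: Y_def\<close>)
      moreover have "reach G Y (c 0) u" using u by (simp add: D_def)
      ultimately have "w \<in> D" unfolding D_def using reach_trans by fast
      then show False using \<open>A = W \<inter> D\<close> w SA by blast
    qed
  qed
  have "D \<subseteq> X" using DY by (auto simp: Y_def)
  moreover have "D \<noteq> {}" using cD by blast
  moreover have "A \<subseteq> D" using AW(1) by blast
  ultimately show thesis using that[of A D M] AW sep by blast
qed

theorem subdivision_class_subset:
  fixes G :: "'a sgraph"
  assumes k: "k \<ge> 3" and G: "G \<in> \<H>' k" shows "G \<in> \<G>' k"
proof -
  have wf: "wf_sgraph G" using G by (simp add: \<H>'_def)
  have seg: "\<exists>W E q. segment_system k B W E q \<and> (\<forall>K \<in> components_of (delete_verts G W).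
      verts K \<inter> (verts B - W) \<noteq> {} \<longrightarrow> k_paths k K = {})"
    if B: "B \<in> blocks G" "\<not> trivial_block B" for B
  proof -
    obtain H :: "('a, nat) multigraph" where H: "wf_multigraph H" "is_Sub k H B"
      "\<forall>K \<in> components_of (delete_verts G (mverts H)).
            verts K \<inter> (verts B - mverts H) \<noteq> {} \<longrightarrow> is_tree K \<and> k_paths k K = {}"
      using G B unfolding \<H>'_def by blast
    obtain q where q: "segments k B (mverts H) (medges H) q"
      using is_Sub_segments[OF H(1,2)] k by auto
    have "segment_system k B (mverts H) (medges H) q"
      using k q blocksD(2)[OF B(1)] by (simp add: segment_system_def)
    then show ?thesis using H(3) by blast
  qed
  have konig: "konig k G X" if "X \<subseteq> verts G" for X
    using that
  proof (induction "card X" arbitrary: X rule: less_induct)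
    case less
    have finX: "finite X" using less(2) wf finite_subset by (auto simp: wf_sgraph_def)
    have smaller: "konig k G (X - D)" if "D \<subseteq> X" "D \<noteq> {}" for D
    proof (rule less(1))
      show "card (X - D) < card X" using that finX by (intro psubset_card_mono) auto
    qed (use less(2) in blast)
    show ?case
    proof (cases "\<exists>m c. icyc G m c \<and> range c \<subseteq> X")
      case True
      then obtain m c where c: "icyc G m c" "range c \<subseteq> X" by blast
      obtain B where B: "B \<in> blocks G" "icyc B m c" "\<not> trivial_block B" by (rule cycle_in_block[OF wf c(1)])
      obtain W E q where s: "segment_system k B W E q" "\<forall>K \<in> components_of (delete_verts G W).
        verts K \<inter> (verts B - W) \<noteq> {} \<longrightarrow> k_paths k K = {}" using seg[OF B(1,3)] by blast
      obtain D W' M where D: "W' \<subseteq> D" "D \<subseteq> X" "D \<noteq> {}" "M \<subseteq> kpath_sets k G D" "pairwise disjnt M"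
        "card M = card W'" "\<forall>S\<in>kpath_sets k G X. S \<inter> W' = {} \<longrightarrow> S \<inter> D = {}"
        by (rule subdivision_step[OF wf B(1) s(1) s(2)[rule_format] less(2) B(2) c(2)])
      show ?thesis by (rule konig_reduce[OF finX _ D(1,2,4,5,6) D(7)[rule_format] smaller[OF D(2,3)]]) (use k in auto)
    next
      case False
      show ?thesis
      proof (cases "kpath_sets k G X = {}")
        case True then show ?thesis by (rule konig_empty)
      next
        case ne: False
        obtain w D where D: "w \<in> D" "D \<subseteq> X" "kpath_sets k G D \<noteq> {}"
          "\<forall>S\<in>kpath_sets k G X. w \<notin> S \<longrightarrow> S \<inter> D = {}"
          using forest_step[OF wf _ less(2) _ ne] False k by (metis less_le_trans zero_less_numeral)
        obtain S where S: "S \<in> kpath_sets k G D" using D(3) by blast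
        show ?thesis
        proof (rule konig_reduce[OF finX _ _ D(2)])
          show "{w} \<subseteq> D" using D(1) by simp
          show "{S} \<subseteq> kpath_sets k G D" using S by simp
          show "konig k G (X - D)" using smaller[OF D(2)] D(1) by blast
          show "S' \<inter> D = {}" if "S' \<in> kpath_sets k G X" "S' \<inter> {w} = {}" for S' using D(4) that by blast
        qed (use k in simp_all)
      qed
    qed
  qed
  have nocyc: "\<not> order C < k" if C: "is_cycle C" "subgraph C G" for C
  proof -
    obtain c where c: "icyc G (int (order C)) c" by (rule is_cycle_imp_icyc[OF C])
    obtain B where B: "B \<in> blocks G" "icyc B (int (order C)) c" "\<not> trivial_block B"
      by (rule cycle_in_block[OF wf c])
    obtain W E q where s: "segment_system k B W E q" using seg[OF B(1,3)] by blast
    have "int k dvd int (order C)" by (rule segment_system.cycle_length[OF s B(2)])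
    moreover have "0 < int (order C)" using icycD(1)[OF c] by simp
    ultimately have "int k \<le> int (order C)" by (rule zdvd_imp_le)
    then show ?thesis by simp
  qed
  have k0: "k > 0" using k by simp
  have "\<forall>F. induced_subgraph F G \<longrightarrow> nu k F = tau k F"
    unfolding konig_all_iff[OF k0 wf] using konig by blast
  then show ?thesis unfolding \<G>'_def using wf nocyc by blast
qed

section \<open>Attached paths and branch vertices of a block\<close>

definition hang :: "'a sgraph \<Rightarrow> 'a sgraph \<Rightarrow> 'a \<Rightarrow> nat \<Rightarrow> bool" where
  "hang G B x r \<longleftrightarrow> (\<exists>ys. length ys = r \<and> gpath G (x # ys) \<and> set ys \<inter> verts B = {})"

definition branching :: "'a sgraph \<Rightarrow> 'a \<Rightarrow> bool" where
  "branching B v \<longleftrightarrow> (\<exists>x y z. x \<noteq> y \<and> y \<noteq> z \<and> x \<noteq> z \<and>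
     {v, x} \<in> edges B \<and> {v, y} \<in> edges B \<and> {v, z} \<in> edges B)"

text \<open>The last conjunct says that a path attached to the cycle at a vertex outside \<open>W\<close> is too short to
  reach \<open>W\<close> if it is laid along the cycle.\<close>

definition class_cycle :: "nat \<Rightarrow> 'a sgraph \<Rightarrow> 'a sgraph \<Rightarrow> 'a set \<Rightarrow> (int \<Rightarrow> 'a) \<Rightarrow> int \<Rightarrow> bool" where
  "class_cycle k G B W c b \<longleftrightarrow> (\<exists>m. icyc B m c \<and> int k dvd m) \<and> (\<forall>i. c i \<in> W \<longleftrightarrow> int k dvd i - b) \<and>
     (\<forall>a r d. hang G B (c a) r \<and> 1 \<le> d \<and> d \<le> int r \<and> 2 * d < int k \<longrightarrow>
        \<not> int k dvd a + d - b \<and> \<not> int k dvd a - d - b)"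

text \<open>The interface between the two halves of the block analysis: from these conditions the
  subdivision and the properties of the components of \<open>G - W\<close> are derived. Different
  edges may use different cycles, but all of these cycles agree on \<open>W\<close>.\<close>

definition good :: "nat \<Rightarrow> 'a sgraph \<Rightarrow> 'a sgraph \<Rightarrow> 'a set \<Rightarrow> bool" where
  "good k G B W \<longleftrightarrow> W \<subseteq> verts B \<and> (\<forall>v\<in>verts B - W. \<not> branching B v) \<and>
     (\<forall>x y. {x, y} \<in> edges B \<longrightarrow> (\<exists>c b l. class_cycle k G B W c b \<and> {x, y} = {c l, c (l + 1)}))"

lemma class_cycle_cong:
  assumes "class_cycle k G B W c b" "int k dvd b - b'"
  shows "class_cycle k G B W c b'"
proof -
  have eq: "int k dvd x - b' \<longleftrightarrow> int k dvd x - b" for x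
  proof -
    have "x - b' = (x - b) + (b - b')" by simp
    then show ?thesis using dvd_add_left_iff[OF assms(2), of "x - b"] by simp
  qed
  show ?thesis using assms(1) unfolding class_cycle_def eq .
qed

section \<open>Pendant paths and ears of a cycle\<close>

lemma gpath_appendD: "gpath G (xs @ ys) \<Longrightarrow> xs \<noteq> [] \<Longrightarrow> gpath G xs"
  by (simp add: gpath_def successively_append_iff)

lemma gpath_take: "gpath G (x # us) \<Longrightarrow> gpath G (x # take l us)"
  by (rule gpath_appendD[of G "x # take l us" "drop l us"]) simp_all

locale konig_graph =
  fixes k :: nat and G :: "'a sgraph"
  assumes k: "k \<ge> 3" "odd k" and wf: "wf_sgraph G"
    and konig: "\<And>X. X \<subseteq> verts G \<Longrightarrow> konig k G X" and cyc: "\<And>m c. icyc G m c \<Longrightarrow> int k dvd m"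
begin

lemma k2: "k = 2 * (k div 2) + 1" using k(2) by simp

lemma k_le_cycle: "icyc G m c \<Longrightarrow> int k \<le> m"
  using cyc[of m c] icycD(1)[of G m c] by (intro zdvd_imp_le) auto

lemma pendants_class:
  assumes c: "icyc G m c" and A: "finite A"
    and ys: "\<And>a. a \<in> A \<Longrightarrow> gpath G (c a # ys a)" "\<And>a. a \<in> A \<Longrightarrow> set (ys a) \<inter> range c = {}"
    and disj: "\<And>a b. a \<in> A \<Longrightarrow> b \<in> A \<Longrightarrow> a \<noteq> b \<Longrightarrow> set (ys a) \<inter> set (ys b) = {}"
    and len: "(\<Sum>a\<in>A. length (ys a)) < k"
  obtains i where "\<forall>a\<in>A. \<forall>d. 1 \<le> d \<and> d \<le> int (length (ys a)) \<longrightarrow>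
    \<not> int k dvd a + d - i \<and> \<not> int k dvd a - d - i"
proof -
  obtain n' where n': "m = int k * n'" using cyc[OF c] by (elim dvdE)
  have "0 < int k * n'" using n' icycD(1)[OF c] by simp
  then have "0 < n'" using k by (simp add: zero_less_mult_iff)
  define n where "n = nat n'"
  have n: "m = int (n * k)" "0 < n" using n' \<open>0 < n'\<close> by (auto simp: n_def mult.commute)
  have k0: "0 < k" using k by simp
  show thesis
    by (rule pendants_avoid_class[OF wf c[unfolded n(1)] k0 n(2) A ys disj len konig])
      (assumption+, rule that, blast)
qed

text \<open>A pendant path of length \<open>(k - 1) / 2\<close> pins down the class of any minimum cover.\<close>

lemma long_pendant_class:
  assumes "\<forall>d. 1 \<le> d \<and> d \<le> int (k div 2) \<longrightarrow> \<not> int k dvd a + d - i \<and> \<not> int k dvd a - d - i"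
  shows "int k dvd a - i"
proof (rule ccontr)
  assume nd: "\<not> int k dvd a - i"
  define e where "e = (i - a) mod int k"
  have e: "0 \<le> e" "e < int k" using k by (simp_all add: e_def)
  have d: "int k dvd (i - a) - e" unfolding e_def by (rule dvd_minus_mod)
  have e0: "e \<noteq> 0"
  proof
    assume "e = 0"
    then have "int k dvd - (a - i)" using d by simp
    then show False using nd unfolding dvd_minus_iff by blast
  qed
  have kk: "int k = 2 * int (k div 2) + 1" using k2 by presburger
  show False
  proof (cases "e \<le> int (k div 2)")
    case True
    have "a + e - i = - ((i - a) - e)" by simp
    then have "int k dvd a + e - i" using d by (simp only: dvd_minus_iff)
    then show False using assms True e e0 by auto
  next
    case False
    have "a - (int k - e) - i = - ((i - a) - e) - int k" by simp
    moreover have "int k dvd - ((i - a) - e) - int k" using d by (intro dvd_diff) (simp_all only: dvd_minus_iff dvd_refl)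
    ultimately have "int k dvd a - (int k - e) - i" by (simp only:)
    moreover have "1 \<le> int k - e" "int k - e \<le> int (k div 2)" using False e kk by auto
    ultimately show False using assms by blast
  qed
qed

text \<open>An arc of \<open>L\<close> cycle vertices is closed up by the vertices \<open>ws\<close>
  off the cycle. Empty \<open>ws\<close> means closing by a single edge, which is the case of a
  chord.\<close>

lemma closing_length:
  assumes c: "icyc G m c" and L: "1 \<le> L" "int L \<le> m" and ws: "distinct ws" "set ws \<inter> range c = {}"
      "walk G ws"
    and ends: "if ws = [] then {c (a + int L - 1), c a} \<in> edges G
      else {c (a + int L - 1), hd ws} \<in> edges G \<and> {last ws, c a} \<in> edges G"
    and len: "3 \<le> L + length ws"
  shows "k dvd L + length ws"
proof -
  define xs where "xs = map (\<lambda>i. c (a + int i)) [0..<L]"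
  note p = icyc_path_list[OF c L(2) xs_def]
  have xs0: "xs \<noteq> []" using p(3) L(1) by auto
  have xs: "hd xs = c a" "last xs = c (a + int L - 1)"
    using L(1) by (simp_all add: xs_def hd_map last_map of_nat_diff algebra_simps)
  have "distinct (xs @ ws)" using p(1,4) ws(1,2) by auto
  moreover have "3 \<le> length (xs @ ws)" using p(3) len by simp
  moreover have "walk G (xs @ ws)"
    using p(2) ws(3) ends xs by (auto simp: successively_append_iff split: if_splits)
  moreover have "{last (xs @ ws), hd (xs @ ws)} \<in> edges G"
    using ends xs xs0 by (auto split: if_splits)
  ultimately have "icyc G (int (length (xs @ ws))) (\<lambda>i. (xs @ ws) ! nat (i mod int (length (xs @ ws))))"
    by (rule icyc_of_list(1))
  then have "int k dvd int (length (xs @ ws))" by (rule cyc)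
  moreover have "length (xs @ ws) = L + length ws" using p(3) by simp
  ultimately show ?thesis by (simp only: int_dvd_int_iff)
qed

text \<open>The three paths of a theta graph have lengths \<open>a\<close>, \<open>m - a\<close> and \<open>l + 1\<close>, any two of which sum
  to a multiple of the odd number \<open>k\<close>.\<close>

lemma ear_lengths:
  assumes c: "icyc G m c" and zs: "distinct zs" "zs \<noteq> []" "set zs \<inter> range c = {}"
      "walk G zs"
    and ends: "{c i, hd zs} \<in> edges G" "{last zs, c j} \<in> edges G" and ne: "c i \<noteq> c j"
  shows "int k dvd i - j \<and> k dvd length zs + 1"
proof -
  have "c j \<in> range c" by simp
  then obtain j' where j': "i \<le> j'" "j' < i + m" "c j = c j'" by (rule icyc_obtain[OF c])
  have ij: "i \<noteq> j'" using ne j'(3) by auto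
  define a where "a = nat (j' - i)"
  have a: "int a = j' - i" "1 \<le> a" using j' ij by (auto simp: a_def)
  define b where "b = nat (m - int a)"
  have b: "int b = m - int a" "1 \<le> b" using j' a by (auto simp: b_def)
  have zl: "1 \<le> length zs" using zs(2) by (cases zs) auto
  have e1: "{c (i + int (a + 1) - 1), last zs} \<in> edges G" "{c i, hd zs} \<in> edges G"
    using a ends j' by (simp_all add: insert_commute)
  have "walk G (rev zs)" using zs(4) by (simp add: insert_commute)
  then have 1: "k dvd (a + 1) + length (rev zs)"
    using zs e1 a b zl by (intro closing_length[OF c, of "a + 1" "rev zs" i]) (auto simp: hd_rev last_rev insert_commute)
  have "c (i + m) = c i" by (rule icyc_periodic[OF c])
  moreover have "j' + int (b + 1) - 1 = i + m" using a b by simp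
  ultimately have e2: "{c (j' + int (b + 1) - 1), hd zs} \<in> edges G" "{last zs, c j'} \<in> edges G"
    using ends j'(3) by (simp_all only:)
  have 2: "k dvd (b + 1) + length zs"
    using zs e2 a b zl by (intro closing_length[OF c, of "b + 1" zs j']) auto
  have "int k dvd int (a + b)" using cyc[OF c] a b by simp
  then have 3: "k dvd a + b" by (simp only: int_dvd_int_iff)
  have 1: "k dvd (a + 1) + length zs" using 1 by (simp only: length_rev)
  have "k dvd ((a + 1) + length zs) + ((b + 1) + length zs)" by (rule dvd_add[OF 1 2])
  also have "((a + 1) + length zs) + ((b + 1) + length zs) = (a + b) + 2 * (length zs + 1)" by simp
  finally have "k dvd 2 * (length zs + 1)" using 3 by (simp only: dvd_add_right_iff)
  moreover have "coprime k 2" using k(2) by simp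
  ultimately have l: "k dvd length zs + 1" by (simp only: coprime_dvd_mult_right_iff)
  have "k dvd a + (length zs + 1)" using 1 by (simp add: add.commute add.left_commute)
  then have "k dvd a" using l by (simp only: dvd_add_left_iff)
  then have "int k dvd j' - i" using a(1) by (metis int_dvd_int_iff)
  moreover have "int k dvd j - j'" using icycD(2)[OF c, of j j'] j'(3) cyc[OF c] dvd_trans by blast
  ultimately have "int k dvd - ((j - j') + (j' - i))" unfolding dvd_minus_iff by (intro dvd_add)
  then have "int k dvd i - j" by simp
  then show ?thesis using l by simp
qed

text \<open>A chord splits the cycle into two cycles whose orders add up to \<open>m + 2\<close>. As
  all three orders are multiples of \<open>k\<close>, the number \<open>k\<close> would divide
  2.\<close>

lemma no_chord:
  assumes c: "icyc G m c" and e: "{c i, c j} \<in> edges G"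
  shows "c j = c (i - 1) \<or> c j = c (i + 1)"
proof (rule ccontr)
  assume n: "\<not> ?thesis"
  have "c j \<in> range c" by simp
  then obtain j' where j': "i \<le> j'" "j' < i + m" "c j = c j'" by (rule icyc_obtain[OF c])
  have "j' \<noteq> i" using edge_ne[OF wf e] j'(3) by auto
  moreover have "j' \<noteq> i + 1" using n j'(3) by auto
  moreover have "c (i + m - 1) = c (i - 1)" using icyc_periodic[OF c, of "i - 1"] by (simp add: algebra_simps)
  then have "j' \<noteq> i + m - 1" using n j'(3) by metis
  ultimately have r: "i + 2 \<le> j'" "j' + 2 \<le> i + m" using j' by auto
  define a where "a = nat (j' - i)"
  have a: "int a = j' - i" using r by (simp add: a_def)
  define b where "b = nat (m - int a)"
  have b: "int b = m - int a" using r a by (simp add: b_def)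
  have "{c (i + int (a + 1) - 1), c i} \<in> edges G" using a e j'(3) by (simp add: insert_commute)
  then have 1: "k dvd (a + 1) + length ([] :: 'a list)"
    using r a by (intro closing_length[OF c, of "a + 1" "[]" i]) auto
  have "j' + int (b + 1) - 1 = i + m" using a b by simp
  then have "{c (j' + int (b + 1) - 1), c j'} \<in> edges G" using e j'(3) icyc_periodic[OF c, of i] by (simp only:)
  then have 2: "k dvd (b + 1) + length ([] :: 'a list)"
    using r a b by (intro closing_length[OF c, of "b + 1" "[]" j']) auto
  have "int k dvd int (a + b)" using cyc[OF c] b by simp
  then have 3: "k dvd a + b" by (simp only: int_dvd_int_iff)
  have "k dvd (a + 1 + length ([] :: 'a list)) + (b + 1 + length ([] :: 'a list))" by (rule dvd_add[OF 1 2])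
  then have "k dvd (a + 1) + (b + 1)" by (simp only: list.size add_0_right)
  also have "(a + 1) + (b + 1) = (a + b) + 2" by simp
  finally have "k dvd 2" using 3 by (simp only: dvd_add_right_iff)
  then have "k \<le> 2" by (rule dvd_imp_le) simp
  then show False using k by simp
qed

end

locale konig_block = konig_graph k G for k :: nat and G :: "'a sgraph" +
  fixes B :: "'a sgraph"
  assumes B: "B \<in> blocks G" and nontriv: "3 \<le> card (verts B)"
begin

lemma wfB: "wf_sgraph B" by (rule blocksD(2)[OF B])

lemma cycG: "icyc B m c \<Longrightarrow> icyc G m c" by (rule icyc_mono[OF _ blocksD(5)[OF B]])

lemma hang_mono:
  assumes "hang G B x r" "r' \<le> r"
  shows "hang G B x r'"
proof -
  obtain ys where ys: "length ys = r" "gpath G (x # ys)" "set ys \<inter> verts B = {}"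
    using assms(1) unfolding hang_def by blast
  have "gpath G (x # take r' ys)" by (rule gpath_take[OF ys(2)])
  moreover have "set (take r' ys) \<inter> verts B = {}" using ys(3) set_take_subset[of r' ys] by blast
  ultimately show ?thesis unfolding hang_def using ys(1) assms(2) by (intro exI[of _ "take r' ys"]) simp
qed

text \<open>Intersecting paths would contain a connection from \<open>x\<close> to \<open>x'\<close>
  outside the block, that is, an ear.\<close>

lemma hangs_disjoint:
  assumes x: "x \<in> verts B" "x' \<in> verts B" "x \<noteq> x'"
    and ys: "gpath G (x # ys)" "set ys \<inter> verts B = {}" and ys': "gpath G (x' # ys')" "set ys' \<inter> verts B = {}"
  shows "set ys \<inter> set ys' = {}"
proof (rule ccontr)
  assume "set ys \<inter> set ys' \<noteq> {}"
  then obtain z where z: "z \<in> set ys" "z \<in> set ys'" by blast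
  then have ne: "ys \<noteq> []" "ys' \<noteq> []" by auto
  have s: "walk G ys" "{x, hd ys} \<in> edges G" "set ys \<subseteq> verts G - verts B"
    "walk G ys'" "{x', hd ys'} \<in> edges G" "set ys' \<subseteq> verts G - verts B"
    using ys ys' ne by (auto simp: gpath_def successively_Cons)
  have "reach G (verts G - verts B) (hd ys) z"
    by (rule reach_successively[OF s(1,3)]) (use ne z in simp_all)
  moreover have "reach G (verts G - verts B) z (hd ys')"
    by (rule reach_successively[OF s(4,6)]) (use ne z in simp_all)
  ultimately have "reach G (verts G - verts B) (hd ys) (hd ys')" by (rule reach_trans)
  then have "x = x'"
    using block_no_ear[OF wf B _ _ x(1,2) s(2)] s(3,5) hd_in_set[OF ne(1)] by (metis insert_commute subsetD)
  then show False using x by blast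
qed

lemma branch_neighbour:
  assumes "branching B (c i)"
  obtains y where "{c i, y} \<in> edges B" "y \<noteq> c (i - 1)" "y \<noteq> c (i + 1)"
  using assms unfolding branching_def by metis

lemma not_branching_cycle:
  assumes c: "icyc B m c" and nb: "\<not> branching B (c i)" and y: "{c i, y} \<in> edges B"
  shows "y = c (i - 1) \<or> y = c (i + 1)"
proof (rule ccontr)
  assume "\<not> ?thesis"
  moreover have "{c i, c (i - 1)} \<in> edges B" using icycD(4)[OF c, of i] by (simp add: insert_commute)
  ultimately have "branching B (c i)"
    using icyc_neighbours_ne(1)[OF c, of i] icycD(3)[OF c, of i] y unfolding branching_def by blast
  then show False using nb by blast
qed

text \<open>The third neighbour of \<open>c i\<close> is off the cycle, as there are no chords.
  Since \<open>c i\<close> is not a cutvertex, the cycle is reached again at another vertex. By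
  \<open>ear_lengths\<close> this ear has length divisible by \<open>k\<close>, hence at least
  \<open>k - 1\<close> inner vertices.\<close>

lemma branch_ear:
  assumes c: "icyc B m c" and br: "branching B (c i)"
  obtains us where "gpath G (c i # us)" "set us \<inter> range c = {}" "set us \<subseteq> verts B" "k - 1 \<le> length us"
proof -
  obtain y where y: "{c i, y} \<in> edges B" "y \<noteq> c (i - 1)" "y \<noteq> c (i + 1)" by (rule branch_neighbour[where c = c and i = i, OF br])
  have cG: "icyc G m c" by (rule cycG[OF c])
  have yG: "{c i, y} \<in> edges G" using y(1) blocksD(5)[OF B] by blast
  have yc: "y \<notin> range c"
  proof
    assume "y \<in> range c"
    then obtain j where "y = c j" by blast
    then show False using no_chord[OF cG] yG y(2,3) by blast
  qed
  have cB: "range c \<subseteq> verts B" by (rule icyc_verts[OF wfB c])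
  have yB: "y \<in> verts B - {c i}" using edge_verts[OF wfB y(1)] edge_ne[OF wfB y(1)] by auto
  have nB: "c (i + 1) \<in> verts B - {c i}" using icyc_neighbours_ne(2)[OF c, of i] cB by auto
  have r: "reach B (verts B - {c i}) y (c (i + 1))"
    by (rule nonsepD[OF blocksD(3)[OF B] wfB _ yB nB]) blast
  have cin: "c (i + 1) \<in> range c" by simp
  obtain us t where us: "t \<in> range c" "t \<in> verts B - {c i}" "distinct (us @ [t])"
    "set us \<subseteq> verts B - {c i} - range c" "walk B (us @ [t])" "hd (us @ [t]) = y"
    by (rule reach_first_hit[OF r yB cin])
  have u0: "us \<noteq> []" using us(1,6) yc by (cases us) auto
  have sG: "walk G (us @ [t])"
    by (rule successively_mono[OF us(5)]) (use blocksD(5)[OF B] in auto)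
  obtain j where j: "t = c j" using us(1) by blast
  have h: "hd us = y" using us(6) u0 by simp
  have "int k dvd i - j \<and> k dvd length us + 1"
  proof (rule ear_lengths[OF cG _ u0])
    show "{c i, hd us} \<in> edges G" using yG h by simp
    show "{last us, c j} \<in> edges G" using sG u0 j by (simp add: successively_append_iff)
  qed (use us j sG in \<open>auto simp: successively_append_iff\<close>)
  then have "k \<le> length us + 1" using dvd_imp_le[of k "length us + 1"] by simp
  moreover have "gpath G (c i # us)"
    using us u0 sG yG h cB blocksD(4)[OF B] by (auto simp: gpath_def successively_append_iff successively_Cons)
  moreover have "set us \<inter> range c = {}" "set us \<subseteq> verts B" using us(4) by auto
  ultimately show thesis using that[of us] by simp
qed

text \<open>Disjoint ears are cut down to \<open>k div 2\<close> vertices each, fewer than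
  \<open>k\<close> together, and each of them forces the covering class to be that of its attachment
  vertex. Intersecting ears yield an ear from \<open>c i\<close> to \<open>c j\<close>, and
  \<open>ear_lengths\<close> applies.\<close>

lemma branch_congruent:
  assumes c: "icyc B m c" and i: "branching B (c i)" and j: "branching B (c j)"
  shows "int k dvd i - j"
proof (cases "c i = c j")
  case True
  then show ?thesis using icycD(2)[OF c] cyc[OF cycG[OF c]] dvd_trans by blast
next
  case ne: False
  have cG: "icyc G m c" by (rule cycG[OF c])
  obtain us where us: "gpath G (c i # us)" "set us \<inter> range c = {}" "set us \<subseteq> verts B" "k - 1 \<le> length us"
    by (rule branch_ear[OF c i])
  obtain vs where vs: "gpath G (c j # vs)" "set vs \<inter> range c = {}" "set vs \<subseteq> verts B" "k - 1 \<le> length vs"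
    by (rule branch_ear[OF c j])
  define l where "l = k div 2"
  have l: "l \<le> length us" "l \<le> length vs" "2 * l < k" using us(4) vs(4) k k2 by (auto simp: l_def)
  show ?thesis
  proof (cases "set us \<inter> set vs = {}")
    case True
    define ys where "ys x = (if x = i then take l us else take l vs)" for x
    have ij: "i \<noteq> j" using ne by auto
    have tk: "set (take l us) \<subseteq> set us" "set (take l vs) \<subseteq> set vs" by (rule set_take_subset)+
    have ly: "length (ys x) = l" for x using l by (simp add: ys_def)
    obtain t where t: "\<forall>a\<in>{i, j}. \<forall>d. 1 \<le> d \<and> d \<le> int (length (ys a)) \<longrightarrow>
      \<not> int k dvd a + d - t \<and> \<not> int k dvd a - d - t"
    proof (rule pendants_class[OF cG, of "{i, j}" ys])
      show "gpath G (c a # ys a)" if "a \<in> {i, j}" for a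
        using that gpath_take[OF us(1)] gpath_take[OF vs(1)] ij by (auto simp: ys_def)
      show "set (ys a) \<inter> range c = {}" for a using us(2) vs(2) tk by (auto simp: ys_def)
      show "set (ys a) \<inter> set (ys b) = {}" if "a \<in> {i, j}" "b \<in> {i, j}" "a \<noteq> b" for a b
        using that True tk ij by (auto simp: ys_def)
      show "(\<Sum>a\<in>{i, j}. length (ys a)) < k" using ij l(3) by (simp add: ly)
    qed simp
    have "int k dvd i - t" "int k dvd j - t" using t ly unfolding l_def by (auto intro!: long_pendant_class)
    then have "int k dvd (i - t) - (j - t)" by (rule dvd_diff)
    then show ?thesis by simp
  next
    case False
    then obtain z where z: "z \<in> set us" "z \<in> set vs" by blast
    then have ne': "us \<noteq> []" "vs \<noteq> []" by auto
    define Z where "Z = verts G - range c"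
    have s: "walk G us" "{c i, hd us} \<in> edges G" "set us \<subseteq> Z"
      "walk G vs" "{c j, hd vs} \<in> edges G" "set vs \<subseteq> Z"
      using us vs ne' by (auto simp: gpath_def successively_Cons Z_def)
    have "reach G Z (hd us) z" by (rule reach_successively[OF s(1,3)]) (use ne' z in simp_all)
    moreover have "reach G Z z (hd vs)" by (rule reach_successively[OF s(4,6)]) (use ne' z in simp_all)
    ultimately have r: "reach G Z (hd us) (hd vs)" by (rule reach_trans)
    have "hd us \<in> Z" using s(3) ne' by (meson hd_in_set subsetD)
    then obtain zs where zs: "zs \<noteq> []" "hd zs = hd us" "last zs = hd vs" "distinct zs" "set zs \<subseteq> Z"
      "walk G zs" by (rule reach_path[OF r])
    have "set zs \<inter> range c = {}" using zs(5) by (auto simp: Z_def)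
    then show ?thesis
      using ear_lengths[OF cG zs(4,1) _ zs(6), of i j] zs(2,3) s(2,5) ne by (simp add: insert_commute)
  qed
qed

text \<open>Without branch vertices the cycle is closed under adjacency in the connected graph
  \<open>B\<close>.\<close>

lemma cycle_branch_or_all:
  assumes c: "icyc B m c" and nb: "\<And>i. \<not> branching B (c i)"
  shows "verts B = range c" "{x, y} \<in> edges B \<Longrightarrow> \<exists>l. {x, y} = {c l, c (l + 1)}" "\<not> branching B v"
proof -
  have cB: "range c \<subseteq> verts B" by (rule icyc_verts[OF wfB c])
  have nbr: "y = c (i - 1) \<or> y = c (i + 1)" if "{c i, y} \<in> edges B" for i y
    by (rule not_branching_cycle[OF c nb that])
  show V: "verts B = range c"
  proof (intro equalityI subsetI)
    fix v assume v: "v \<in> verts B"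
    have c0: "c 0 \<in> verts B" using cB by blast
    have "reach B (verts B) (c 0) v" using nonsepD[OF blocksD(3)[OF B] wfB, of "{}" "c 0" v] v c0 by simp
    then show "v \<in> range c"
    proof (rule reach_closed)
      show "c 0 \<in> range c" by simp
      fix u w assume "u \<in> range c" "{u, w} \<in> edges B"
      then obtain i where "{c i, w} \<in> edges B" by blast
      from nbr[OF this] show "w \<in> range c" by blast
    qed
  qed (use cB in blast)
  show ed: "\<exists>l. {x, y} = {c l, c (l + 1)}" if e: "{x, y} \<in> edges B" for x y
  proof -
    have "x \<in> range c" using edge_verts[OF wfB e] V by blast
    then obtain i where i: "x = c i" by blast
    from nbr[of i y] e i have "y = c (i - 1) \<or> y = c (i + 1)" by blast
    then show ?thesis
    proof
      assume "y = c (i - 1)"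
      then show ?thesis using i by (intro exI[of _ "i - 1"]) (simp add: insert_commute)
    next
      assume "y = c (i + 1)" then show ?thesis using i by blast
    qed
  qed
  show "\<not> branching B v"
  proof
    assume br: "branching B v"
    then obtain x where "{v, x} \<in> edges B" unfolding branching_def by blast
    then have "v \<in> range c" using edge_verts[OF wfB] V by blast
    then show False using br nb by blast
  qed
qed

end

section \<open>From class cycles to a subdivision\<close>

text \<open>A parametrized segment of the subdivision to be built. By the last conjunct a path
  attached at an inner vertex has fewer vertices than the distance to either end; this excludes
  \<open>k\<close>-paths in the components of \<open>G - W\<close> that meet
  \<open>B\<close>.\<close>

definition seg_fun :: "nat \<Rightarrow> 'a sgraph \<Rightarrow> 'a sgraph \<Rightarrow> 'a set \<Rightarrow> (nat \<Rightarrow> 'a) \<Rightarrow> bool" where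
  "seg_fun k G B W s \<longleftrightarrow> s 0 \<in> W \<and> s k \<in> W \<and> (\<forall>j. 0 < j \<and> j < k \<longrightarrow> s j \<in> verts B - W) \<and>
     (\<forall>j<k. {s j, s (Suc j)} \<in> edges B) \<and> inj_on s {0<..<k} \<and>
     (\<forall>j. 0 < j \<and> j < k \<longrightarrow> s (j - 1) \<noteq> s (Suc j)) \<and>
     (\<forall>j r. 0 < j \<and> j < k \<and> hang G B (s j) r \<longrightarrow> r < j \<and> r < k - j)"

lemma seg_funD:
  assumes "seg_fun k G B W s"
  shows "s 0 \<in> W" "s k \<in> W" "0 < j \<Longrightarrow> j < k \<Longrightarrow> s j \<in> verts B \<and> s j \<notin> W"
    "j < k \<Longrightarrow> {s j, s (Suc j)} \<in> edges B" "inj_on s {0<..<k}"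
    "0 < j \<Longrightarrow> j < k \<Longrightarrow> s (j - 1) \<noteq> s (Suc j)"
    "0 < j \<Longrightarrow> j < k \<Longrightarrow> hang G B (s j) r \<Longrightarrow> r < j \<and> r < k - j"
  using assms unfolding seg_fun_def by simp_all

lemma seg_fun_rev:
  assumes s: "seg_fun k G B W s" shows "seg_fun k G B W (\<lambda>j. s (k - j))"
  unfolding seg_fun_def
proof (intro conjI allI impI)
  show "s (k - 0) \<in> W" "s (k - k) \<in> W" using seg_funD(1,2)[OF s] by simp_all
  show "s (k - j) \<in> verts B - W" if "0 < j \<and> j < k" for j using seg_funD(3)[OF s, of "k - j"] that by simp
  show "{s (k - j), s (k - Suc j)} \<in> edges B" if "j < k" for j
  proof -
    have "Suc (k - Suc j) = k - j" using that by simp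
    then show ?thesis using seg_funD(4)[OF s, of "k - Suc j"] that by (simp add: insert_commute)
  qed
  show "inj_on (\<lambda>j. s (k - j)) {0<..<k}"
  proof (rule inj_onI)
    fix i j assume ij: "i \<in> {0<..<k}" "j \<in> {0<..<k}" "s (k - i) = s (k - j)"
    then have "k - i = k - j" by (intro inj_onD[OF seg_funD(5)[OF s]]) auto
    then show "i = j" using ij unfolding greaterThanLessThan_iff by arith
  qed
  show "s (k - (j - 1)) \<noteq> s (k - Suc j)" if "0 < j \<and> j < k" for j
  proof -
    have "k - (j - 1) = Suc (k - j)" "k - Suc j = k - j - 1" using that by auto
    then show ?thesis using seg_funD(6)[OF s, of "k - j"] that by simp
  qed
  show "r < j" "r < k - j" if "0 < j \<and> j < k \<and> hang G B (s (k - j)) r" for j r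
    using seg_funD(7)[OF s, of "k - j" r] that by simp_all
qed

text \<open>As \<open>k\<close> is odd, an inner position is strictly closer to one end. Let
  \<open>d\<close> be that distance: an attached path with \<open>d\<close> or more vertices would
  exclude the class \<open>b\<close> itself, so it is shorter than the distance to both
  ends.\<close>

lemma class_cycle_seg_fun:
  assumes k: "k \<ge> 3" "odd k" and wfB: "wf_sgraph B" and c: "class_cycle k G B W c b"
  shows "seg_fun k G B W (\<lambda>j. c (b + int j))"
proof -
  obtain m where m: "icyc B m c" "int k dvd m" using c by (auto simp: class_cycle_def)
  have W: "c i \<in> W \<longleftrightarrow> int k dvd i - b" for i using c by (simp add: class_cycle_def)
  have H: "\<not> int k dvd a + d - b \<and> \<not> int k dvd a - d - b"
    if "hang G B (c a) r" "1 \<le> d" "d \<le> int r" "2 * d < int k" for a r d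
    using c that unfolding class_cycle_def by blast
  have km: "int k \<le> m" using zdvd_imp_le[OF m(2)] icycD(1)[OF m(1)] by simp
  show ?thesis unfolding seg_fun_def
  proof (intro conjI allI impI)
    show "c (b + int 0) \<in> W" "c (b + int k) \<in> W" using W by simp_all
    show "c (b + int j) \<in> verts B - W" if "0 < j \<and> j < k" for j
    proof -
      have "\<not> int k dvd int j" using that by (simp add: nat_dvd_not_less)
      then show ?thesis using W[of "b + int j"] icyc_verts[OF wfB m(1)] by auto
    qed
    show "{c (b + int j), c (b + int (Suc j))} \<in> edges B" for j
      using icycD(3)[OF m(1), of "b + int j"] by (simp add: algebra_simps)
    show "inj_on (\<lambda>j. c (b + int j)) {0<..<k}"
    proof (rule inj_onI)
      fix i j assume "i \<in> {0<..<k}" "j \<in> {0<..<k}" "c (b + int i) = c (b + int j)"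
      then have "b + int i = b + int j" using km by (intro inj_onD[OF icyc_inj[OF m(1), of b]]) auto
      then show "i = j" by simp
    qed
    show "c (b + int (j - 1)) \<noteq> c (b + int (Suc j))" if "0 < j \<and> j < k" for j
    proof -
      have "b + int (j - 1) = (b + int j) - 1" "b + int (Suc j) = (b + int j) + 1" using that by auto
      then show ?thesis using icyc_neighbours_ne(1)[OF m(1), of "b + int j"] by (simp only:) simp
    qed
    have hh: "r < j \<and> r < k - j" if j: "0 < j \<and> j < k \<and> hang G B (c (b + int j)) r" for j r
    proof -
      consider "2 * j < k" | "2 * (k - j) < k" using k(2) j by (metis diff_mult_distrib2 dvd_triv_left linorder_neqE_nat mult_2 nat_add_left_cancel_less less_diff_conv add.commute add_diff_inverse_nat less_imp_le_nat not_less)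
      then show ?thesis
      proof cases
        case 1
        have "\<not> j \<le> r"
          using H[of "b + int j" r "int j"] j 1 by auto
        then show ?thesis using 1 by simp
      next
        case 2
        have "\<not> k - j \<le> r"
        proof
          assume le: "k - j \<le> r"
          have e: "(b + int j) + int (k - j) - b = int k" using j by simp
          have "\<not> int k dvd (b + int j) + int (k - j) - b"
          proof -
            have "1 \<le> int (k - j)" "int (k - j) \<le> int r" "2 * int (k - j) < int k"
              using j le 2 by arith+
            then show ?thesis using H[of "b + int j" r "int (k - j)"] j by blast
          qed
          then show False unfolding e by simp
        qed
        then show ?thesis using 2 j by simp
      qed
    qed
    then show "r < j" "r < k - j" if "0 < j \<and> j < k \<and> hang G B (c (b + int j)) r" for j r
      using that by blast+
  qed
qed

locale good_block =
  fixes k :: nat and G B :: "'a sgraph" and W :: "'a set"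
  assumes k: "k \<ge> 3" "odd k" and wf: "wf_sgraph G" and B: "B \<in> blocks G" and nontriv: "3 \<le> card (verts B)"
    and good: "good k G B W"
begin

lemma wfB: "wf_sgraph B" by (rule blocksD(2)[OF B])

lemma WB: "W \<subseteq> verts B" using good by (simp add: good_def)

lemma not_branching: "v \<in> verts B \<Longrightarrow> v \<notin> W \<Longrightarrow> {v, x} \<in> edges B \<Longrightarrow> {v, y} \<in> edges B \<Longrightarrow>
   {v, z} \<in> edges B \<Longrightarrow> x = y \<or> y = z \<or> x = z"
  using good unfolding good_def branching_def by blast

lemma edge_in_seg:
  assumes "{x, y} \<in> edges B"
  obtains s j where "seg_fun k G B W s" "j < k" "{x, y} = {s j, s (Suc j)}"
proof -
  obtain c b l where c: "class_cycle k G B W c b" "{x, y} = {c l, c (l + 1)}"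
    using good assms unfolding good_def by blast
  define j where "j = nat ((l - b) mod int k)"
  have j: "int j = (l - b) mod int k" "j < k" using k by (simp_all add: j_def nat_less_iff)
  \<comment> \<open>A representative of the class of \<open>b\<close>, chosen so that the edge from
    \<open>l\<close> to \<open>l + 1\<close> lies in the window starting at
    \<open>b'\<close>.\<close>
  define b' where "b' = l - int j"
  have "int k dvd (l - b) mod int k - (l - b)" by (metis dvd_minus_iff dvd_minus_mod minus_diff_eq)
  then have "int k dvd b - b'" unfolding b'_def j(1) by (simp add: algebra_simps)
  then have s: "seg_fun k G B W (\<lambda>j. c (b' + int j))"
    using class_cycle_seg_fun[OF k wfB class_cycle_cong[OF c(1)]] by blast
  have "b' + int j = l" "b' + int (Suc j) = l + 1" by (simp_all add: b'_def)
  then have "{x, y} = {c (b' + int j), c (b' + int (Suc j))}" using c(2) by (simp only:)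
  then show thesis by (rule that[OF s j(2)])
qed

lemma vertex_in_seg:
  assumes "v \<in> verts B" "v \<notin> W"
  obtains s j where "seg_fun k G B W s" "0 < j" "j < k" "v = s j"
proof -
  have "\<not> verts B \<subseteq> {v}" using nontriv card_mono[of "{v}" "verts B"] by auto
  then obtain u where u: "u \<in> verts B" "u \<noteq> v" by blast
  have "reach B (verts B) v u" using nonsepD[OF blocksD(3)[OF B] wfB, of "{}" v u] u assms by simp
  then obtain w where w: "{v, w} \<in> edges B"
    using u(2) unfolding reach_def by (auto elim: converse_rtranclpE)
  obtain s j where s: "seg_fun k G B W s" "j < k" "{v, w} = {s j, s (Suc j)}" by (rule edge_in_seg[OF w])
  note D = seg_funD[OF s(1)]
  from s(3) consider "v = s j" | "v = s (Suc j)" by (auto simp: doubleton_eq_iff)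
  then show thesis
  proof cases
    case 1
    then have "0 < j" using D(1) assms(2) by (cases j) auto
    then show thesis using that[OF s(1) _ s(2) 1] by simp
  next
    case 2
    then have "Suc j < k" using D(2) assms(2) s(2) by (cases "Suc j = k") auto
    then show thesis using that[OF s(1) _ _ 2] by simp
  qed
qed

lemma seg_neighbours:
  assumes s: "seg_fun k G B W s" and j: "0 < j" "j < k" and y: "{s j, y} \<in> edges B"
  shows "y = s (j - 1) \<or> y = s (Suc j)"
proof -
  note D = seg_funD[OF s]
  have "{s j, s (j - 1)} \<in> edges B" using D(4)[of "j - 1"] j by (simp add: insert_commute)
  then show ?thesis
    using not_branching[of "s j" "s (j - 1)" "s (Suc j)" y] D(3)[OF j] D(4)[OF j(2)] D(6)[OF j] y by auto
qed

text \<open>There are no branch vertices outside \<open>W\<close>. Hence a walk from an inner vertex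
  that neither turns back nor meets \<open>W\<close> moves along \<open>s\<close> in a constant
  direction.\<close>

lemma inner_walk:
  assumes s: "seg_fun k G B W s" and i: "0 < i" "i < k" and f0: "f 0 = s i"
    and adj: "\<And>t. t < l \<Longrightarrow> {f t, f (Suc t)} \<in> edges B" and nW: "\<And>t. t \<le> l \<Longrightarrow> f t \<notin> W"
    and nb: "\<And>t. Suc t < l \<Longrightarrow> f (Suc (Suc t)) \<noteq> f t"
  shows "(\<forall>t\<le>l. i + t < k \<and> f t = s (i + t)) \<or> (\<forall>t\<le>l. t < i \<and> f t = s (i - t))"
  using adj nW nb
proof (induction l)
  case 0
  then show ?case using i f0 by simp
next
  case (Suc l)
  note D = seg_funD[OF s]
  have IH: "(\<forall>t\<le>l. i + t < k \<and> f t = s (i + t)) \<or> (\<forall>t\<le>l. t < i \<and> f t = s (i - t))"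
    using Suc.IH Suc.prems by simp
  have e: "{f l, f (Suc l)} \<in> edges B" using Suc.prems(1)[of l] by simp
  have nW': "f (Suc l) \<notin> W" using Suc.prems(2)[of "Suc l"] by simp
  have nb': "f (Suc l) \<noteq> f (l - 1)" if "l \<noteq> 0" using Suc.prems(3)[of "l - 1"] that by simp
  have up: "\<forall>t\<le>Suc l. i + t < k \<and> f t = s (i + t)"
    if a: "\<forall>t\<le>l. i + t < k \<and> f t = s (i + t)" and eq: "f (Suc l) = s (Suc (i + l))"
  proof -
    have "Suc (i + l) \<noteq> k" using eq nW' D(2) by auto
    then have "Suc (i + l) < k" using a by (metis Suc_lessI order_refl)
    then show ?thesis using a eq by (simp add: le_Suc_eq)
  qed
  have down: "\<forall>t\<le>Suc l. t < i \<and> f t = s (i - t)"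
    if a: "\<forall>t\<le>l. t < i \<and> f t = s (i - t)" and eq: "f (Suc l) = s (i - l - 1)"
  proof -
    have "i - l - 1 \<noteq> 0" using eq nW' D(1) by auto
    then show ?thesis using a eq by (simp add: le_Suc_eq)
  qed
  from IH show ?case
  proof
    assume a: "\<forall>t\<le>l. i + t < k \<and> f t = s (i + t)"
    have "f (Suc l) = s (i + l - 1) \<or> f (Suc l) = s (Suc (i + l))"
      using seg_neighbours[OF s, of "i + l" "f (Suc l)"] a e i by simp
    then show ?case
    proof
      assume "f (Suc l) = s (Suc (i + l))" then show ?thesis using up a by blast
    next
      assume d: "f (Suc l) = s (i + l - 1)"
      have "l = 0"
      proof (rule ccontr)
        assume l: "l \<noteq> 0"
        then have "f (l - 1) = s (i + l - 1)" using a[rule_format, of "l - 1"] by simp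
        then show False using nb'[OF l] d by simp
      qed
      then show ?thesis using down d f0 i by simp
    qed
  next
    assume a: "\<forall>t\<le>l. t < i \<and> f t = s (i - t)"
    have li: "l < i" using a by blast
    have "f (Suc l) = s (i - l - 1) \<or> f (Suc l) = s (Suc (i - l))"
      using seg_neighbours[OF s, of "i - l" "f (Suc l)"] a e i li by simp
    then show ?case
    proof
      assume "f (Suc l) = s (i - l - 1)" then show ?thesis using down a by blast
    next
      assume d: "f (Suc l) = s (Suc (i - l))"
      have "l = 0"
      proof (rule ccontr)
        assume l: "l \<noteq> 0"
        have "i - (l - 1) = Suc (i - l)" using l li by simp
        then have "f (l - 1) = s (Suc (i - l))" using a[rule_format, of "l - 1"] by simp
        then show False using nb'[OF l] d by simp
      qed
      then show ?thesis using up d f0 i by simp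
    qed
  qed
qed

text \<open>Walking along \<open>s\<close> in both directions from the common vertex avoids
  \<open>W\<close> and therefore stays inside \<open>s'\<close>. Applied in both roles, this makes
  the inner vertex sets equal.\<close>

lemma seg_inner_eq:
  assumes s: "seg_fun k G B W s" and s': "seg_fun k G B W s'" and ij: "0 < i" "i < k" "0 < j" "j < k" "s i = s' j"
  shows "s ` {0<..<k} \<subseteq> s' ` {0<..<k}"
proof -
  note D = seg_funD[OF s]
  have fw: "s t \<in> s' ` {0<..<k}" if t: "i \<le> t" "t < k" for t
  proof -
    define f where "f u = s (i + u)" for u
    have "(\<forall>u\<le>t - i. j + u < k \<and> f u = s' (j + u)) \<or> (\<forall>u\<le>t - i. u < j \<and> f u = s' (j - u))"
    proof (rule inner_walk[OF s' ij(3,4)])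
      show "f 0 = s' j" using ij by (simp add: f_def)
      show "{f u, f (Suc u)} \<in> edges B" if "u < t - i" for u using D(4)[of "i + u"] that t by (simp add: f_def)
      show "f u \<notin> W" if "u \<le> t - i" for u using D(3)[of "i + u"] that t ij by (simp add: f_def)
      show "f (Suc (Suc u)) \<noteq> f u" if "Suc u < t - i" for u
      proof -
        have "s (i + Suc u - 1) \<noteq> s (Suc (i + Suc u))" by (rule D(6)) (use that t ij in auto)
        from this[symmetric] show ?thesis by (simp add: f_def)
      qed
    qed
    then have "f (t - i) \<in> s' ` {0<..<k}"
    proof
      assume "\<forall>u\<le>t - i. j + u < k \<and> f u = s' (j + u)"
      then have "j + (t - i) < k \<and> f (t - i) = s' (j + (t - i))" by blast
      then show ?thesis using ij(3) by (intro image_eqI[of _ _ "j + (t - i)"]) auto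
    next
      assume "\<forall>u\<le>t - i. u < j \<and> f u = s' (j - u)"
      then have "t - i < j \<and> f (t - i) = s' (j - (t - i))" by blast
      then show ?thesis using ij(4) by (intro image_eqI[of _ _ "j - (t - i)"]) auto
    qed
    then show ?thesis using t by (simp add: f_def)
  qed
  have bw: "s t \<in> s' ` {0<..<k}" if t: "0 < t" "t \<le> i" for t
  proof -
    define f where "f u = s (i - u)" for u
    have "(\<forall>u\<le>i - t. j + u < k \<and> f u = s' (j + u)) \<or> (\<forall>u\<le>i - t. u < j \<and> f u = s' (j - u))"
    proof (rule inner_walk[OF s' ij(3,4)])
      show "f 0 = s' j" using ij by (simp add: f_def)
      show "{f u, f (Suc u)} \<in> edges B" if "u < i - t" for u
      proof -
        have "Suc (i - Suc u) = i - u" using that by simp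
        then show ?thesis using D(4)[of "i - Suc u"] that t ij by (simp add: f_def insert_commute)
      qed
      show "f u \<notin> W" if "u \<le> i - t" for u using D(3)[of "i - u"] that t ij by (simp add: f_def)
      show "f (Suc (Suc u)) \<noteq> f u" if u: "Suc u < i - t" for u
      proof -
        have "Suc (i - Suc u) = i - u" "i - Suc u - 1 = i - Suc (Suc u)" using u by auto
        moreover have "s (i - Suc u - 1) \<noteq> s (Suc (i - Suc u))" by (rule D(6)) (use u t ij in auto)
        ultimately show ?thesis unfolding f_def by (simp only:) simp
      qed
    qed
    then have "f (i - t) \<in> s' ` {0<..<k}"
    proof
      assume "\<forall>u\<le>i - t. j + u < k \<and> f u = s' (j + u)"
      then have "j + (i - t) < k \<and> f (i - t) = s' (j + (i - t))" by blast
      then show ?thesis using ij(3) by (intro image_eqI[of _ _ "j + (i - t)"]) auto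
    next
      assume "\<forall>u\<le>i - t. u < j \<and> f u = s' (j - u)"
      then have "i - t < j \<and> f (i - t) = s' (j - (i - t))" by blast
      then show ?thesis using ij(4) by (intro image_eqI[of _ _ "j - (i - t)"]) auto
    qed
    then show ?thesis using t by (simp add: f_def)
  qed
  show ?thesis using fw bw by (metis (no_types, lifting) greaterThanLessThan_iff image_subsetI linear)
qed

text \<open>A segment has two parametrizations, so the edges of the multigraph are the sets of inner
  vertices of segments, numbered by natural numbers. These sets are non-empty because
  \<open>k \<ge> 3\<close>, and different ones are disjoint by \<open>seg_inner_eq\<close>.\<close>

lemma exists_subdivision:
  obtains H :: "('a, nat) multigraph" where "wf_multigraph H" "is_Sub k H B" "mverts H = W"
proof -
  have finB: "finite (verts B)" using wfB by (simp add: wf_sgraph_def)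
  define I where "I = {s ` {0<..<k} |s. seg_fun k G B W s}"
  have "I \<subseteq> Pow (verts B)"
  proof
    fix S assume "S \<in> I"
    then obtain s where s: "S = s ` {0<..<k}" "seg_fun k G B W s" unfolding I_def by blast
    then show "S \<in> Pow (verts B)" using seg_funD(3)[OF s(2)] by auto
  qed
  then have "finite I" using finB finite_subset by blast
  then obtain g where g: "bij_betw g {0..<card I} I" using ex_bij_betw_nat_finite by blast
  define N where "N = card I"
  have "\<forall>e. \<exists>s. e < N \<longrightarrow> seg_fun k G B W s \<and> g e = s ` {0<..<k}"
  proof
    fix e
    have "g e \<in> I" if "e < N" using g that by (auto simp: bij_betw_def N_def)
    then show "\<exists>s. e < N \<longrightarrow> seg_fun k G B W s \<and> g e = s ` {0<..<k}" unfolding I_def by blast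
  qed
  from choice[OF this] obtain s where s: "\<And>e. e < N \<Longrightarrow> seg_fun k G B W (s e)" "\<And>e. e < N \<Longrightarrow> g e = s e ` {0<..<k}"
    by blast
  define H :: "('a, nat) multigraph" where "H = \<lparr>mverts = W, medges = {..<N}, ends = \<lambda>e. {s e 0, s e k}\<rparr>"
  have H: "mverts H = W" "medges H = {..<N}" "ends H e = {s e 0, s e k}" for e by (simp_all add: H_def)
  have wfH: "wf_multigraph H" unfolding wf_multigraph_def H
  proof (intro conjI ballI)
    show "finite W" using finite_subset[OF WB finB] .
    show "{s e 0, s e k} \<subseteq> W" if "e \<in> {..<N}" for e using seg_funD(1,2)[OF s(1)] that by simp
    show "card {s e 0, s e k} = 1 \<or> card {s e 0, s e k} = 2" for e by (cases "s e 0 = s e k") auto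
  qed simp
  \<comment> \<open>\<open>Sub\<close> orients edges by an arbitrary choice; the parametrization is
    reversed where this is necessary to agree with it.\<close>
  define q where "q e = (if orient H e = (s e 0, s e k) then s e else (\<lambda>j. s e (k - j)))" for e
  have q: "seg_fun k G B W (q e)" if "e < N" for e
    using s(1)[OF that] seg_fun_rev[OF s(1)[OF that]] by (simp add: q_def)
  have gq: "g e = q e ` {0<..<k}" if "e < N" for e
  proof -
    have "s e ` {0<..<k} = (\<lambda>j. s e (k - j)) ` {0<..<k}"
    proof (intro equalityI subsetI)
      fix x assume "x \<in> s e ` {0<..<k}"
      then obtain i where "x = s e i" "0 < i" "i < k" by auto
      then show "x \<in> (\<lambda>j. s e (k - j)) ` {0<..<k}" by (intro image_eqI[of _ _ "k - i"]) auto
    next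
      fix x assume "x \<in> (\<lambda>j. s e (k - j)) ` {0<..<k}"
      then obtain i where "x = s e (k - i)" "0 < i" "i < k" by auto
      then show "x \<in> s e ` {0<..<k}" by (intro image_eqI[of _ _ "k - i"]) auto
    qed
    then show ?thesis using s(2)[OF that] by (simp add: q_def)
  qed
  have orq: "orient H e = (q e 0, q e k)" for e
  proof -
    have "case (s e 0, s e k) of (x, y) \<Rightarrow> ends H e = {x, y}" by (simp add: H)
    then have "case orient H e of (x, y) \<Rightarrow> ends H e = {x, y}" unfolding orient_def by (rule someI)
    then have "orient H e = (s e 0, s e k) \<or> orient H e = (s e k, s e 0)"
      by (cases "orient H e") (auto simp: H doubleton_eq_iff)
    then show ?thesis by (auto simp: q_def)
  qed
  define \<phi> where "\<phi> v = (case v of Orig w \<Rightarrow> w | Inner e i \<Rightarrow> q e i)" for v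
  have sp: "\<phi> (sub_point k H e i) = q e i" for e i
    by (simp add: sub_point_def \<phi>_def orq)
  have qinj: "e = e' \<and> i = j" if a: "e < N" "e' < N" "0 < i" "i < k" "0 < j" "j < k" "q e i = q e' j" for e e' i j
  proof -
    have "q e ` {0<..<k} \<subseteq> q e' ` {0<..<k}" by (rule seg_inner_eq[OF q[OF a(1)] q[OF a(2)] a(3-7)])
    moreover have "q e' ` {0<..<k} \<subseteq> q e ` {0<..<k}"
      by (rule seg_inner_eq[OF q[OF a(2)] q[OF a(1)] a(5,6,3,4) a(7)[symmetric]])
    ultimately have "g e = g e'" using gq a by simp
    then have e: "e = e'" using g a by (auto simp: bij_betw_def N_def dest: inj_onD)
    have "i = j" using a e by (intro inj_onD[OF seg_funD(5)[OF q[OF a(1)]]]) auto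
    then show ?thesis using e by simp
  qed
  have V: "mverts (Sub k H) = Orig ` W \<union> {Inner e i |e i. e < N \<and> 0 < i \<and> i < k}"
    by (simp add: Sub_def H)
  have inner: "q e i \<in> verts B \<and> q e i \<notin> W" if "e < N" "0 < i" "i < k" for e i
    using seg_funD(3)[OF q[OF that(1)] that(2,3)] .
  \<comment> \<open>A walk through all \<open>k - 1\<close> inner vertices must begin at position
    \<open>1\<close> or \<open>k - 1\<close> of \<open>q e\<close> and run to the other side. Each
    end is then the neighbour in \<open>W\<close> of an outermost inner vertex.\<close>
  have in_q: "\<exists>e. e < N \<and> ((\<forall>t\<le>k. s' t = q e t) \<or> (\<forall>t\<le>k. s' t = q e (k - t)))"
    if s': "seg_fun k G B W s'" for s'
  proof -
    have "s' ` {0<..<k} \<in> I" unfolding I_def using s' by blast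
    then have "s' ` {0<..<k} \<in> g ` {0..<card I}" using g by (simp add: bij_betw_def)
    then obtain e where "s' ` {0<..<k} = g e" "e \<in> {0..<card I}" by (rule imageE)
    then have e: "e < N" "g e = s' ` {0<..<k}" by (simp_all add: N_def)
    have k1: "0 < (1::nat)" "1 < k" using k by auto
    have "s' 1 \<in> q e ` {0<..<k}" using e(2) gq[OF e(1)] k1 by auto
    then obtain j where j: "0 < j" "j < k" "s' 1 = q e j" by auto
    define f where "f t = s' (1 + t)" for t
    note D = seg_funD[OF s'] and Q = seg_funD[OF q[OF e(1)]]
    have w: "(\<forall>t\<le>k - 2. j + t < k \<and> f t = q e (j + t)) \<or> (\<forall>t\<le>k - 2. t < j \<and> f t = q e (j - t))"
    proof (rule inner_walk[OF q[OF e(1)] j(1,2)])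
      show "f 0 = q e j" using j by (simp add: f_def)
      show "{f t, f (Suc t)} \<in> edges B" if "t < k - 2" for t using D(4)[of "1 + t"] that by (simp add: f_def)
      show "f t \<notin> W" if "t \<le> k - 2" for t using D(3)[of "1 + t"] that k by (simp add: f_def)
      show "f (Suc (Suc t)) \<noteq> f t" if "Suc t < k - 2" for t
      proof -
        have "s' (Suc (Suc t) - 1) \<noteq> s' (Suc (Suc (Suc t)))" by (rule D(6)) (use that in auto)
        from this[symmetric] show ?thesis by (simp add: f_def)
      qed
    qed
    have ends: "{s' 1, s' 0} \<in> edges B" "{s' (k - 1), s' k} \<in> edges B"
      using D(4)[of 0] D(4)[of "k - 1"] k by (simp_all add: insert_commute)
    from w show ?thesis
    proof
      assume a: "\<forall>t\<le>k - 2. j + t < k \<and> f t = q e (j + t)"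
      then have "j + (k - 2) < k" by blast
      then have j1: "j = 1" using j(1) k by simp
      have mid: "s' t = q e t" if "0 < t" "t < k" for t
        using a[rule_format, of "t - 1"] that j1 by (simp add: f_def)
      have "s' 0 = q e 0 \<or> s' 0 = q e 2"
        using seg_neighbours[OF q[OF e(1)] k1, of "s' 0"] ends(1) mid[of 1] k by (simp add: numeral_2_eq_2)
      moreover have "q e 2 \<notin> W" using Q(3)[of 2] k by simp
      ultimately have z: "s' 0 = q e 0" using D(1) by auto
      have "s' k = q e (k - 2) \<or> s' k = q e k"
        using seg_neighbours[OF q[OF e(1)], of "k - 1" "s' k"] ends(2) mid[of "k - 1"] k by (simp add: numeral_2_eq_2)
      moreover have "q e (k - 2) \<notin> W" using Q(3)[of "k - 2"] k by simp
      ultimately have "s' k = q e k" using D(2) by auto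
      then have "\<forall>t\<le>k. s' t = q e t" using z mid by (metis le_eq_less_or_eq not_gr_zero)
      then show ?thesis using e(1) by blast
    next
      assume a: "\<forall>t\<le>k - 2. t < j \<and> f t = q e (j - t)"
      then have "k - 2 < j" by blast
      then have j1: "j = k - 1" using j(2) k by simp
      have mid: "s' t = q e (k - t)" if "0 < t" "t < k" for t
        using a[rule_format, of "t - 1"] that j1 by (simp add: f_def)
      have "s' 0 = q e (k - 2) \<or> s' 0 = q e k"
        using seg_neighbours[OF q[OF e(1)], of "k - 1" "s' 0"] ends(1) mid[of 1] k by (simp add: numeral_2_eq_2)
      moreover have "q e (k - 2) \<notin> W" using Q(3)[of "k - 2"] k by simp
      ultimately have z: "s' 0 = q e k" using D(1) by auto
      have "s' k = q e 0 \<or> s' k = q e 2"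
        using seg_neighbours[OF q[OF e(1)] k1, of "s' k"] ends(2) mid[of "k - 1"] k by (simp add: numeral_2_eq_2)
      moreover have "q e 2 \<notin> W" using Q(3)[of 2] k by simp
      ultimately have "s' k = q e 0" using D(2) by auto
      then have "\<forall>t\<le>k. s' t = q e (k - t)" using z mid by (metis le_eq_less_or_eq not_gr_zero diff_self_eq_0 diff_zero)
      then show ?thesis using e(1) by blast
    qed
  qed
  have "bij_betw \<phi> (mverts (Sub k H)) (verts B)"
  proof (rule bij_betw_imageI)
    show "inj_on \<phi> (mverts (Sub k H))"
    proof (rule inj_onI)
      fix x y assume "x \<in> mverts (Sub k H)" "y \<in> mverts (Sub k H)" "\<phi> x = \<phi> y"
      then show "x = y" unfolding V using inner qinj
        by (auto simp: \<phi>_def split: sub_vertex.splits)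
    qed
    show "\<phi> ` mverts (Sub k H) = verts B"
    proof (intro equalityI subsetI)
      fix x assume "x \<in> \<phi> ` mverts (Sub k H)"
      then show "x \<in> verts B" unfolding V using inner WB by (auto simp: \<phi>_def)
    next
      fix x assume x: "x \<in> verts B"
      show "x \<in> \<phi> ` mverts (Sub k H)"
      proof (cases "x \<in> W")
        case True
        then show ?thesis unfolding V by (intro image_eqI[of _ _ "Orig x"]) (auto simp: \<phi>_def)
      next
        case False
        obtain s' j where s': "seg_fun k G B W s'" "0 < j" "j < k" "x = s' j" by (rule vertex_in_seg[OF x False])
        obtain e where e: "e < N" "(\<forall>t\<le>k. s' t = q e t) \<or> (\<forall>t\<le>k. s' t = q e (k - t))" using in_q[OF s'(1)] by blast
        then have "x = q e j \<or> x = q e (k - j)" using s' by auto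
        then obtain i where "0 < i" "i < k" "x = q e i" using s' by (metis diff_less zero_less_diff less_trans)
        then show ?thesis unfolding V using e(1) by (intro image_eqI[of _ _ "Inner e i"]) (auto simp: \<phi>_def)
      qed
    qed
  qed
  moreover have "bij_betw (\<lambda>d. \<phi> ` ends (Sub k H) d) (medges (Sub k H)) (edges B)"
  proof -
    have M: "medges (Sub k H) = {..<N} \<times> {..<k}" by (simp add: Sub_def H)
    have im: "\<phi> ` ends (Sub k H) (e, i) = {q e i, q e (Suc i)}" for e i by (simp add: Sub_def sp)
    show ?thesis unfolding M
    proof (rule bij_betw_imageI)
      show "inj_on (\<lambda>d. \<phi> ` ends (Sub k H) d) ({..<N} \<times> {..<k})"
      proof (rule inj_onI)
        fix d d' assume d: "d \<in> {..<N} \<times> {..<k}" "d' \<in> {..<N} \<times> {..<k}"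
          and eq: "\<phi> ` ends (Sub k H) d = \<phi> ` ends (Sub k H) d'"
        obtain e i e' j where dd: "d = (e, i)" "d' = (e', j)" by (metis surj_pair)
        have lt: "e < N" "i < k" "e' < N" "j < k" using d dd by auto
        have eq': "{q e i, q e (Suc i)} = {q e' j, q e' (Suc j)}" using eq by (simp add: dd im)
        note Q = seg_funD[OF q[OF lt(1)]] and Q' = seg_funD[OF q[OF lt(3)]]
        \<comment> \<open>Every edge of a segment has an inner end, since \<open>k > 1\<close>, and
          an inner point determines both its segment and its position.\<close>
        have idx: "e = e' \<and> a = b" if "q e a = q e' b" "0 < a" "a < k" "b \<le> k" for a b
        proof -
          have "q e a \<notin> W" using Q(3) that by blast
          then have "b \<noteq> 0" "b \<noteq> k" using that(1) Q'(1,2) by metis+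
          then show ?thesis using qinj[OF lt(1,3) that(2,3)] that by simp
        qed
        have "e = e' \<and> i = j"
        proof (cases "i = 0")
          case False
          from eq' consider "q e i = q e' j" | "q e i = q e' (Suc j)" "q e (Suc i) = q e' j"
            by (auto simp: doubleton_eq_iff)
          then show ?thesis
          proof cases
            case 1 then show ?thesis using idx[of i j] False lt by simp
          next
            case 2
            then have "e = e'" "i = Suc j" using idx[of i "Suc j"] False lt by auto
            then show ?thesis using 2 Q(6)[of i] lt by auto
          qed
        next
          case True
          have k1: "1 < k" using k by simp
          from eq' consider "q e (Suc i) = q e' j" "q e i = q e' (Suc j)" | "q e (Suc i) = q e' (Suc j)"
            by (auto simp: doubleton_eq_iff)
          then show ?thesis
          proof cases
            case 1
            then have "e = e'" "j = Suc 0" using idx[of "Suc i" j] True lt k1 by auto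
            then show ?thesis using 1 True Q(6)[of 1] k1 by auto
          next
            case 2 then show ?thesis using idx[of "Suc i" "Suc j"] True lt k1 by auto
          qed
        qed
        then show "d = d'" using dd by simp
      qed
      show "(\<lambda>d. \<phi> ` ends (Sub k H) d) ` ({..<N} \<times> {..<k}) = edges B"
      proof (intro equalityI subsetI)
        fix d assume "d \<in> (\<lambda>d. \<phi> ` ends (Sub k H) d) ` ({..<N} \<times> {..<k})"
        then obtain e i where "e < N" "i < k" "d = {q e i, q e (Suc i)}" using im by auto
        then show "d \<in> edges B" using seg_funD(4)[OF q] by simp
      next
        fix d assume d: "d \<in> edges B"
        then have "card d = 2" using wfB by (simp add: wf_sgraph_def)
        then obtain x y where xy: "d = {x, y}" by (auto simp: card_2_iff)
        obtain s' j where s': "seg_fun k G B W s'" "j < k" "{x, y} = {s' j, s' (Suc j)}"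
          using edge_in_seg d xy by metis
        obtain e where e: "e < N" "(\<forall>t\<le>k. s' t = q e t) \<or> (\<forall>t\<le>k. s' t = q e (k - t))" using in_q[OF s'(1)] by blast
        from e(2) have "\<exists>i<k. d = {q e i, q e (Suc i)}"
        proof
          assume "\<forall>t\<le>k. s' t = q e t"
          then show ?thesis using s' xy by (intro exI[of _ j]) simp
        next
          assume a: "\<forall>t\<le>k. s' t = q e (k - t)"
          have "Suc (k - Suc j) = k - j" using s'(2) by simp
          then show ?thesis using a s' xy by (intro exI[of _ "k - Suc j"]) (simp add: insert_commute)
        qed
        then obtain i where "i < k" "d = {q e i, q e (Suc i)}" by blast
        then show "d \<in> (\<lambda>d. \<phi> ` ends (Sub k H) d) ` ({..<N} \<times> {..<k})"
          using e(1) im by (intro image_eqI[of _ _ "(e, i)"]) auto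
      qed
    qed
  qed
  moreover have "\<forall>v\<in>mverts H. \<phi> (Orig v) = v" by (simp add: \<phi>_def)
  ultimately have "is_Sub k H B" unfolding is_Sub_def by blast
  then show thesis using that wfH H(1) by blast
qed

text \<open>A vertex of the path outside \<open>B\<close> lies on an excursion between two vertices
  of \<open>B\<close>, which differ because the path repeats no vertex. Such an excursion is an
  ear.\<close>

lemma path_meets_block_inside:
  assumes xs: "distinct (x # mid @ [y])" "walk G (x # mid @ [y])"
    "set (x # mid @ [y]) \<subseteq> verts G" and x: "x \<in> verts B" and y: "y \<in> verts B"
  shows "set mid \<subseteq> verts B"
proof (rule ccontr)
  assume "\<not> set mid \<subseteq> verts B"
  then obtain v where v: "v \<in> set mid" "v \<notin> verts B" by blast
  then obtain as bs where m: "mid = as @ v # bs" by (auto simp: in_set_conv_decomp)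
  have "\<exists>z\<in>set (x # as). z \<in> verts B" using x by simp
  then obtain as1 b as2 where a: "x # as = as1 @ b # as2" "b \<in> verts B" "\<forall>z\<in>set as2. z \<notin> verts B"
    by (rule split_list_last_propE)
  have "\<exists>z\<in>set (bs @ [y]). z \<in> verts B" using y by simp
  then obtain bs1 b' bs2 where b: "bs @ [y] = bs1 @ b' # bs2" "b' \<in> verts B" "\<forall>z\<in>set bs1. z \<notin> verts B"
    by (rule split_list_first_propE)
  define zs where "zs = as2 @ v # bs1"
  have "x # mid @ [y] = (x # as) @ v # (bs @ [y])" by (simp add: m)
  then have e: "x # mid @ [y] = as1 @ b # zs @ b' # bs2" by (simp add: a(1) b(1) zs_def)
  have zs: "zs \<noteq> []" by (simp add: zs_def)
  have s: "walk G zs" "{b, hd zs} \<in> edges G" "{last zs, b'} \<in> edges G"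
    using xs(2) zs unfolding e by (simp_all add: successively_append_iff successively_Cons hd_append)
  have sub: "set zs \<subseteq> verts G - verts B"
  proof -
    have "set zs \<subseteq> set (x # mid @ [y])" unfolding e by auto
    moreover have "set zs \<inter> verts B = {}" using a(3) b(3) v(2) by (auto simp: zs_def)
    ultimately show ?thesis using xs(3) by blast
  qed
  have "reach G (verts G - verts B) (hd zs) (last zs)"
    by (rule reach_successively[OF s(1) sub]) (use zs in simp_all)
  then have "b = b'" using block_no_ear[OF wf B _ _ a(2) b(2) s(2,3)] sub zs by (metis hd_in_set subsetD)
  then show False using xs(1) unfolding e by simp
qed

text \<open>Between its first and last vertex in \<open>B\<close> the path follows one segment, say
  from position \<open>i\<close> up to position \<open>j\<close>. The parts before and after are
  paths attached at these positions, with fewer than \<open>i\<close> and fewer than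
  \<open>k - j\<close> vertices. This leaves at most \<open>k - 1\<close> vertices
  altogether.\<close>

lemma no_path_through_block:
  assumes xs: "gpath G xs" "length xs = k" "set xs \<inter> W = {}"
  shows "set xs \<inter> verts B = {}"
proof (rule ccontr)
  assume "set xs \<inter> verts B \<noteq> {}"
  then have ex: "\<exists>x\<in>set xs. x \<in> verts B" by blast
  obtain pre x rest where p: "xs = pre @ x # rest" "x \<in> verts B" "\<forall>z\<in>set pre. z \<notin> verts B"
    using ex by (rule split_list_first_propE)
  have "\<exists>z\<in>set (x # rest). z \<in> verts B" using p(2) by simp
  then obtain mid y post where r: "x # rest = mid @ y # post" "y \<in> verts B" "\<forall>z\<in>set post. z \<notin> verts B"
    by (rule split_list_last_propE)
  have X: "xs = pre @ mid @ y # post" using p(1) r(1) by simp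
  have d: "distinct xs" "walk G xs" "set xs \<subseteq> verts G"
    using xs(1) by (simp_all add: gpath_def)
  have "x \<in> set xs" by (simp add: p(1))
  moreover have "y \<in> set xs" by (simp add: X)
  ultimately have xW: "x \<notin> W" "y \<notin> W" using xs(3) by blast+
  have hx: "hang G B x (length pre)"
    unfolding hang_def
  proof (intro exI[of _ "rev pre"] conjI)
    have "walk G (pre @ [x])"
      using d(2) unfolding p(1) by (simp add: successively_append_iff)
    then have "gpath G (pre @ [x])" using d unfolding p(1) by (simp add: gpath_def)
    from gpath_rev[OF this] show "gpath G (x # rev pre)" by simp
  qed (use p(3) in auto)
  have hy: "hang G B y (length post)"
    unfolding hang_def
  proof (intro exI[of _ post] conjI)
    show "gpath G (y # post)" using d unfolding X by (simp add: gpath_def successively_append_iff)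
  qed (use r(3) in auto)
  define L where "L = mid @ [y]"
  have L0: "L ! 0 = x" "L \<noteq> []" using r(1) by (cases mid; simp add: L_def)+
  have LB: "set L \<subseteq> verts B"
  proof (cases mid)
    case Nil then show ?thesis using r(2) by (simp add: L_def)
  next
    case (Cons x' mid')
    then have [simp]: "x' = x" using r(1) by simp
    have "set mid' \<subseteq> verts B"
    proof (rule path_meets_block_inside[OF _ _ _ p(2) r(2)])
      show "distinct (x # mid' @ [y])" using d(1) unfolding X Cons by simp
      show "walk G (x # mid' @ [y])"
      proof -
        have e: "xs = pre @ (x # mid' @ [y]) @ post" unfolding X Cons by simp
        show ?thesis using d(2) unfolding e successively_append_iff[of _ pre]
            successively_append_iff[of _ "x # mid' @ [y]" post] by blast
      qed
      show "set (x # mid' @ [y]) \<subseteq> verts G" using d(3) unfolding X Cons by auto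
    qed
    then show ?thesis using p(2) r(2) Cons by (simp add: L_def)
  qed
  have Ls: "walk G L" "distinct L"
    using d unfolding X L_def by (simp_all add: successively_append_iff successively_Cons)
  have LW: "set L \<inter> W = {}" using xs(3) unfolding X L_def by auto
  obtain s i where s: "seg_fun k G B W s" "0 < i" "i < k" "x = s i" by (rule vertex_in_seg[OF p(2) xW(1)])
  have w: "(\<forall>t\<le>length mid. i + t < k \<and> L ! t = s (i + t)) \<or> (\<forall>t\<le>length mid. t < i \<and> L ! t = s (i - t))"
  proof (rule inner_walk[OF s(1-3)])
    show "L ! 0 = s i" using L0 s(4) by simp
    show "{L ! t, L ! Suc t} \<in> edges B" if "t < length mid" for t
    proof -
      have "t < length L" "Suc t < length L" using that by (simp_all add: L_def)
      then have "{L ! t, L ! Suc t} \<in> edges G" "L ! t \<in> verts B" "L ! Suc t \<in> verts B"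
        using successively_nth[OF Ls(1)] LB nth_mem by blast+
      then show ?thesis using block_edge[OF wf B] by blast
    qed
    show "L ! t \<notin> W" if "t \<le> length mid" for t
    proof -
      have "t < length L" using that by (simp add: L_def)
      then show ?thesis using LW nth_mem by blast
    qed
    show "L ! Suc (Suc t) \<noteq> L ! t" if "Suc t < length mid" for t
      using nth_eq_iff_index_eq[OF Ls(2), of "Suc (Suc t)" t] that by (simp add: L_def)
  qed
  have Ly: "L ! length mid = y" by (simp add: L_def)
  have len: "length pre + length mid + 1 + length post = k" using xs(2) unfolding X by simp
  note D = seg_funD[OF s(1)]
  have px: "length pre < i \<and> length pre < k - i" using D(7)[OF s(2,3)] hx s(4) by simp
  from w show False
  proof
    assume "\<forall>t\<le>length mid. i + t < k \<and> L ! t = s (i + t)"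
    then have j: "i + length mid < k" "y = s (i + length mid)" using Ly by auto
    have "length post < i + length mid \<and> length post < k - (i + length mid)"
      using D(7)[of "i + length mid"] j s(2) hy by simp
    then show False using px len j(1) by linarith
  next
    assume "\<forall>t\<le>length mid. t < i \<and> L ! t = s (i - t)"
    then have j: "length mid < i" "y = s (i - length mid)" using Ly by auto
    have "length post < i - length mid \<and> length post < k - (i - length mid)"
      using D(7)[of "i - length mid"] j s(3) hy by simp
    then show False using px len j(1) s(3) by linarith
  qed
qed

text \<open>A \<open>k\<close>-path in the component avoids \<open>B\<close>, but some connection
  joins it, at \<open>z\<close>, to a vertex \<open>a\<close> of \<open>B\<close> outside
  \<open>W\<close>. Continuing from \<open>z\<close> to either end of the path gives two paths
  attached at \<open>a\<close>. Together they have at least \<open>k + 1\<close> vertices, counted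
  separately, while at position \<open>i\<close> of a segment they may have at most
  \<open>(i - 1) + (k - i - 1)\<close>.\<close>

lemma component_no_path:
  assumes K: "K \<in> components_of (delete_verts G W)" and KB: "verts K \<inter> (verts B - W) \<noteq> {}"
  shows "k_paths k K = {}"
proof (rule ccontr)
  assume "k_paths k K \<noteq> {}"
  then obtain P where "P \<in> k_paths k K" by blast
  then obtain xs where xs: "gpath K xs" "length xs = k" unfolding k_paths_iff by blast
  define F where "F = induced G (verts G - W)"
  have F: "delete_verts G W = F" by (simp add: F_def delete_verts_eq[OF wf])
  have sub: "subgraph K F" "connected_graph K" using component_subgraph[OF K] by (simp_all add: F)
  have wfK: "wf_sgraph K" "verts K \<subseteq> verts G - W" "edges K \<subseteq> edges G"
    using sub(1) by (auto simp: subgraph_def F_def)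
  have con: "reach G (verts G - W) u v" if "u \<in> verts K" "v \<in> verts K" for u v
  proof -
    have "reach K (verts K) u v" using sub(2) that by (simp add: connected_graph_iff[OF wfK(1)])
    then show ?thesis by (rule reach_mono[OF _ wfK(2,3)])
  qed
  have sG: "walk G xs"
    by (rule successively_mono[of "\<lambda>x y. {x, y} \<in> edges K"]) (use xs(1) wfK(3) in \<open>auto simp: gpath_def\<close>)
  have xK: "set xs \<subseteq> verts K" "xs \<noteq> []" "distinct xs" using xs(1) by (simp_all add: gpath_def)
  have gG: "gpath G xs" using sG xK wfK(2) by (auto simp: gpath_def)
  have xW: "set xs \<inter> W = {}" using xK wfK(2) by blast
  have xB: "set xs \<inter> verts B = {}" by (rule no_path_through_block[OF gG xs(2) xW])
  obtain u where u: "u \<in> verts K" "u \<in> verts B" using KB by blast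
  have h: "hd xs \<in> set xs" "hd xs \<in> verts G - W" using xK wfK(2) hd_in_set by blast+
  obtain us a where us: "a \<in> verts B" "a \<in> verts G - W" "distinct (us @ [a])" "set us \<subseteq> verts G - W - verts B"
    "walk G (us @ [a])" "hd (us @ [a]) = hd xs"
    by (rule reach_first_hit[OF con[of "hd xs" u] h(2) u(2)]) (use h xK u in blast)+
  \<comment> \<open>\<open>a\<close> is the only vertex of \<open>B\<close> in \<open>Z\<close>, so
    the connection found in \<open>Z\<close> has no further vertex in the block.\<close>
  define Z where "Z = insert a (verts G - W - verts B)"
  have hdin: "hd xs \<in> set (us @ [a])" using us(6) hd_in_set[of "us @ [a]"] by simp
  have "reach G Z a (hd xs)"
  proof (rule reach_successively[OF us(5)])
    show "set (us @ [a]) \<subseteq> Z" using us(4) by (auto simp: Z_def)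
  qed (use hdin in auto)
  then obtain ws z where ws: "z \<in> set xs" "z \<in> Z" "distinct (ws @ [z])" "set ws \<subseteq> Z - set xs"
    "walk G (ws @ [z])" "hd (ws @ [z]) = a"
    by (rule reach_first_hit[OF _ _ h(1)]) (simp_all add: Z_def)
  have az: "a \<noteq> z" using ws(1) us(1) xB by blast
  then obtain ws' where w': "ws = a # ws'" using ws(6) by (cases ws) auto
  have w'B: "set ws' \<inter> verts B = {}" using ws(3,4) unfolding w' Z_def by auto
  obtain pre post where sp: "xs = pre @ z # post" using ws(1) by (auto simp: in_set_conv_decomp)
  have sV: "set xs \<subseteq> verts G" "set ws \<subseteq> verts G" using xK wfK(2) ws(4) us(2) by (auto simp: Z_def)
  have g1: "hang G B a (length ws' + 1 + length post)"
    unfolding hang_def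
  proof (intro exI[of _ "ws' @ z # post"] conjI)
    have s1: "walk G (z # post)"
      using sG unfolding sp by (simp add: successively_append_iff)
    have "walk G (ws @ z # post)"
      using ws(5) s1 by (simp add: successively_append_iff successively_Cons)
    moreover have "distinct (ws @ z # post)" using ws(3,4) xK(3) unfolding sp by auto
    ultimately show "gpath G (a # ws' @ z # post)" using sV unfolding w' sp by (auto simp: gpath_def)
    show "set (ws' @ z # post) \<inter> verts B = {}" using w'B xB unfolding sp by auto
  qed simp
  have g2: "hang G B a (length ws' + 1 + length pre)"
    unfolding hang_def
  proof (intro exI[of _ "ws' @ z # rev pre"] conjI)
    have "walk G (pre @ [z])"
      using sG unfolding sp by (simp add: successively_append_iff)
    then have "walk G (rev (pre @ [z]))"
      unfolding successively_rev by (simp add: insert_commute)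
    then have s1: "walk G (z # rev pre)" by simp
    have "walk G (ws @ z # rev pre)"
      using ws(5) s1 by (simp add: successively_append_iff successively_Cons)
    moreover have "distinct (ws @ z # rev pre)" using ws(3,4) xK(3) unfolding sp by auto
    ultimately show "gpath G (a # ws' @ z # rev pre)" using sV unfolding w' sp by (auto simp: gpath_def)
    show "set (ws' @ z # rev pre) \<inter> verts B = {}" using w'B xB unfolding sp by auto
  qed simp
  have aW: "a \<notin> W" using us(2) by blast
  obtain s i where s: "seg_fun k G B W s" "0 < i" "i < k" "a = s i" by (rule vertex_in_seg[OF us(1) aW])
  note D7 = seg_funD(7)[OF s(1-3)]
  have "length ws' + 1 + length post < i \<and> length ws' + 1 + length post < k - i" using D7 g1 s(4) by simp
  moreover have "length ws' + 1 + length pre < i \<and> length ws' + 1 + length pre < k - i" using D7 g2 s(4) by simp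
  moreover have "length pre + 1 + length post = k" using xs(2) unfolding sp by simp
  ultimately show False using s(3) by linarith
qed

text \<open>The order of a cycle is a positive multiple of \<open>k\<close>, so a cycle in the
  component would contain a \<open>k\<close>-path.\<close>

lemma component_is_tree:
  assumes cyc: "\<And>m c. icyc G m c \<Longrightarrow> int k dvd m"
    and K: "K \<in> components_of (delete_verts G W)" and KB: "verts K \<inter> (verts B - W) \<noteq> {}"
  shows "is_tree K"
proof -
  have sub: "subgraph K (delete_verts G W)" "connected_graph K" using component_subgraph[OF K] by simp_all
  have wfK: "wf_sgraph K" "edges K \<subseteq> edges G" using sub(1) by (auto simp: subgraph_def delete_verts_def)
  have "\<not> (is_cycle C \<and> subgraph C K)" for C
  proof
    assume C: "is_cycle C \<and> subgraph C K"
    obtain c where c: "icyc K (int (order C)) c" using is_cycle_imp_icyc C by metis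
    have "int k dvd int (order C)" by (rule cyc[OF icyc_mono[OF c wfK(2)]])
    then have km: "int k \<le> int (order C)" using icycD(1)[OF c] by (intro zdvd_imp_le) auto
    have k0: "0 < k" using k by simp
    obtain xs where "gpath K xs" "length xs = k" by (rule kpath_setsE[OF icyc_window_kpath[OF wfK(1) c k0 km, of 0]])
    then have "\<lparr>verts = set xs, edges = path_edges xs\<rparr> \<in> k_paths k K" unfolding k_paths_iff by blast
    then show False using component_no_path[OF K KB] by blast
  qed
  then show ?thesis using sub(2) by (auto simp: is_tree_def)
qed

end

section \<open>The choice of \<open>W\<close> in a block\<close>

context konig_block
begin

text \<open>Only residues modulo \<open>k\<close> matter, so for each residue a longest attached
  path is kept, at one position \<open>pos\<close> of the cycle that realises it. After truncation,
  the class \<open>t\<close> that these paths permit lies in none of the truncated balls, although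
  they cover all integers.\<close>

lemma cycle_choose_class:
  assumes c: "icyc B m c"
  obtains b where "\<forall>a r d. hang G B (c a) r \<and> 1 \<le> d \<and> d \<le> int r \<and> 2 * d < int k \<longrightarrow>
    \<not> int k dvd a + d - b \<and> \<not> int k dvd a - d - b"
proof (rule ccontr)
  assume "\<not> thesis"
  then have none: "\<exists>a r d. hang G B (c a) r \<and> 1 \<le> d \<and> d \<le> int r \<and> 2 * d < int k \<and>
    (int k dvd a + d - b \<or> int k dvd a - d - b)" for b
    using that[of b] by blast
  have cG: "icyc G m c" by (rule cycG[OF c])
  have cB: "range c \<subseteq> verts B" by (rule icyc_verts[OF wfB c])
  have k0: "int k > 0" using k by simp
  have km: "int k \<le> m" by (rule k_le_cycle[OF cG])
  have dm: "int k dvd m" by (rule cyc[OF cG])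
  \<comment> \<open>The cap \<open>k div 2\<close> loses nothing, as only \<open>d\<close> with
    \<open>2 * d < k\<close> are considered, and it yields the radius bound of
    \<open>punctured_cover_truncation\<close>.\<close>
  define R where "R x = {r. r \<le> k div 2 \<and> hang G B x r}" for x
  have finR: "finite (R x)" for x by (rule finite_subset[of _ "{..k div 2}"]) (auto simp: R_def)
  define h where "h x = Max (R x)" for x
  have R0: "0 \<in> R (c a)" for a
  proof -
    have "c a \<in> verts G" using cB blocksD(4)[OF B] by blast
    then have "hang G B (c a) 0" by (simp add: hang_def gpath_def)
    then show ?thesis by (simp add: R_def)
  qed
  have hR: "h (c a) \<in> R (c a)" for a unfolding h_def using finR R0[of a] by (intro Max_in) auto
  have hge: "r \<le> h x" if "r \<in> R x" for r x unfolding h_def using finR that by (intro Max_ge)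
  define I where "I \<rho> = {a \<in> {0..<m}. int k dvd a - \<rho>}" for \<rho>
  have finI: "finite (I \<rho>)" for \<rho> by (rule finite_subset[of _ "{0..<m}"]) (auto simp: I_def)
  have I0: "I \<rho> \<noteq> {}" for \<rho>
  proof -
    have "int k dvd \<rho> mod int k - \<rho>" by (metis dvd_minus_iff dvd_minus_mod minus_diff_eq)
    moreover have "0 \<le> \<rho> mod int k" using k0 by simp
    moreover have "\<rho> mod int k < m" using km pos_mod_bound[OF k0, of \<rho>] by linarith
    ultimately have "\<rho> mod int k \<in> I \<rho>" by (simp add: I_def)
    then show ?thesis by blast
  qed
  define hh where "hh \<rho> = Max ((\<lambda>a. int (h (c a))) ` I \<rho>)" for \<rho>
  have hhin: "hh \<rho> \<in> (\<lambda>a. int (h (c a))) ` I \<rho>" for \<rho>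
    unfolding hh_def using finI I0 by (intro Max_in) auto
  have hhge: "int (h (c a)) \<le> hh \<rho>" if "int k dvd a - \<rho>" for a \<rho>
  proof -
    have m0: "0 < m" using km k0 by simp
    have "m dvd a mod m - a" by (metis dvd_minus_iff dvd_minus_mod minus_diff_eq)
    then have "int k dvd (a mod m - a) + (a - \<rho>)" using dm that by (intro dvd_add) (auto intro: dvd_trans)
    then have "a mod m \<in> I \<rho>" using m0 by (simp add: I_def)
    then have "int (h (c (a mod m))) \<le> hh \<rho>" unfolding hh_def using finI by (intro Max_ge) auto
    then show ?thesis by (simp only: icyc_mod[OF c])
  qed
  have hper: "hh (\<rho> + int k) = hh \<rho>" for \<rho>
  proof -
    have "int k dvd a - (\<rho> + int k) \<longleftrightarrow> int k dvd a - \<rho>" for a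
    proof -
      have "a - \<rho> = (a - (\<rho> + int k)) + int k" by simp
      then show ?thesis using dvd_add_left_iff[of "int k" "int k" "a - (\<rho> + int k)"] by (metis dvd_refl)
    qed
    then have "I (\<rho> + int k) = I \<rho>" unfolding I_def by simp
    then show ?thesis by (simp add: hh_def)
  qed
  have hpos: "0 \<le> hh \<rho> \<and> 2 * hh \<rho> < int k" for \<rho>
  proof -
    obtain a where a: "hh \<rho> = int (h (c a))" using hhin[of \<rho>] by blast
    have "h (c a) \<le> k div 2" using hR[of a] by (simp add: R_def)
    then have "2 * h (c a) < k" using k2 by linarith
    then show ?thesis unfolding a by simp
  qed
  have hcov: "\<exists>x. p \<in> punctured_ball hh x" for p
  proof -
    obtain a r d where d: "hang G B (c a) r" "1 \<le> d" "d \<le> int r" "2 * d < int k"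
      "int k dvd a + d - p \<or> int k dvd a - d - p" using none[of p] by blast
    have "hang G B (c a) (nat d)" by (rule hang_mono[OF d(1)]) (use d(3) in simp)
    then have "nat d \<in> R (c a)" using d(4) by (auto simp: R_def)
    then have "nat d \<le> h (c a)" by (rule hge)
    then have dh: "d \<le> int (h (c a))" using d(2) by simp
    from d(5) show ?thesis
    proof
      assume "int k dvd a + d - p"
      then have "int k dvd a - (p - d)" by (simp add: algebra_simps)
      then have "d \<le> hh (p - d)" using hhge dh by (meson order_trans)
      then show ?thesis using d(2) by (intro exI[of _ "p - d"]) (simp add: punctured_ball_def)
    next
      assume "int k dvd a - d - p"
      then have "int k dvd a - (p + d)" by (simp add: algebra_simps)
      then have "d \<le> hh (p + d)" using hhge dh by (meson order_trans)
      then show ?thesis using d(2) by (intro exI[of _ "p + d"]) (simp add: punctured_ball_def)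
    qed
  qed
  obtain r where rper: "\<And>x. r (x + int k) = r x" and rnn: "\<And>x. 0 \<le> r x" and rh: "\<And>x. r x \<le> hh x"
    and rcov: "\<And>p. \<exists>x. p \<in> punctured_ball r x" and rsum: "(\<Sum>x\<in>{0..<int k}. r x) < int k"
    using punctured_cover_truncation[of "int k" hh] k0 hper hpos hcov by metis
  have "\<forall>\<rho>. \<exists>a. a \<in> I \<rho> \<and> hh \<rho> = int (h (c a))" using hhin by blast
  from choice[OF this] obtain pos where pos: "\<And>\<rho>. pos \<rho> \<in> I \<rho>" "\<And>\<rho>. hh \<rho> = int (h (c (pos \<rho>)))" by blast
  have posm: "0 \<le> pos \<rho>" "pos \<rho> < m" "int k dvd pos \<rho> - \<rho>" for \<rho> using pos(1)[of \<rho>] by (simp_all add: I_def)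
  have posmod: "pos \<rho> mod int k = \<rho>" if "0 \<le> \<rho>" "\<rho> < int k" for \<rho>
    using posm(3)[of \<rho>] that by (simp add: mod_eq_dvd_iff[symmetric])
  have "\<forall>\<rho>. \<exists>ys. length ys = nat (r \<rho>) \<and> gpath G (c (pos \<rho>) # ys) \<and> set ys \<inter> verts B = {}"
  proof
    fix \<rho>
    have "hang G B (c (pos \<rho>)) (h (c (pos \<rho>)))" using hR by (simp add: R_def)
    moreover have "nat (r \<rho>) \<le> h (c (pos \<rho>))" using rh[of \<rho>] pos(2)[of \<rho>] by simp
    ultimately have "hang G B (c (pos \<rho>)) (nat (r \<rho>))" by (rule hang_mono)
    then show "\<exists>ys. length ys = nat (r \<rho>) \<and> gpath G (c (pos \<rho>) # ys) \<and> set ys \<inter> verts B = {}"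
      by (simp add: hang_def)
  qed
  from choice[OF this] obtain Y where Y: "\<And>\<rho>. length (Y \<rho>) = nat (r \<rho>)"
    "\<And>\<rho>. gpath G (c (pos \<rho>) # Y \<rho>)" "\<And>\<rho>. set (Y \<rho>) \<inter> verts B = {}" by blast
  define A where "A = pos ` {0..<int k}"
  define ys where "ys a = Y (a mod int k)" for a
  have Ain: "\<exists>\<rho>. a = pos \<rho> \<and> ys a = Y \<rho>" if "a \<in> A" for a
    using that posmod by (auto simp: A_def ys_def)
  obtain t where t: "\<forall>a\<in>A. \<forall>d. 1 \<le> d \<and> d \<le> int (length (ys a)) \<longrightarrow>
      \<not> int k dvd a + d - t \<and> \<not> int k dvd a - d - t"
  proof (rule pendants_class[OF cG, of A ys])
    show "finite A" by (simp add: A_def)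
    show "gpath G (c a # ys a)" if "a \<in> A" for a using Ain[OF that] Y(2) by auto
    show "set (ys a) \<inter> range c = {}" for a using Y(3)[of "a mod int k"] cB by (auto simp: ys_def)
    show "set (ys a) \<inter> set (ys b) = {}" if ab: "a \<in> A" "b \<in> A" "a \<noteq> b" for a b
    proof (rule hangs_disjoint)
      show "c a \<in> verts B" "c b \<in> verts B" using cB by auto
      have "a \<in> {0..<0 + m}" "b \<in> {0..<0 + m}" using ab(1,2) posm by (auto simp: A_def)
      then show "c a \<noteq> c b" using inj_onD[OF icyc_inj[OF c, of 0]] ab(3) by blast
      show "gpath G (c a # ys a)" "gpath G (c b # ys b)" using Ain[OF ab(1)] Ain[OF ab(2)] Y(2) by auto
      show "set (ys a) \<inter> verts B = {}" "set (ys b) \<inter> verts B = {}" using Y(3) by (simp_all add: ys_def)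
    qed
    have "inj_on pos {0..<int k}" by (rule inj_on_inverseI[of _ "\<lambda>a. a mod int k"]) (use posmod in simp)
    then have "(\<Sum>a\<in>A. length (ys a)) = (\<Sum>\<rho>\<in>{0..<int k}. length (ys (pos \<rho>)))"
      unfolding A_def by (simp add: sum.reindex)
    also have "\<dots> = (\<Sum>\<rho>\<in>{0..<int k}. nat (r \<rho>))"
      by (rule sum.cong) (simp_all add: ys_def posmod Y(1))
    finally have "int (\<Sum>a\<in>A. length (ys a)) = (\<Sum>\<rho>\<in>{0..<int k}. r \<rho>)" using rnn by simp
    then show "(\<Sum>a\<in>A. length (ys a)) < k" using rsum by linarith
  qed
  obtain x where x: "t \<in> punctured_ball r x" using rcov by blast
  define \<rho> where "\<rho> = x mod int k"
  have rho: "0 \<le> \<rho>" "\<rho> < int k" using k0 by (simp_all add: \<rho>_def)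
  have rr: "r \<rho> = r x" unfolding \<rho>_def by (rule periodic_mod[of r, OF rper])
  define d where "d = \<bar>t - x\<bar>"
  have d: "1 \<le> d" "d \<le> r \<rho>" using x rr by (auto simp: punctured_ball_def d_def)
  have pA: "pos \<rho> \<in> A" using rho by (simp add: A_def)
  have "int (length (ys (pos \<rho>))) = r \<rho>" using rnn by (simp add: ys_def posmod[OF rho] Y(1))
  then have nd: "\<not> int k dvd pos \<rho> + d - t \<and> \<not> int k dvd pos \<rho> - d - t" using t pA d by auto
  have "int k dvd x mod int k - x" by (metis dvd_minus_iff dvd_minus_mod minus_diff_eq)
  then have "int k dvd (pos \<rho> - \<rho>) + (\<rho> - x)" using posm(3) unfolding \<rho>_def by (intro dvd_add)
  then have dv: "int k dvd pos \<rho> - x" by simp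
  have "t = x + d \<or> t = x - d" by (auto simp: d_def)
  then show False
  proof
    assume "t = x + d" then show False using nd dv by simp
  next
    assume "t = x - d" then show False using nd dv by simp
  qed
qed

lemma good_of_cycle_block:
  assumes c: "icyc B m c" and nb: "\<And>i. \<not> branching B (c i)"
  shows "\<exists>W. good k G B W"
proof -
  obtain b where b: "\<forall>a r d. hang G B (c a) r \<and> 1 \<le> d \<and> d \<le> int r \<and> 2 * d < int k \<longrightarrow>
    \<not> int k dvd a + d - b \<and> \<not> int k dvd a - d - b" by (rule cycle_choose_class[OF c])
  define W where "W = c ` {i. int k dvd i - b}"
  have dm: "int k dvd m" by (rule cyc[OF cycG[OF c]])
  have W: "c i \<in> W \<longleftrightarrow> int k dvd i - b" for i
  proof
    assume "c i \<in> W"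
    then obtain j where j: "int k dvd j - b" "c i = c j" unfolding W_def by blast
    have "m dvd i - j" using icycD(2)[OF c] j(2) by blast
    then have "int k dvd (i - j) + (j - b)" using j(1) dm by (intro dvd_add) (auto intro: dvd_trans)
    then show "int k dvd i - b" by simp
  qed (auto simp: W_def)
  have cc: "class_cycle k G B W c b" unfolding class_cycle_def using c dm W b by blast
  have "good k G B W" unfolding good_def
  proof (intro conjI ballI allI impI)
    show "W \<subseteq> verts B" using icyc_verts[OF wfB c] unfolding W_def by blast
    show "\<not> branching B v" for v by (rule cycle_branch_or_all(3)[OF c nb])
    fix x y assume "{x, y} \<in> edges B"
    then obtain l where "{x, y} = {c l, c (l + 1)}" using cycle_branch_or_all(2)[OF c nb] by blast
    then show "\<exists>c b l. class_cycle k G B W c b \<and> {x, y} = {c l, c (l + 1)}" using cc by blast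
  qed
  then show ?thesis by blast
qed

text \<open>At a vertex that is not branching, the next vertex of a cycle is determined by the
  previous one.\<close>

lemma follow_cycle:
  assumes c: "icyc B m c" "icyc B m' c'" and eq: "c 0 = c' 0" "c 1 = c' 1"
    and nb: "\<And>j. 0 < j \<Longrightarrow> j < N \<Longrightarrow> \<not> branching B (c (int j))"
  shows "j < N \<Longrightarrow> c (int j) = c' (int j) \<and> c (int j + 1) = c' (int j + 1)"
proof (induction j)
  case 0
  then show ?case using eq by simp
next
  case (Suc j)
  have IH: "c (int j) = c' (int j)" "c (int j + 1) = c' (int j + 1)" using Suc by simp_all
  have e: "int (Suc j) = int j + 1" by simp
  have "{c' (int j + 1), c' (int j + 1 + 1)} \<in> edges B" by (rule icycD(3)[OF c(2)])
  then have "{c (int j + 1), c' (int j + 1 + 1)} \<in> edges B" using IH by simp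
  moreover have "\<not> branching B (c (int j + 1))" using nb[of "Suc j"] Suc.prems unfolding e by simp
  ultimately have "c' (int j + 1 + 1) = c (int j + 1 - 1) \<or> c' (int j + 1 + 1) = c (int j + 1 + 1)"
    by (intro not_branching_cycle[OF c(1)])
  moreover have "c' (int j + 1 + 1) \<noteq> c' (int j + 1 - 1)" using icyc_neighbours_ne(1)[OF c(2), of "int j + 1"] by metis
  ultimately show ?case unfolding e using IH by simp
qed

text \<open>This makes membership in \<open>W\<close> independent of the cycle chosen through a
  vertex. Up to the first branch vertex of \<open>c\<close>, at index \<open>N\<close>, the cycle
  \<open>c'\<close> follows \<open>c\<close> forwards or backwards and so has the same branch vertex
  at \<open>N\<close> or \<open>- N\<close>. By \<open>branch_congruent\<close>, \<open>N\<close> is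
  a multiple of \<open>k\<close>.\<close>

lemma branch_transfer:
  assumes c: "icyc B m c" "icyc B m' c'" and eq: "c 0 = c' 0" and br: "branching B (c (int k * t))"
  shows "\<exists>t'. branching B (c' (int k * t'))"
proof -
  have dm: "int k dvd m" by (rule cyc[OF cycG[OF c(1)]])
  have m3: "3 \<le> m" by (rule icycD(1)[OF c(1)])
  have "\<exists>N::nat. branching B (c (int N))"
  proof -
    \<comment> \<open>A multiple of the period is added to make the index non-negative.\<close>
    define N where "N = nat (int k * t + m * \<bar>int k * t\<bar>)"
    have "\<bar>int k * t\<bar> \<le> m * \<bar>int k * t\<bar>" using m3 by (simp add: mult_le_cancel_right1)
    then have N: "int N = int k * t + m * \<bar>int k * t\<bar>" unfolding N_def by linarith
    have "c (int N) = c (int k * t)" unfolding icycD(2)[OF c(1)] N by simp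
    then show ?thesis using br by metis
  qed
  then obtain N where N: "branching B (c (int N))" and least: "\<And>j. j < N \<Longrightarrow> \<not> branching B (c (int j))"
    using exists_least_iff[of "\<lambda>N. branching B (c (int N))"] by blast
  have "int k dvd int N - int k * t" by (rule branch_congruent[OF c(1) N br])
  then have "int k dvd (int N - int k * t) + int k * t" by (intro dvd_add) simp_all
  then have "int k dvd int N" by simp
  then obtain u where u: "int N = int k * u" by (elim dvdE)
  show ?thesis
  proof (cases "N = 0")
    case True
    then have "branching B (c' (int k * 0))" using N eq by simp
    then show ?thesis by blast
  next
    case False
    have nb0: "\<not> branching B (c 0)" using least[of 0] False by simp
    have N1: "N - 1 < N" "int (N - 1) + 1 = int N" using False by simp_all
    have e1: "{c 0, c' 1} \<in> edges B" using icycD(3)[OF c(2), of 0] eq by simp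
    have e2: "{c 0, c' (-1)} \<in> edges B" using icycD(4)[OF c(2), of 0] eq by (simp add: insert_commute)
    have ne: "c' (-1) \<noteq> c' 1" using icyc_neighbours_ne(1)[OF c(2), of 0] by simp
    have o1: "c' 1 = c (-1) \<or> c' 1 = c 1" using not_branching_cycle[OF c(1) nb0 e1] by simp
    have o2: "c' (-1) = c (-1) \<or> c' (-1) = c 1" using not_branching_cycle[OF c(1) nb0 e2] by simp
    show ?thesis
    proof (cases "c' 1 = c 1")
      case True
      have "c (int (N - 1) + 1) = c' (int (N - 1) + 1)"
        using follow_cycle[OF c eq True[symmetric] least N1(1)] by blast
      then have "branching B (c' (int k * u))" using N N1(2) u by simp
      then show ?thesis by blast
    next
      case False
      then have r: "c (-1) = c' 1" "c 1 = c' (-1)" using o1 o2 ne by auto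
      have "c (int (N - 1) + 1) = c' (- (int (N - 1) + 1))"
        using follow_cycle[OF c(1) icyc_rev[OF c(2)], of N "N - 1"] eq r(2) least N1(1) by simp
      then have "branching B (c' (int k * (- u)))" using N N1(2) u by simp
      then show ?thesis by blast
    qed
  qed
qed

text \<open>An ear at \<open>c b\<close> cut down to \<open>k div 2\<close> vertices and
  \<open>d\<close> vertices of the path at \<open>c a\<close> have fewer than \<open>k\<close>
  vertices together; they are disjoint, as one lies inside the block and the other outside. The ear
  forces the class of \<open>b\<close>, and the path excludes the classes at distance
  \<open>d\<close> from \<open>a\<close>.\<close>

lemma branch_hang_class:
  assumes c: "icyc B m c" and br: "branching B (c b)"
    and h: "hang G B (c a) r" "1 \<le> d" "d \<le> int r" "2 * d < int k"
  shows "\<not> int k dvd a + d - b \<and> \<not> int k dvd a - d - b"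
proof (cases "c a = c b")
  case True
  have dv: "int k dvd a - b" using icycD(2)[OF c] True cyc[OF cycG[OF c]] dvd_trans by blast
  have nd: "\<not> int k dvd d" using h zdvd_imp_le[of "int k" d] by auto
  have "int k dvd d" if "int k dvd a + d - b"
  proof -
    have "int k dvd (a + d - b) - (a - b)" by (rule dvd_diff[OF that dv])
    then show ?thesis by simp
  qed
  moreover have "int k dvd d" if "int k dvd a - d - b"
  proof -
    have "int k dvd (a - b) - (a - d - b)" by (rule dvd_diff[OF dv that])
    then show ?thesis by simp
  qed
  ultimately show ?thesis using nd by blast
next
  case False
  have cG: "icyc G m c" by (rule cycG[OF c])
  have cB: "range c \<subseteq> verts B" by (rule icyc_verts[OF wfB c])
  obtain us where us: "gpath G (c b # us)" "set us \<inter> range c = {}" "set us \<subseteq> verts B" "k - 1 \<le> length us"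
    by (rule branch_ear[OF c br])
  have "hang G B (c a) (nat d)" by (rule hang_mono[OF h(1)]) (use h(3) in simp)
  then obtain vs where vs: "length vs = nat d" "gpath G (c a # vs)" "set vs \<inter> verts B = {}"
    unfolding hang_def by blast
  define l where "l = k div 2"
  have l: "l \<le> length us" "nat d \<le> l" "2 * l < k" using us(4) k k2 h(4) by (auto simp: l_def)
  define ys where "ys x = (if x = b then take l us else vs)" for x
  have ab: "a \<noteq> b" using False by auto
  have tk: "set (take l us) \<subseteq> set us" by (rule set_take_subset)
  have ly: "length (ys b) = l" "length (ys a) = nat d" using l vs(1) ab by (simp_all add: ys_def)
  obtain t where t: "\<forall>x\<in>{b, a}. \<forall>d. 1 \<le> d \<and> d \<le> int (length (ys x)) \<longrightarrow>
      \<not> int k dvd x + d - t \<and> \<not> int k dvd x - d - t"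
  proof (rule pendants_class[OF cG, of "{b, a}" ys])
    show "gpath G (c x # ys x)" if "x \<in> {b, a}" for x
      using that gpath_take[OF us(1)] vs(2) ab by (auto simp: ys_def)
    show "set (ys x) \<inter> range c = {}" for x using us(2) vs(3) tk cB by (auto simp: ys_def)
    show "set (ys x) \<inter> set (ys y) = {}" if "x \<in> {b, a}" "y \<in> {b, a}" "x \<noteq> y" for x y
      using that us(3) vs(3) tk ab by (auto simp: ys_def)
    show "(\<Sum>x\<in>{b, a}. length (ys x)) < k" using ab l by (simp add: ly)
  qed simp
  have bt: "int k dvd b - t" using t ly(1) unfolding l_def by (intro long_pendant_class) simp
  have nt: "\<not> int k dvd a + d - t \<and> \<not> int k dvd a - d - t" using t ly(2) h(2) by auto
  have "int k dvd a + d - t" if "int k dvd a + d - b"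
  proof -
    have "int k dvd (a + d - b) + (b - t)" by (rule dvd_add[OF that bt])
    then show ?thesis by (simp add: algebra_simps)
  qed
  moreover have "int k dvd a - d - t" if "int k dvd a - d - b"
  proof -
    have "int k dvd (a - d - b) + (b - t)" by (rule dvd_add[OF that bt])
    then show ?thesis by (simp add: algebra_simps)
  qed
  ultimately show ?thesis using nt by blast
qed

lemma good_of_branching_block:
  assumes all: "\<And>m c. icyc B m c \<Longrightarrow> \<exists>i. branching B (c i)"
  shows "\<exists>W. good k G B W"
proof -
  \<comment> \<open>The vertices at a distance divisible by \<open>k\<close> from a branch vertex
    along some cycle. A branch vertex belongs to \<open>W\<close> with \<open>t = 0\<close>, since
    each of its edges lies on a cycle.\<close>
  define W where "W = {v. \<exists>m c t. icyc B m c \<and> c 0 = v \<and> branching B (c (int k * t))}"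
  have Wc: "c i \<in> W \<longleftrightarrow> (\<exists>t. branching B (c (i + int k * t)))" if c: "icyc B m c" for m c i
  proof
    assume "c i \<in> W"
    then obtain m' c' t where w: "icyc B m' c'" "c' 0 = c i" "branching B (c' (int k * t))"
      unfolding W_def by blast
    have "\<exists>t'. branching B ((\<lambda>j. c (j + i)) (int k * t'))"
      by (rule branch_transfer[OF w(1) icyc_shift[OF c] _ w(3)]) (simp add: w(2))
    then show "\<exists>t. branching B (c (i + int k * t))" by (simp add: add.commute)
  next
    assume "\<exists>t. branching B (c (i + int k * t))"
    then obtain t where "branching B (c (int k * t + i))" by (auto simp: add.commute)
    then show "c i \<in> W" unfolding W_def using icyc_shift[OF c, of i]
      by (intro CollectI exI[of _ m] exI[of _ "\<lambda>j. c (j + i)"] exI[of _ t]) simp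
  qed
  have cc: "\<exists>b. class_cycle k G B W c b" if c: "icyc B m c" for m c
  proof -
    obtain b where b: "branching B (c b)" using all[OF c] by blast
    have "c i \<in> W \<longleftrightarrow> int k dvd i - b" for i
    proof
      assume "c i \<in> W"
      then obtain t where "branching B (c (i + int k * t))" using Wc[OF c] by blast
      from branch_congruent[OF c this b] have "int k dvd (i + int k * t - b) - int k * t" by (rule dvd_diff) simp
      then show "int k dvd i - b" by simp
    next
      assume "int k dvd i - b"
      then obtain u where "i - b = int k * u" by (elim dvdE)
      then have "i + int k * (- u) = b" by simp
      then have "branching B (c (i + int k * (- u)))" using b by (simp only:)
      then show "c i \<in> W" using Wc[OF c] by blast
    qed
    moreover have "int k dvd m" by (rule cyc[OF cycG[OF c]])
    ultimately have "class_cycle k G B W c b"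
      unfolding class_cycle_def using c branch_hang_class[OF c b] by blast
    then show ?thesis by blast
  qed
  have "W \<subseteq> verts B"
  proof
    fix v assume "v \<in> W"
    then obtain m c where "icyc B m c" "c 0 = v" unfolding W_def by blast
    then show "v \<in> verts B" using icyc_verts[OF wfB, of m c] by blast
  qed
  moreover have "\<not> branching B v" if v: "v \<in> verts B - W" for v
  proof
    assume br: "branching B v"
    then obtain x where "{v, x} \<in> edges B" unfolding branching_def by blast
    then obtain m c where c: "icyc B m c" "c 0 = v"
      using nonsep_edge_on_cycle[OF wfB blocksD(3)[OF B] nontriv] by metis
    have "branching B (c (int k * 0))" using br c(2) by simp
    then have "v \<in> W" unfolding W_def using c by blast
    then show False using v by blast
  qed
  moreover have "\<exists>c b l. class_cycle k G B W c b \<and> {x, y} = {c l, c (l + 1)}" if e: "{x, y} \<in> edges B" for x y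
  proof -
    obtain m c where c: "icyc B m c" "c 0 = x" "c 1 = y"
      by (rule nonsep_edge_on_cycle[OF wfB blocksD(3)[OF B] nontriv e])
    obtain b where "class_cycle k G B W c b" using cc[OF c(1)] by blast
    then show ?thesis using c(2,3) by (intro exI[of _ c] exI[of _ b] exI[of _ 0]) simp
  qed
  ultimately have "good k G B W" unfolding good_def by blast
  then show ?thesis by blast
qed

text \<open>A cycle without branch vertices is the whole block; otherwise every cycle of the block
  has one.\<close>

lemma exists_good: "\<exists>W. good k G B W"
proof (cases "\<exists>m c. icyc B m c \<and> (\<forall>i. \<not> branching B (c i))")
  case True
  then obtain m c where "icyc B m c" "\<forall>i. \<not> branching B (c i)" by blast
  then show ?thesis by (intro good_of_cycle_block) auto
next
  case False
  then show ?thesis by (intro good_of_branching_block) blast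
qed

end

theorem konig_class_subset:
  fixes G :: "'a sgraph"
  assumes k: "k \<ge> 3" "odd k" and G: "G \<in> \<G>' k" shows "G \<in> \<H>' k"
proof -
  have wf: "wf_sgraph G" using G by (simp add: \<G>'_def)
  have k0: "k > 0" using k by simp
  have konig: "konig k G X" if "X \<subseteq> verts G" for X
  proof -
    have "\<forall>F. induced_subgraph F G \<longrightarrow> nu k F = tau k F" using G by (simp add: \<G>'_def)
    then show ?thesis unfolding konig_all_iff[OF k0 wf] using that by blast
  qed
  have cyc: "int k dvd m" if c: "icyc G m c" for m c
  proof -
    obtain C where C: "is_cycle C" "subgraph C G" "int (order C) = m" by (rule icyc_imp_is_cycle[OF wf c])
    then have "\<not> order C < k" using G unfolding \<G>'_def by blast
    then have "int k \<le> m" using C(3) by simp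
    then show ?thesis by (rule cycle_length_dvd[OF wf c k0 _ konig[OF icyc_verts[OF wf c]]])
  qed
  have "\<exists>H :: ('a, nat) multigraph. wf_multigraph H \<and> is_Sub k H B \<and>
        (\<forall>K \<in> components_of (delete_verts G (mverts H)).
            verts K \<inter> (verts B - mverts H) \<noteq> {} \<longrightarrow> is_tree K \<and> k_paths k K = {})"
    if B: "B \<in> blocks G" "\<not> trivial_block B" for B
  proof -
    have card: "3 \<le> card (verts B)" by (rule nontrivial_block_card[OF B])
    interpret konig_block k G B
      by unfold_locales (use k wf konig cyc B card in auto)
    obtain W where W: "good k G B W" using exists_good by blast
    interpret good_block k G B W
      by unfold_locales (use k wf B card W in auto)
    obtain H :: "('a, nat) multigraph" where H: "wf_multigraph H" "is_Sub k H B" "mverts H = W"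
      by (rule exists_subdivision)
    show ?thesis using H component_is_tree[OF cyc] component_no_path by (intro exI[of _ H]) simp
  qed
  then show ?thesis using wf unfolding \<H>'_def by simp
qed

section \<open>The case \<open>k = 1\<close>\<close>

text \<open>For \<open>k = 1\<close> nothing is subdivided, so numbering the edges of
  \<open>B\<close> already gives the multigraph.\<close>

lemma is_Sub_one:
  fixes B :: "'a sgraph"
  assumes wf: "wf_sgraph B"
  obtains H :: "('a, nat) multigraph" where "wf_multigraph H" "is_Sub 1 H B" "mverts H = verts B"
proof -
  have fin: "finite (verts B)" "finite (edges B)"
    using wf finite_subset[of "edges B" "Pow (verts B)"] by (auto simp: wf_sgraph_def)
  obtain g where g: "bij_betw g {0..<card (edges B)} (edges B)"
    using ex_bij_betw_nat_finite[OF fin(2)] by blast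
  define H :: "('a, nat) multigraph" where
    "H = \<lparr>mverts = verts B, medges = {0..<card (edges B)}, ends = g\<rparr>"
  have ge: "g e \<in> edges B" if "e \<in> {0..<card (edges B)}" for e using g that by (auto simp: bij_betw_def)
  have wfH: "wf_multigraph H"
    using ge wf fin by (auto simp: wf_multigraph_def wf_sgraph_def H_def)
  \<comment> \<open>There are no vertices \<open>Inner e i\<close> for \<open>k = 1\<close>, so the
    default value never occurs.\<close>
  define \<phi> where "\<phi> v = (case v of Orig w \<Rightarrow> w | Inner e i \<Rightarrow> undefined)" for v :: "('a, nat) sub_vertex"
  have V: "mverts (Sub 1 H) = Orig ` verts B" by (auto simp: Sub_def H_def)
  have or: "{fst (orient H e), snd (orient H e)} = g e" if "e \<in> {0..<card (edges B)}" for e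
  proof -
    have "card (g e) = 2" using ge[OF that] wf by (simp add: wf_sgraph_def)
    then obtain x y where "g e = {x, y}" by (auto simp: card_2_iff)
    then have "case (x, y) of (x, y) \<Rightarrow> ends H e = {x, y}" by (simp add: H_def)
    then have "case orient H e of (x, y) \<Rightarrow> ends H e = {x, y}" unfolding orient_def by (rule someI)
    then show ?thesis by (simp add: case_prod_beta H_def)
  qed
  have M: "medges (Sub 1 H) = {0..<card (edges B)} \<times> {0}" by (auto simp: Sub_def H_def)
  have im: "\<phi> ` ends (Sub 1 H) d = g (fst d)" if "d \<in> medges (Sub 1 H)" for d
    using that or[of "fst d"] unfolding M by (auto simp: Sub_def sub_point_def \<phi>_def)
  have "bij_betw \<phi> (mverts (Sub 1 H)) (verts B)"
    unfolding V by (rule bij_betw_imageI) (auto simp: inj_on_def \<phi>_def image_iff)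
  moreover have "bij_betw (\<lambda>d. \<phi> ` ends (Sub 1 H) d) (medges (Sub 1 H)) (edges B)"
  proof -
    have "bij_betw fst (medges (Sub 1 H)) {0..<card (edges B)}"
      unfolding M by (rule bij_betw_imageI) (auto simp: inj_on_def)
    from bij_betw_trans[OF this g] have "bij_betw (\<lambda>d. g (fst d)) (medges (Sub 1 H)) (edges B)"
      by (simp add: o_def)
    then show ?thesis
      using bij_betw_cong[of "medges (Sub 1 H)" "\<lambda>d. \<phi> ` ends (Sub 1 H) d" "\<lambda>d. g (fst d)"] im by blast
  qed
  ultimately have "is_Sub 1 H B"
    unfolding is_Sub_def by (intro exI[of _ \<phi>]) (simp add: \<phi>_def)
  then show thesis using that wfH by (simp add: H_def)
qed

text \<open>Both conditions become void: no cycle has order below 1, the single vertices form a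
  packing as large as the cover by all vertices, and taking all vertices of \<open>B\<close> as
  vertices of the multigraph leaves no component to examine.\<close>

lemma classes_one: "(G :: 'a sgraph) \<in> \<G>' 1 \<longleftrightarrow> wf_sgraph G" "G \<in> \<H>' 1 \<longleftrightarrow> wf_sgraph G"
proof -
  have ord: "\<not> order C < 1" if C: "is_cycle C" for C :: "'a sgraph"
  proof -
    obtain xs where "3 \<le> length xs" "distinct xs" "verts C = set xs" using C by (auto simp: is_cycle_def)
    then have "order C = length xs" "3 \<le> length xs" by (simp_all add: order_def distinct_card)
    then show ?thesis by linarith
  qed
  have "\<forall>F. induced_subgraph F G \<longrightarrow> nu 1 F = tau 1 F" if wf: "wf_sgraph G"
  proof -
    have "konig 1 G X" if "X \<subseteq> verts G" for X
    proof (rule konig_one[OF _ that])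
      show "finite X" using that wf finite_subset by (auto simp: wf_sgraph_def)
    qed
    then show ?thesis using konig_all_iff[of 1 G] wf by simp
  qed
  then show "G \<in> \<G>' 1 \<longleftrightarrow> wf_sgraph G" unfolding \<G>'_def using ord by blast
  have "\<exists>H :: ('a, nat) multigraph. wf_multigraph H \<and> is_Sub 1 H B \<and>
        (\<forall>K \<in> components_of (delete_verts G (mverts H)).
            verts K \<inter> (verts B - mverts H) \<noteq> {} \<longrightarrow> is_tree K \<and> k_paths 1 K = {})"
    if B: "B \<in> blocks G" for B
  proof -
    obtain H :: "('a, nat) multigraph" where "wf_multigraph H" "is_Sub 1 H B" "mverts H = verts B"
      by (rule is_Sub_one[OF blocksD(2)[OF B]])
    then show ?thesis by (intro exI[of _ H]) simp
  qed
  then show "G \<in> \<H>' 1 \<longleftrightarrow> wf_sgraph G" unfolding \<H>'_def by blast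
qed

theorem theorem8:
  fixes k :: nat
  assumes "k > 0" and "odd k"
  shows "(\<G>' k :: 'a sgraph set) = \<H>' k"
proof (cases "k = 1")
  case True
  then show ?thesis using classes_one by auto
next
  case False
  then have "k \<ge> 3" using assms by (cases "k = 2") auto
  then show ?thesis using konig_class_subset subdivision_class_subset assms(2) by blast
qed

end
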